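(* Let $\mathbf{V}$ be a semigroup variety of finite axiomatic rank. Then $\mathbf{V}$ is locally $\mathcal{H}$-finite if and only if at least one of the following holds: (1) $\mathbf{V}$ is locally finite; (2) every semigroup in $\mathbf{V}$ is a locally finite extension of some periodic completely regular ideal, and $\mathbf{V}$ contains none of the semigroups $L(G)$, $R(G)$ where $G$ is a Novikov--Adian group.
   Context: A semigroup variety is a class of semigroups defined by a set of semigroup identities; it is of finite axiomatic rank if for some fixed $n>0$ it can be given by a set of identities each involving at most $n$ letters. A semigroup is locally finite if each of its finitely generated subsemigroups is finite, and periodic if each of its monogenic subsemigroups is finite; a variety is locally finite if all its members are. Green's relations on a semigroup $S$: $x\,\mathcal{R}\,y\iff xS^1=yS^1$; $x\,\mathcal{L}\,y\iff S^1x=S^1y$; $\mathcal{H}=\mathcal{R}\cap\mathcal{L}$, where $S^1$ is $S$ if $S$ has an identity and $S$ with an identity adjoined otherwise. A semigroup is $\mathcal{H}$-finite if it has only finitely many $\mathcal{H}$-classes; a variety is locally $\mathcal{H}$-finite if each finitely generated semigroup in it is $\mathcal{H}$-finite. A semigroup is completely regular if it is a union of its subgroups. A semigroup $S$ is a locally finite extension of its (nonempty) ideal $J$ if the Rees quotient $S/J$ is locally finite. A Novikov--Adian group is an infinite finitely generated group of finite exponent. For a group $G$, $L(G)$ is the semigroup on the disjoint union of $G$ and a copy $\overline{G}=\{\overline{g}\mid g\in G\}$ of $G$, with multiplication extending that of $G$ and $g_1\overline{g_2}=\overline{g_1g_2}$, $\overline{g_1}g_2=\overline{g_1}\,\overline{g_2}=\overline{g_1}$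 for all $g_1,g_2\in G$. Dually, $R(G)$ is the semigroup on the disjoint union of $G$ and a copy $\widehat{G}=\{\widehat{g}\mid g\in G\}$, with multiplication extending that of $G$ and $\widehat{g_1}g_2=\widehat{g_1g_2}$, $g_1\widehat{g_2}=\widehat{g_1}\,\widehat{g_2}=\widehat{g_2}$ for all $g_1,g_2\in G$. *)

theory Defs
  imports "HOL-Algebra.Generated_Groups" "HOL-Library.Infinite_Typeclass"
begin

section \<open>Semigroups\<close>

record 'a semigrp = "'a partial_object" +
  sprod :: "['a, 'a] \<Rightarrow> 'a"  (infixl \<open>\<cdot>\<index>\<close> 70)

text \<open>Semigroups are nonempty, as usual in semigroup theory; the empty structure would have
  no (nonempty) ideal.\<close>

definition is_semigroup :: "'a semigrp \<Rightarrow> bool" where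
  "is_semigroup S \<longleftrightarrow> carrier S \<noteq> {} \<and>
     (\<forall>x\<in>carrier S. \<forall>y\<in>carrier S. x \<cdot>\<^bsub>S\<^esub> y \<in> carrier S) \<and>
     (\<forall>x\<in>carrier S. \<forall>y\<in>carrier S. \<forall>z\<in>carrier S.
        (x \<cdot>\<^bsub>S\<^esub> y) \<cdot>\<^bsub>S\<^esub> z = x \<cdot>\<^bsub>S\<^esub> (y \<cdot>\<^bsub>S\<^esub> z))"

abbreviation sub_semigrp :: "'a semigrp \<Rightarrow> 'a set \<Rightarrow> 'a semigrp" where
  "sub_semigrp S T \<equiv> \<lparr>carrier = T, sprod = sprod S\<rparr>"

inductive_set sgenerate :: "'a semigrp \<Rightarrow> 'a set \<Rightarrow> 'a set"
  for S :: "'a semigrp" and A :: "'a set" where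
    base: "a \<in> A \<Longrightarrow> a \<in> sgenerate S A"
  | prod: "x \<in> sgenerate S A \<Longrightarrow> y \<in> sgenerate S A \<Longrightarrow> x \<cdot>\<^bsub>S\<^esub> y \<in> sgenerate S A"

definition fin_generated :: "'a semigrp \<Rightarrow> bool" where
  "fin_generated S \<longleftrightarrow> (\<exists>A. finite A \<and> A \<subseteq> carrier S \<and> sgenerate S A = carrier S)"

definition locally_finite :: "'a semigrp \<Rightarrow> bool" where
  "locally_finite S \<longleftrightarrow> (\<forall>A. finite A \<and> A \<subseteq> carrier S \<longrightarrow> finite (sgenerate S A))"

definition periodic :: "'a semigrp \<Rightarrow> bool" where
  "periodic S \<longleftrightarrow> (\<forall>x\<in>carrier S. finite (sgenerate S {x}))"

definition is_subgroup_of :: "'a set \<Rightarrow> 'a semigrp \<Rightarrow> bool" where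
  "is_subgroup_of T S \<longleftrightarrow> T \<subseteq> carrier S \<and>
     (\<exists>e. group \<lparr>carrier = T, mult = sprod S, one = e\<rparr>)"

definition completely_regular :: "'a semigrp \<Rightarrow> bool" where
  "completely_regular S \<longleftrightarrow> carrier S = \<Union>{T. is_subgroup_of T S}"

section \<open>Green's relations\<close>

definition has_identity :: "'a semigrp \<Rightarrow> bool" where
  "has_identity S \<longleftrightarrow>
     (\<exists>e\<in>carrier S. \<forall>x\<in>carrier S. e \<cdot>\<^bsub>S\<^esub> x = x \<and> x \<cdot>\<^bsub>S\<^esub> e = x)"

fun lift_prod :: "('a \<Rightarrow> 'a \<Rightarrow> 'a) \<Rightarrow> 'a option \<Rightarrow> 'a option \<Rightarrow> 'a option" where
  "lift_prod f (Some x) (Some y) = Some (f x y)"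
| "lift_prod f None y = y"
| "lift_prod f x None = x"

text \<open>The semigroup \<open>S\<^sup>1\<close>: elements of \<open>S\<close> occur as \<open>Some x\<close>; the adjoined identity \<open>None\<close> belongs
  to the carrier only if \<open>S\<close> has no identity of its own.\<close>

definition with_one :: "'a semigrp \<Rightarrow> 'a option semigrp" where
  "with_one S = \<lparr>carrier = Some ` carrier S \<union> (if has_identity S then {} else {None}),
                 sprod = lift_prod (sprod S)\<rparr>"

definition greenR :: "'a semigrp \<Rightarrow> ('a \<times> 'a) set" where
  "greenR S = {(x, y). x \<in> carrier S \<and> y \<in> carrier S \<and>
     {Some x \<cdot>\<^bsub>with_one S\<^esub> s |s. s \<in> carrier (with_one S)} =
     {Some y \<cdot>\<^bsub>with_one S\<^esub> s |s. s \<in> carrier (with_one S)}}"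

definition greenL :: "'a semigrp \<Rightarrow> ('a \<times> 'a) set" where
  "greenL S = {(x, y). x \<in> carrier S \<and> y \<in> carrier S \<and>
     {s \<cdot>\<^bsub>with_one S\<^esub> Some x |s. s \<in> carrier (with_one S)} =
     {s \<cdot>\<^bsub>with_one S\<^esub> Some y |s. s \<in> carrier (with_one S)}}"

definition greenH :: "'a semigrp \<Rightarrow> ('a \<times> 'a) set" where
  "greenH S = greenR S \<inter> greenL S"

definition H_finite :: "'a semigrp \<Rightarrow> bool" where
  "H_finite S \<longleftrightarrow> finite (carrier S // greenH S)"

section \<open>Ideals and Rees quotients\<close>

definition is_ideal :: "'a set \<Rightarrow> 'a semigrp \<Rightarrow> bool" where
  "is_ideal J S \<longleftrightarrow> J \<noteq> {} \<and> J \<subseteq> carrier S \<and>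
     (\<forall>s\<in>carrier S. \<forall>j\<in>J. s \<cdot>\<^bsub>S\<^esub> j \<in> J \<and> j \<cdot>\<^bsub>S\<^esub> s \<in> J)"

text \<open>The Rees quotient \<open>S/J\<close>: elements outside \<open>J\<close> occur as \<open>Some x\<close>; the ideal \<open>J\<close> is collapsed
  to the zero element \<open>None\<close>.\<close>

fun rees_prod :: "'a semigrp \<Rightarrow> 'a set \<Rightarrow> 'a option \<Rightarrow> 'a option \<Rightarrow> 'a option" where
  "rees_prod S J (Some x) (Some y) = (if x \<cdot>\<^bsub>S\<^esub> y \<in> J then None else Some (x \<cdot>\<^bsub>S\<^esub> y))"
| "rees_prod S J None _ = None"
| "rees_prod S J _ None = None"

definition rees_quotient :: "'a semigrp \<Rightarrow> 'a set \<Rightarrow> 'a option semigrp" where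
  "rees_quotient S J =
     \<lparr>carrier = insert None (Some ` (carrier S - J)), sprod = rees_prod S J\<rparr>"

definition locally_finite_extension :: "'a semigrp \<Rightarrow> 'a set \<Rightarrow> bool" where
  "locally_finite_extension S J \<longleftrightarrow> is_ideal J S \<and> locally_finite (rees_quotient S J)"

section \<open>Varieties\<close>

text \<open>A semigroup word is a nonempty list of letters. The value on the empty list is left
  unspecified and is never used.\<close>

fun word_val :: "'a semigrp \<Rightarrow> (nat \<Rightarrow> 'a) \<Rightarrow> nat list \<Rightarrow> 'a" where
  "word_val S \<phi> [x] = \<phi> x"
| "word_val S \<phi> (x # y # w) = \<phi> x \<cdot>\<^bsub>S\<^esub> word_val S \<phi> (y # w)"

definition satisfies :: "'a semigrp \<Rightarrow> nat list \<times> nat list \<Rightarrow> bool" where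
  "satisfies S p \<longleftrightarrow>
     (\<forall>\<phi>. (\<forall>i. \<phi> i \<in> carrier S) \<longrightarrow> word_val S \<phi> (fst p) = word_val S \<phi> (snd p))"

text \<open>The members, with elements in the type \<open>'a\<close>, of the variety defined by the identities
  \<open>E\<close>.\<close>

definition variety :: "(nat list \<times> nat list) set \<Rightarrow> 'a semigrp set" where
  "variety E = {S. is_semigroup S \<and> (\<forall>p\<in>E. satisfies S p)}"

definition semigroup_identities :: "(nat list \<times> nat list) set \<Rightarrow> bool" where
  "semigroup_identities E \<longleftrightarrow> (\<forall>(u, v)\<in>E. u \<noteq> [] \<and> v \<noteq> [])"

definition bounded_letters :: "(nat list \<times> nat list) set \<Rightarrow> bool" where
  "bounded_letters E \<longleftrightarrow> (\<exists>n>0. \<forall>(u, v)\<in>E. card (set u \<union> set v) \<le> n)"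

section \<open>Novikov--Adian groups and the semigroups \<open>L(G)\<close>, \<open>R(G)\<close>\<close>

definition novikov_adian :: "'g monoid \<Rightarrow> bool" where
  "novikov_adian G \<longleftrightarrow> group G \<and> infinite (carrier G) \<and>
     (\<exists>A. finite A \<and> A \<subseteq> carrier G \<and> generate G A = carrier G) \<and>
     (\<exists>n::nat. n > 0 \<and> (\<forall>x\<in>carrier G. x [^]\<^bsub>G\<^esub> n = \<one>\<^bsub>G\<^esub>))"

text \<open>In both constructions \<open>Inl g\<close> is the element \<open>g\<close> of \<open>G\<close> and \<open>Inr g\<close> its copy
  (barred in \<open>L(G)\<close>, hatted in \<open>R(G)\<close>).\<close>

fun L_prod :: "'g monoid \<Rightarrow> 'g + 'g \<Rightarrow> 'g + 'g \<Rightarrow> 'g + 'g" where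
  "L_prod G (Inl a) (Inl b) = Inl (a \<otimes>\<^bsub>G\<^esub> b)"
| "L_prod G (Inl a) (Inr b) = Inr (a \<otimes>\<^bsub>G\<^esub> b)"
| "L_prod G (Inr a) (Inl b) = Inr a"
| "L_prod G (Inr a) (Inr b) = Inr a"

fun R_prod :: "'g monoid \<Rightarrow> 'g + 'g \<Rightarrow> 'g + 'g \<Rightarrow> 'g + 'g" where
  "R_prod G (Inl a) (Inl b) = Inl (a \<otimes>\<^bsub>G\<^esub> b)"
| "R_prod G (Inr a) (Inl b) = Inr (a \<otimes>\<^bsub>G\<^esub> b)"
| "R_prod G (Inl a) (Inr b) = Inr b"
| "R_prod G (Inr a) (Inr b) = Inr b"

definition L_semigrp :: "'g monoid \<Rightarrow> ('g + 'g) semigrp" where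
  "L_semigrp G = \<lparr>carrier = carrier G <+> carrier G, sprod = L_prod G\<rparr>"

definition R_semigrp :: "'g monoid \<Rightarrow> ('g + 'g) semigrp" where
  "R_semigrp G = \<lparr>carrier = carrier G <+> carrier G, sprod = R_prod G\<rparr>"

end

(*
  Let V be locally H-finite and let S0 in V be infinite and finitely generated. If V contained the
  positive integers, the semigroup P = <e, a | ee = e, ea = a, ae = aa = 0> or its dual, or the
  monoid N = <a | aa = 0>, then respectively the positive integers, a subsemigroup of P x S0 (or its
  dual), or the subsemigroup of N x S0^S0 generated by constants and the identity would have
  infinitely many H-classes. The identities failing in these small semigroups show that the x with
  x = x^n for some n > 1 form an ideal of every member of V. Outside this ideal H-classes are
  trivial, so the Rees quotient is locally finite; and in L(G) barred elements are R-classes.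

  Conversely, let J be the ideal of (2) in S generated by a finite set A, and induct on |A|. An
  element of J stays in its R-class when multiplied on the right by one of its divisors, so up to R
  every element of J is a letter, ends in a letter preceded by an element outside J, or is b a with
  b generated by A - {a}. By induction b runs over finitely many H-classes, and an infinite one is
  a maximal subgroup H, finitely generated by Schreier's argument. If H a met infinitely many
  R-classes, the quotient of H acting on these R-classes would be a Novikov--Adian group G with
  L(G) in V. Dually for L-classes.
*)

theory Submission
  imports Defs "HOL-Library.Countable_Set"
begin

section \<open>Semigroups, adjoined identities and opposites\<close>

text \<open>The obstacle in the forward direction is that an infinite finitely generated
  \<open>S0\<close> may itself have few H-classes. It is combined with a small semigroup that breaks
  its R-equivalences. For \<open>P3\<close> every right factor leaves the relevant elements, so this
  is immediate. For \<open>N21\<close> right multiplication by constants survives. Few R-classes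
  then only say that left multiplication by any \<open>w\<close> has the form y to s y t with
  \<open>s\<close> from a finite set, and a separate commutation argument has to show that such an
  \<open>S0\<close> is finite.

  In the converse, the subgroup \<open>H\<close> need not act faithfully on the R-classes, so the
  group entering L(G) is \<open>H\<close> modulo a kernel. An identity of \<open>S\<close> must be
  tested at every base point of the orbit to decide equality modulo that kernel. L-classes are
  treated as R-classes of the opposite semigroup, which satisfies the reversed identities.

  The conditions to be compared speak of semigroups and groups on four unrelated infinite types.
  They can be compared because finitely generated semigroups and groups are countable and so have
  copies on every infinite type.\<close>

lemma is_semigroupD:
  assumes "is_semigroup S"
  shows semigroup_closed: "x \<in> carrier S \<Longrightarrow> y \<in> carrier S \<Longrightarrow> x \<cdot>\<^bsub>S\<^esub> y \<in> carrier S"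
    and semigroup_assoc: "x \<in> carrier S \<Longrightarrow> y \<in> carrier S \<Longrightarrow> z \<in> carrier S \<Longrightarrow>
      (x \<cdot>\<^bsub>S\<^esub> y) \<cdot>\<^bsub>S\<^esub> z = x \<cdot>\<^bsub>S\<^esub> (y \<cdot>\<^bsub>S\<^esub> z)"
    and semigroup_nonempty: "carrier S \<noteq> {}"
  using assms unfolding is_semigroup_def by blast+

text \<open>Unlike \<open>with_one\<close>, this always adjoins a new identity. Green's relations do not notice the
  difference.\<close>

definition adj :: "'a semigrp \<Rightarrow> 'a option monoid" where
  "adj S = \<lparr>carrier = insert None (Some ` carrier S), mult = lift_prod (sprod S), one = None\<rparr>"

lemma carrier_adj: "carrier (adj S) = insert None (Some ` carrier S)"
  by (simp add: adj_def)

lemma adj_simps [simp]: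
  "Some x \<in> carrier (adj S) \<longleftrightarrow> x \<in> carrier S"
  "None \<in> carrier (adj S)"
  "\<one>\<^bsub>adj S\<^esub> = None"
  "Some x \<otimes>\<^bsub>adj S\<^esub> Some y = Some (x \<cdot>\<^bsub>S\<^esub> y)"
  "None \<otimes>\<^bsub>adj S\<^esub> u = u"
  "u \<otimes>\<^bsub>adj S\<^esub> None = u"
  by (cases u; auto simp: adj_def)+

lemma monoid_adj: "is_semigroup S \<Longrightarrow> Group.monoid (adj S)"
  by (rule monoidI) (auto simp: carrier_adj semigroup_closed semigroup_assoc)

definition opp :: "'a semigrp \<Rightarrow> 'a semigrp" where
  "opp S = \<lparr>carrier = carrier S, sprod = (\<lambda>x y. y \<cdot>\<^bsub>S\<^esub> x)\<rparr>"

lemma opp_simps [simp]: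
  "carrier (opp S) = carrier S"
  "x \<cdot>\<^bsub>opp S\<^esub> y = y \<cdot>\<^bsub>S\<^esub> x"
  "opp (opp S) = S"
  by (simp_all add: opp_def)

lemma is_semigroup_opp [simp]: "is_semigroup (opp S) \<longleftrightarrow> is_semigroup S"
  unfolding is_semigroup_def by auto

lemma adj_opp [simp]: "u \<otimes>\<^bsub>adj (opp S)\<^esub> v = v \<otimes>\<^bsub>adj S\<^esub> u"
  by (cases u; cases v) auto

subsection \<open>Generated subsemigroups\<close>

lemma sgenerate_subset:
  assumes "is_semigroup S" "A \<subseteq> carrier S"
  shows "sgenerate S A \<subseteq> carrier S"
proof
  fix x assume "x \<in> sgenerate S A"
  then show "x \<in> carrier S"
    by induction (use assms semigroup_closed in auto)
qed

lemma sgenerate_mono: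
  assumes "A \<subseteq> B"
  shows "sgenerate S A \<subseteq> sgenerate S B"
proof
  fix x assume "x \<in> sgenerate S A"
  then show "x \<in> sgenerate S B"
    by induction (use assms in \<open>auto intro: sgenerate.intros\<close>)
qed

lemma sgenerate_opp [simp]: "sgenerate (opp S) A = sgenerate S A"
proof -
  have "sgenerate S A \<subseteq> sgenerate (opp S) A" for S :: "'a semigrp"
  proof
    fix x assume "x \<in> sgenerate S A"
    then show "x \<in> sgenerate (opp S) A"
      by induction (auto intro: sgenerate.base sgenerate.prod[of _ "opp S", simplified])
  qed
  from this[of S] this[of "opp S"] show ?thesis by auto
qed

lemma sgenerate_induct_right [consumes 3, case_names base step]:
  assumes "is_semigroup S" "A \<subseteq> carrier S" "x \<in> sgenerate S A"
    and base: "\<And>a. a \<in> A \<Longrightarrow> P a"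
    and step: "\<And>x a. x \<in> sgenerate S A \<Longrightarrow> P x \<Longrightarrow> a \<in> A \<Longrightarrow> P (x \<cdot>\<^bsub>S\<^esub> a)"
  shows "P x"
proof -
  \<comment> \<open>Strengthening: right multiplication by \<open>y\<close> also preserves
    \<open>P\<close>. With associativity this claim passes from two factors to their
    product.\<close>
  have "P y \<and> (\<forall>x\<in>sgenerate S A. P x \<longrightarrow> P (x \<cdot>\<^bsub>S\<^esub> y))" if "y \<in> sgenerate S A" for y
    using that
  proof induction
    case (base a)
    then show ?case using assms by auto
  next
    case (prod y z)
    have "x \<cdot>\<^bsub>S\<^esub> (y \<cdot>\<^bsub>S\<^esub> z) = x \<cdot>\<^bsub>S\<^esub> y \<cdot>\<^bsub>S\<^esub> z" if "x \<in> sgenerate S A" for x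
      using that prod sgenerate_subset[OF assms(1,2)] semigroup_assoc[OF assms(1)]
      by (metis subsetD)
    then show ?case using prod by (auto intro: sgenerate.prod)
  qed
  then show ?thesis using assms(3) by blast
qed

lemma sgenerate_induct_left [consumes 3, case_names base step]:
  assumes "is_semigroup S" "A \<subseteq> carrier S" "x \<in> sgenerate S A"
    and "\<And>a. a \<in> A \<Longrightarrow> P a"
    and "\<And>x a. x \<in> sgenerate S A \<Longrightarrow> P x \<Longrightarrow> a \<in> A \<Longrightarrow> P (a \<cdot>\<^bsub>S\<^esub> x)"
  shows "P x"
  using sgenerate_induct_right[of "opp S" A x P] assms by simp

lemma sgenerate_sub [simp]: "sgenerate (sub_semigrp S T) A = sgenerate S A"
proof -
  have "x \<in> sgenerate S A" if "x \<in> sgenerate (sub_semigrp S T) A" for x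
    using that by induction (auto intro: sgenerate.intros)
  moreover have "x \<in> sgenerate (sub_semigrp S T) A" if "x \<in> sgenerate S A" for x
    using that
    by induction (auto intro: sgenerate.base sgenerate.prod[of _ "sub_semigrp S T", simplified])
  ultimately show ?thesis by blast
qed

lemma sgenerate_empty [simp]: "sgenerate S {} = {}"
proof -
  have False if "x \<in> sgenerate S {}" for x
    using that by induction auto
  then show ?thesis by blast
qed

lemma fin_generated_sub: "finite A \<Longrightarrow> fin_generated (sub_semigrp S (sgenerate S A))"
  unfolding fin_generated_def by (auto intro!: exI[of _ A] sgenerate.base)

lemma fin_generated_opp [simp]: "fin_generated (opp S) \<longleftrightarrow> fin_generated S"
  by (simp add: fin_generated_def)

text \<open>Every element is a nonempty word, coded as its first letter and the list of the others.
  Countability is what allows finitely generated semigroups to be moved between infinite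
  types.\<close>

lemma countable_sgenerate:
  assumes "is_semigroup S" "A \<subseteq> carrier S" "countable A"
  shows "countable (sgenerate S A)"
proof -
  have "x \<in> (\<lambda>(a, l). foldl (sprod S) a l) ` (A \<times> lists A)" if "x \<in> sgenerate S A" for x
    using assms(1,2) that
  proof (induction rule: sgenerate_induct_right)
    case (base a)
    then show ?case by (auto intro!: image_eqI[of _ _ "(a, [])"])
  next
    case (step x a)
    then obtain b l where "b \<in> A" "l \<in> lists A" "x = foldl (sprod S) b l" by auto
    then show ?case using step by (auto intro!: image_eqI[of _ _ "(b, l @ [a])"])
  qed
  then have "sgenerate S A \<subseteq> (\<lambda>(a, l). foldl (sprod S) a l) ` (A \<times> lists A)" by blast
  then show ?thesis using assms(3) by (meson countable_SIGMA countable_image countable_lists countable_subset)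
qed

subsection \<open>Green's relations\<close>

text \<open>If \<open>S\<close> has an identity, then x already lies in xS, so both forms of
  \<open>with_one\<close> yield the right ideal consisting of x and xS. This removes the case
  distinction from all later arguments.\<close>

lemma greenR_iff:
  assumes "is_semigroup S"
  shows "(x, y) \<in> greenR S \<longleftrightarrow> x \<in> carrier S \<and> y \<in> carrier S \<and>
    (x = y \<or> (\<exists>u\<in>carrier S. x \<cdot>\<^bsub>S\<^esub> u = y) \<and> (\<exists>v\<in>carrier S. y \<cdot>\<^bsub>S\<^esub> v = x))"
proof -
  have ideal: "{Some x \<cdot>\<^bsub>with_one S\<^esub> s |s. s \<in> carrier (with_one S)} =
      Some ` insert x ((\<lambda>s. x \<cdot>\<^bsub>S\<^esub> s) ` carrier S)" if "x \<in> carrier S" for x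
  proof (cases "has_identity S")
    case True
    then obtain e where "e \<in> carrier S" "x \<cdot>\<^bsub>S\<^esub> e = x"
      using \<open>x \<in> carrier S\<close> by (auto simp: has_identity_def)
    then have "x \<in> (\<lambda>s. x \<cdot>\<^bsub>S\<^esub> s) ` carrier S" by force
    moreover have "{Some x \<cdot>\<^bsub>with_one S\<^esub> s |s. s \<in> carrier (with_one S)} =
        Some ` (\<lambda>s. x \<cdot>\<^bsub>S\<^esub> s) ` carrier S"
      using True by (simp add: with_one_def Setcompr_eq_image image_image)
    ultimately show ?thesis by (simp add: insert_absorb)
  next
    case False
    then show ?thesis unfolding Setcompr_eq_image by (simp add: with_one_def image_image)
  qed
  have sub: "insert x ((\<lambda>s. x \<cdot>\<^bsub>S\<^esub> s) ` carrier S) \<subseteq> insert y ((\<lambda>s. y \<cdot>\<^bsub>S\<^esub> s) ` carrier S)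
      \<longleftrightarrow> x = y \<or> (\<exists>v\<in>carrier S. y \<cdot>\<^bsub>S\<^esub> v = x)"
    if "x \<in> carrier S" "y \<in> carrier S" for x y
  proof
    assume "x = y \<or> (\<exists>v\<in>carrier S. y \<cdot>\<^bsub>S\<^esub> v = x)"
    then show "insert x ((\<lambda>s. x \<cdot>\<^bsub>S\<^esub> s) ` carrier S) \<subseteq> insert y ((\<lambda>s. y \<cdot>\<^bsub>S\<^esub> s) ` carrier S)"
    proof (elim disjE bexE)
      fix v assume v: "v \<in> carrier S" "y \<cdot>\<^bsub>S\<^esub> v = x"
      have "x \<cdot>\<^bsub>S\<^esub> s = y \<cdot>\<^bsub>S\<^esub> (v \<cdot>\<^bsub>S\<^esub> s)" if "s \<in> carrier S" for s
        using semigroup_assoc[OF assms \<open>y \<in> carrier S\<close> v(1) that] v(2) by simp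
      then show ?thesis using v semigroup_closed[OF assms v(1)] by blast
    qed simp
  qed (use that in auto)
  have eq: "Some ` X = Some ` Y \<longleftrightarrow> X \<subseteq> Y \<and> Y \<subseteq> X" for X Y :: "'a set"
    by (auto simp: inj_image_eq_iff[OF inj_Some])
  show ?thesis
  proof (cases "x \<in> carrier S \<and> y \<in> carrier S")
    case True
    then have xy: "x \<in> carrier S" "y \<in> carrier S" by auto
    have "(x, y) \<in> greenR S \<longleftrightarrow>
        Some ` insert x ((\<lambda>s. x \<cdot>\<^bsub>S\<^esub> s) ` carrier S) = Some ` insert y ((\<lambda>s. y \<cdot>\<^bsub>S\<^esub> s) ` carrier S)"
      unfolding greenR_def mem_Collect_eq case_prod_conv ideal[OF xy(1)] ideal[OF xy(2)]
      using xy by (simp only: simp_thms)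
    also have "\<dots> \<longleftrightarrow> (x = y \<or> (\<exists>v\<in>carrier S. y \<cdot>\<^bsub>S\<^esub> v = x)) \<and> (y = x \<or> (\<exists>u\<in>carrier S. x \<cdot>\<^bsub>S\<^esub> u = y))"
      unfolding eq sub[OF xy] sub[OF xy(2,1)] by (rule refl)
    finally show ?thesis using xy by auto
  qed (auto simp: greenR_def)
qed

lemma with_one_opp: "with_one (opp S) = \<lparr>carrier = carrier (with_one S),
    sprod = (\<lambda>u v. v \<cdot>\<^bsub>with_one S\<^esub> u)\<rparr>"
proof -
  have "lift_prod (sprod (opp S)) u v = lift_prod (sprod S) v u" for u v
    by (cases u; cases v) auto
  then show ?thesis by (auto simp: with_one_def has_identity_def)
qed

lemma green_opp: "greenR (opp S) = greenL S" "greenL (opp S) = greenR S"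
  by (simp_all add: greenR_def greenL_def with_one_opp)

lemma H_finite_opp [simp]: "H_finite (opp S) \<longleftrightarrow> H_finite S"
  by (simp add: H_finite_def greenH_def green_opp Int_commute)

lemma greenL_iff:
  assumes "is_semigroup S"
  shows "(x, y) \<in> greenL S \<longleftrightarrow> x \<in> carrier S \<and> y \<in> carrier S \<and>
    (x = y \<or> (\<exists>u\<in>carrier S. u \<cdot>\<^bsub>S\<^esub> x = y) \<and> (\<exists>v\<in>carrier S. v \<cdot>\<^bsub>S\<^esub> y = x))"
  using greenR_iff[of "opp S"] assms by (simp add: green_opp)

lemma green_equiv:
  "equiv (carrier S) (greenR S)" "equiv (carrier S) (greenL S)" "equiv (carrier S) (greenH S)"
proof -
  have equal: "equiv X {(x, y). x \<in> X \<and> y \<in> X \<and> f x = f y}" for X :: "'a set" and f :: "'a \<Rightarrow> 'b"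
    by (auto intro!: equivI refl_onI symI transI)
  show R: "equiv (carrier S) (greenR S)" and L: "equiv (carrier S) (greenL S)"
    unfolding greenR_def greenL_def by (rule equal)+
  show "equiv (carrier S) (greenH S)"
    using R L unfolding greenH_def equiv_def refl_on_def sym_def trans_def by blast
qed

section \<open>Counting Green classes\<close>

lemma finite_quotient_iff:
  assumes "equiv X r"
  shows "finite (X // r) \<longleftrightarrow> (\<exists>F. finite F \<and> F \<subseteq> X \<and> (\<forall>x\<in>X. \<exists>y\<in>F. (x, y) \<in> r))"
proof
  assume fin: "finite (X // r)"
  define F where "F = (\<lambda>c. SOME x. x \<in> c) ` (X // r)"
  have rep: "(SOME x. x \<in> c) \<in> c" if "c \<in> X // r" for c
    using in_quotient_imp_non_empty[OF assms that] by (simp add: some_in_eq)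
  have "F \<subseteq> X" using rep in_quotient_imp_subset[OF assms] by (auto simp: F_def)
  moreover have "\<exists>y\<in>F. (x, y) \<in> r" if "x \<in> X" for x
  proof -
    have "r `` {x} \<in> X // r" using that by (rule quotientI)
    then have "(SOME y. y \<in> r `` {x}) \<in> F" "(SOME y. y \<in> r `` {x}) \<in> r `` {x}"
      using rep unfolding F_def by blast+
    then show ?thesis by blast
  qed
  ultimately show "\<exists>F. finite F \<and> F \<subseteq> X \<and> (\<forall>x\<in>X. \<exists>y\<in>F. (x, y) \<in> r)"
    using fin by (intro exI[of _ F]) (auto simp: F_def)
next
  assume "\<exists>F. finite F \<and> F \<subseteq> X \<and> (\<forall>x\<in>X. \<exists>y\<in>F. (x, y) \<in> r)"
  then obtain F where F: "finite F" "\<forall>x\<in>X. \<exists>y\<in>F. (x, y) \<in> r" by blast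
  have "X // r \<subseteq> (\<lambda>y. r `` {y}) ` F"
  proof
    fix c assume "c \<in> X // r"
    then obtain x where x: "x \<in> X" "c = r `` {x}" by (rule quotientE)
    with F(2) obtain y where "y \<in> F" "(x, y) \<in> r" by blast
    with x show "c \<in> (\<lambda>y. r `` {y}) ` F" using equiv_class_eq[OF assms] by blast
  qed
  then show "finite (X // r)" using F(1) by (meson finite_imageI finite_subset)
qed

text \<open>An H-class is the intersection of an R-class and an L-class, so the two sides can be
  counted separately.\<close>

lemma H_finite_iff:
  "H_finite S \<longleftrightarrow> finite (carrier S // greenR S) \<and> finite (carrier S // greenL S)"
proof
  assume "H_finite S"
  then obtain F where "finite F" "F \<subseteq> carrier S" "\<forall>x\<in>carrier S. \<exists>y\<in>F. (x, y) \<in> greenH S"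
    unfolding H_finite_def finite_quotient_iff[OF green_equiv(3)] by blast
  then show "finite (carrier S // greenR S) \<and> finite (carrier S // greenL S)"
    unfolding finite_quotient_iff[OF green_equiv(1)] finite_quotient_iff[OF green_equiv(2)]
    by (intro conjI exI[of _ F]) (auto simp: greenH_def)
next
  assume fin: "finite (carrier S // greenR S) \<and> finite (carrier S // greenL S)"
  have "carrier S // greenH S \<subseteq>
      (\<lambda>(a, b). a \<inter> b) ` ((carrier S // greenR S) \<times> (carrier S // greenL S))"
  proof
    fix c assume "c \<in> carrier S // greenH S"
    then obtain x where x: "x \<in> carrier S" "c = greenH S `` {x}" by (rule quotientE)
    then have "c = greenR S `` {x} \<inter> greenL S `` {x}" by (auto simp: greenH_def)
    with x(1) show "c \<in> (\<lambda>(a, b). a \<inter> b) ` ((carrier S // greenR S) \<times> (carrier S // greenL S))"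
      by (auto intro!: image_eqI[of _ _ "(greenR S `` {x}, greenL S `` {x})"] quotientI)
  qed
  with fin show "H_finite S"
    unfolding H_finite_def by (meson finite_SigmaI finite_imageI finite_subset)
qed

lemma H_finite_finite: "finite (carrier S) \<Longrightarrow> H_finite S"
  unfolding H_finite_def using finite_quotient_iff[OF green_equiv(3)] green_equiv(3)
  by (metis equivE order_refl refl_onD)

text \<open>The last hypothesis makes the R-class of each element of \<open>X\<close> a singleton,
  so any set of representatives of the R-classes contains \<open>X\<close>. Applied to an infinite
  \<open>X\<close> this refutes H-finiteness; in the forward direction it also bounds the complement
  of the ideal.\<close>

lemma H_finite_trivial_R:
  assumes "is_semigroup S" "H_finite S" "X \<subseteq> carrier S"
    and "\<And>x u. x \<in> X \<Longrightarrow> u \<in> carrier S \<Longrightarrow> (\<exists>v\<in>carrier S. x \<cdot>\<^bsub>S\<^esub> u \<cdot>\<^bsub>S\<^esub> v = x) \<Longrightarrow> x \<cdot>\<^bsub>S\<^esub> u = x"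
  shows "finite X"
proof -
  obtain F where F: "finite F" "\<forall>x\<in>carrier S. \<exists>y\<in>F. (x, y) \<in> greenR S"
    using assms(2) unfolding H_finite_iff finite_quotient_iff[OF green_equiv(1)] by blast
  have "X \<subseteq> F"
  proof
    fix x assume x: "x \<in> X"
    then obtain y where y: "y \<in> F" "(x, y) \<in> greenR S" using F assms(3) by blast
    have "x = y"
    proof (rule ccontr)
      assume "x \<noteq> y"
      then obtain u v where "u \<in> carrier S" "v \<in> carrier S" "x \<cdot>\<^bsub>S\<^esub> u = y" "y \<cdot>\<^bsub>S\<^esub> v = x"
        using y(2) greenR_iff[OF assms(1)] by auto
      then show False using assms(4)[OF x] \<open>x \<noteq> y\<close> by metis
    qed
    with y show "x \<in> F" by simp
  qed
  then show ?thesis using F finite_subset by blast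
qed

section \<open>Varieties\<close>

lemma word_val_hom:
  assumes "\<And>x y. x \<in> carrier T \<Longrightarrow> y \<in> carrier T \<Longrightarrow> x \<cdot>\<^bsub>T\<^esub> y \<in> carrier T"
    and "\<And>x y. x \<in> carrier T \<Longrightarrow> y \<in> carrier T \<Longrightarrow> f (x \<cdot>\<^bsub>T\<^esub> y) = f x \<cdot>\<^bsub>A\<^esub> f y"
    and "\<And>i. \<phi> i \<in> carrier T" "w \<noteq> []"
  shows "word_val T \<phi> w \<in> carrier T" "f (word_val T \<phi> w) = word_val A (f \<circ> \<phi>) w"
proof -
  have "word_val T \<phi> w \<in> carrier T \<and> f (word_val T \<phi> w) = word_val A (f \<circ> \<phi>) w"
    using assms(4) by (induction w rule: induct_list012) (auto simp: assms(1-3))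
  then show "word_val T \<phi> w \<in> carrier T" "f (word_val T \<phi> w) = word_val A (f \<circ> \<phi>) w" by auto
qed

lemma word_val_append:
  assumes "is_semigroup S" "\<And>i. \<phi> i \<in> carrier S" "u \<noteq> []" "v \<noteq> []"
  shows "word_val S \<phi> (u @ v) = word_val S \<phi> u \<cdot>\<^bsub>S\<^esub> word_val S \<phi> v"
proof -
  have cl: "word_val S \<phi> w \<in> carrier S" if "w \<noteq> []" for w
    using word_val_hom(1)[of S "\<lambda>x. x" S \<phi> w] semigroup_closed[OF assms(1)] assms(2) that by simp
  obtain y v' where v: "v = y # v'" using assms(4) by (cases v) auto
  show ?thesis using assms(3)
  proof (induction u rule: induct_list012)
    case (3 x y zs)
    then show ?case using assms(1,2,4) cl by (simp add: semigroup_assoc)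
  qed (auto simp: v)
qed

lemma identityD:
  assumes "S \<in> variety E" "(u, v) \<in> E" "\<And>i. \<phi> i \<in> carrier S"
  shows "word_val S \<phi> u = word_val S \<phi> v"
  using assms unfolding variety_def satisfies_def by fastforce

lemma identity_nonempty: "semigroup_identities E \<Longrightarrow> (u, v) \<in> E \<Longrightarrow> u \<noteq> [] \<and> v \<noteq> []"
  unfolding semigroup_identities_def by auto

lemma variety_semigroup: "S \<in> variety E \<Longrightarrow> is_semigroup S"
  by (simp add: variety_def)

text \<open>\<open>f\<close> and the maps \<open>g i\<close> embed \<open>T\<close> into the product
  of \<open>A\<close> with a power of \<open>B\<close>. This shape covers P x S0, N x S0^S0 and, for
  empty \<open>I\<close>, embeddings into a single member.\<close>

lemma variety_subdirect:
  assumes E: "semigroup_identities E" "A \<in> variety E" "B \<in> variety E"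
    and ne: "carrier T \<noteq> {}"
    and cl: "\<And>x y. x \<in> carrier T \<Longrightarrow> y \<in> carrier T \<Longrightarrow> x \<cdot>\<^bsub>T\<^esub> y \<in> carrier T"
    and f: "\<And>x. x \<in> carrier T \<Longrightarrow> f x \<in> carrier A"
      "\<And>x y. x \<in> carrier T \<Longrightarrow> y \<in> carrier T \<Longrightarrow> f (x \<cdot>\<^bsub>T\<^esub> y) = f x \<cdot>\<^bsub>A\<^esub> f y"
    and g: "\<And>i x. i \<in> I \<Longrightarrow> x \<in> carrier T \<Longrightarrow> g i x \<in> carrier B"
      "\<And>i x y. i \<in> I \<Longrightarrow> x \<in> carrier T \<Longrightarrow> y \<in> carrier T \<Longrightarrow> g i (x \<cdot>\<^bsub>T\<^esub> y) = g i x \<cdot>\<^bsub>B\<^esub> g i y"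
    and sep: "\<And>x y. x \<in> carrier T \<Longrightarrow> y \<in> carrier T \<Longrightarrow> f x = f y \<Longrightarrow> (\<forall>i\<in>I. g i x = g i y) \<Longrightarrow> x = y"
  shows "T \<in> variety E"
proof -
  have semi: "is_semigroup T"
    unfolding is_semigroup_def
  proof (intro conjI ballI)
    fix x y z assume xyz: "x \<in> carrier T" "y \<in> carrier T" "z \<in> carrier T"
    show "x \<cdot>\<^bsub>T\<^esub> y \<cdot>\<^bsub>T\<^esub> z = x \<cdot>\<^bsub>T\<^esub> (y \<cdot>\<^bsub>T\<^esub> z)"
      using xyz E(2,3)[THEN variety_semigroup]
      by (rule_tac sep) (auto simp: f g cl semigroup_assoc)
  qed (use ne cl in auto)
  have "satisfies T (u, v)" if "(u, v) \<in> E" for u v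
    unfolding satisfies_def fst_conv snd_conv
  proof (intro allI impI)
    fix \<phi> :: "nat \<Rightarrow> _" assume "\<forall>i. \<phi> i \<in> carrier T"
    then have \<phi>: "\<And>i. \<phi> i \<in> carrier T" by blast
    have uv: "u \<noteq> []" "v \<noteq> []" using identity_nonempty[OF E(1) that] by auto
    have hf: "word_val T \<phi> w \<in> carrier T" "f (word_val T \<phi> w) = word_val A (f \<circ> \<phi>) w"
      if "w \<noteq> []" for w
      using word_val_hom[of T f A \<phi> w] cl f(2) \<phi> that by blast+
    have "f (word_val T \<phi> u) = f (word_val T \<phi> v)"
      unfolding hf(2)[OF uv(1)] hf(2)[OF uv(2)] using identityD[OF E(2) that] f(1) \<phi> by simp
    moreover have "g i (word_val T \<phi> u) = g i (word_val T \<phi> v)" if "i \<in> I" for i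
    proof -
      have hg: "g i (word_val T \<phi> w) = word_val B (g i \<circ> \<phi>) w" if "w \<noteq> []" for w
        using word_val_hom(2)[of T "g i" B \<phi> w] cl g(2)[OF \<open>i \<in> I\<close>] \<phi> that by blast
      show ?thesis
        unfolding hg[OF uv(1)] hg[OF uv(2)]
        using identityD[OF E(3) \<open>(u, v) \<in> E\<close>] g(1)[OF that] \<phi> by simp
    qed
    ultimately show "word_val T \<phi> u = word_val T \<phi> v"
      using hf(1) uv by (rule_tac sep) auto
  qed
  then show ?thesis using semi by (auto simp: variety_def)
qed

lemma variety_inj:
  assumes "semigroup_identities E" "A \<in> variety E" "carrier T \<noteq> {}"
    and "\<And>x y. x \<in> carrier T \<Longrightarrow> y \<in> carrier T \<Longrightarrow> x \<cdot>\<^bsub>T\<^esub> y \<in> carrier T"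
    and "\<And>x. x \<in> carrier T \<Longrightarrow> f x \<in> carrier A"
    and "\<And>x y. x \<in> carrier T \<Longrightarrow> y \<in> carrier T \<Longrightarrow> f (x \<cdot>\<^bsub>T\<^esub> y) = f x \<cdot>\<^bsub>A\<^esub> f y"
    and "inj_on f (carrier T)"
  shows "T \<in> variety E"
  by (rule variety_subdirect[where A = A and B = A and f = f and I = "{}" and g = "\<lambda>_. f"])
    (use assms in \<open>auto simp: inj_on_def\<close>)

lemma variety_sub:
  assumes "semigroup_identities E" "S \<in> variety E" "A \<subseteq> carrier S" "A \<noteq> {}"
  shows "sub_semigrp S (sgenerate S A) \<in> variety E"
  using assms sgenerate_subset[OF variety_semigroup[OF assms(2)] assms(3)]
  by (rule_tac variety_inj[where f = "\<lambda>x. x" and A = S]) (auto intro: sgenerate.intros)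

subsection \<open>Reversed identities\<close>

definition rev_ids :: "(nat list \<times> nat list) set \<Rightarrow> (nat list \<times> nat list) set" where
  "rev_ids E = map_prod rev rev ` E"

lemma semigroup_identities_rev [simp]:
  "semigroup_identities (rev_ids E) \<longleftrightarrow> semigroup_identities E"
  by (fastforce simp: semigroup_identities_def rev_ids_def)

lemma rev_rev_ids [simp]: "rev_ids (rev_ids E) = E"
  by (force simp: rev_ids_def image_image map_prod_def)

lemma word_val_opp:
  assumes "is_semigroup S" "\<And>i. \<phi> i \<in> carrier S" "w \<noteq> []"
  shows "word_val (opp S) \<phi> (rev w) = word_val S \<phi> w"
  using assms(3)
proof (induction w rule: induct_list012)
  case (3 x y zs)
  then show ?case
    using word_val_append[of "opp S" \<phi> "rev (y # zs)" "[x]"] assms(1,2) by simp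
qed auto

lemma opp_variety:
  assumes "semigroup_identities E" "S \<in> variety E"
  shows "opp S \<in> variety (rev_ids E)"
proof -
  have S: "is_semigroup S" using assms(2) by (rule variety_semigroup)
  have "satisfies (opp S) (rev u, rev v)" if "(u, v) \<in> E" for u v
    unfolding satisfies_def fst_conv snd_conv opp_simps(1)
    using word_val_opp[OF S] identityD[OF assms(2) that] identity_nonempty[OF assms(1) that] by auto
  then show ?thesis using S by (auto simp: variety_def rev_ids_def)
qed

lemma opp_variety_iff:
  assumes "semigroup_identities E"
  shows "opp S \<in> variety (rev_ids E) \<longleftrightarrow> S \<in> variety E"
  using opp_variety[of E S] opp_variety[of "rev_ids E" "opp S"] assms by auto

subsection \<open>Change of the underlying type\<close>

lemma sgenerate_image:
  assumes "is_semigroup S" "A \<subseteq> carrier S"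
    and hom: "\<And>x y. x \<in> carrier S \<Longrightarrow> y \<in> carrier S \<Longrightarrow> f (x \<cdot>\<^bsub>S\<^esub> y) = f x \<cdot>\<^bsub>T\<^esub> f y"
  shows "sgenerate T (f ` A) = f ` sgenerate S A"
proof -
  have hom': "f (x \<cdot>\<^bsub>S\<^esub> y) = f x \<cdot>\<^bsub>T\<^esub> f y" if "x \<in> sgenerate S A" "y \<in> sgenerate S A" for x y
    using that sgenerate_subset[OF assms(1,2)] by (intro hom) auto
  have "y \<in> f ` sgenerate S A" if "y \<in> sgenerate T (f ` A)" for y
    using that
  proof induction
    case (prod x y)
    then obtain x' y' where xy: "x' \<in> sgenerate S A" "y' \<in> sgenerate S A" "x = f x'" "y = f y'"
      by auto
    have "x \<cdot>\<^bsub>T\<^esub> y = f (x' \<cdot>\<^bsub>S\<^esub> y')" using hom'[OF xy(1,2)] xy(3,4) by simp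
    then show ?case using sgenerate.prod[OF xy(1,2)] by (rule image_eqI)
  qed (use sgenerate.base in fast)
  moreover have "f x \<in> sgenerate T (f ` A)" if "x \<in> sgenerate S A" for x
    using that
  proof induction
    case (prod x y)
    then show ?case using sgenerate.prod[OF prod(3,4)] hom'[OF prod(1,2)] by simp
  qed (auto intro: sgenerate.base)
  ultimately show ?thesis by blast
qed

definition copy :: "('a \<Rightarrow> 'b) \<Rightarrow> 'a semigrp \<Rightarrow> 'b semigrp" where
  "copy f S = \<lparr>carrier = f ` carrier S,
    sprod = (\<lambda>x y. f (inv_into (carrier S) f x \<cdot>\<^bsub>S\<^esub> inv_into (carrier S) f y))\<rparr>"

context
  fixes f :: "'a \<Rightarrow> 'b" and S :: "'a semigrp"
  assumes S: "is_semigroup S" and inj: "inj_on f (carrier S)"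
begin

lemma carrier_copy: "carrier (copy f S) = f ` carrier S"
  by (simp add: copy_def)

lemma copy_hom: "x \<in> carrier S \<Longrightarrow> y \<in> carrier S \<Longrightarrow> f (x \<cdot>\<^bsub>S\<^esub> y) = f x \<cdot>\<^bsub>copy f S\<^esub> f y"
  using inj by (simp add: copy_def)

lemma copy_variety:
  assumes "semigroup_identities E" "S \<in> variety E"
  shows "copy f S \<in> variety E"
proof (rule variety_inj[OF assms, where f = "inv_into (carrier S) f"])
  show "inj_on (inv_into (carrier S) f) (carrier (copy f S))"
    by (simp add: carrier_copy inj_on_inv_into)
qed (use inj in \<open>auto simp: carrier_copy copy_hom[symmetric] semigroup_closed[OF S]
      semigroup_nonempty[OF S]\<close>)

lemma copy_sgenerate: "A \<subseteq> carrier S \<Longrightarrow> sgenerate (copy f S) (f ` A) = f ` sgenerate S A"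
  using sgenerate_image[OF S] copy_hom by blast

lemma copy_fin_generated: "fin_generated S \<Longrightarrow> fin_generated (copy f S)"
  unfolding fin_generated_def
  by (metis carrier_copy copy_sgenerate finite_imageI image_mono)

lemma is_semigroup_copy: "is_semigroup (copy f S)"
  using copy_variety[of "{}"] S by (simp add: semigroup_identities_def variety_def)

lemma copy_mult_bex:
  assumes "x \<in> carrier S" "y \<in> carrier S"
  shows "(\<exists>u\<in>carrier (copy f S). f x \<cdot>\<^bsub>copy f S\<^esub> u = f y) \<longleftrightarrow> (\<exists>u\<in>carrier S. x \<cdot>\<^bsub>S\<^esub> u = y)"
    and "(\<exists>u\<in>carrier (copy f S). u \<cdot>\<^bsub>copy f S\<^esub> f x = f y) \<longleftrightarrow> (\<exists>u\<in>carrier S. u \<cdot>\<^bsub>S\<^esub> x = y)"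
  using assms inj
  by (auto simp: carrier_copy copy_hom[symmetric] semigroup_closed[OF S] inj_on_eq_iff)

lemma copy_H_finite:
  assumes "H_finite (copy f S)"
  shows "H_finite S"
proof -
  obtain F where F: "finite F" "F \<subseteq> f ` carrier S" "\<forall>x\<in>f ` carrier S. \<exists>y\<in>F. (x, y) \<in> greenH (copy f S)"
    using assms unfolding H_finite_def finite_quotient_iff[OF green_equiv(3)] unfolding carrier_copy
    by (elim exE conjE) (rule that)
  obtain F' where F': "F' \<subseteq> carrier S" "finite F'" "F = f ` F'"
    using finite_subset_image[OF F(1,2)] by blast
  have "(x, y) \<in> greenH S" if "(f x, f y) \<in> greenH (copy f S)" "x \<in> carrier S" "y \<in> carrier S" for x y
    using that inj
    by (simp add: greenH_def greenR_iff greenL_iff S is_semigroup_copy copy_mult_bex inj_on_eq_iff)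
  then have "\<exists>y\<in>F'. (x, y) \<in> greenH S" if "x \<in> carrier S" for x
    using F(3)[rule_format, of "f x"] F'(1) that unfolding F'(3) by fastforce
  then show ?thesis
    unfolding H_finite_def finite_quotient_iff[OF green_equiv(3)]
    using F'(1,2) by (intro exI[of _ F'] conjI ballI)
qed

end

lemma countable_inj_infinite:
  assumes "countable X"
  obtains f :: "'x \<Rightarrow> 'a::infinite" where "inj_on f X"
proof -
  obtain h :: "nat \<Rightarrow> 'a" where "inj h"
    using infinite_countable_subset[OF infinite_UNIV] by blast
  then have "inj_on (h \<circ> to_nat_on X) X"
    using assms by (meson comp_inj_on inj_on_subset inj_on_to_nat_on subset_UNIV)
  then show ?thesis by (rule that)
qed

lemma fin_generated_countable: "is_semigroup S \<Longrightarrow> fin_generated S \<Longrightarrow> countable (carrier S)"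
  unfolding fin_generated_def using countable_sgenerate by (metis countable_finite)

text \<open>A finitely generated semigroup is countable, so it has a copy on any infinite type, and
  Green's relations can be read off the copy.\<close>

lemma H_finite_transfer:
  fixes S :: "'x semigrp"
  assumes "\<And>S :: 'a::infinite semigrp. S \<in> variety E \<Longrightarrow> fin_generated S \<Longrightarrow> H_finite S"
    and "semigroup_identities E" "S \<in> variety E" "fin_generated S"
  shows "H_finite S"
proof -
  have S: "is_semigroup S" using assms(3) by (rule variety_semigroup)
  obtain f :: "'x \<Rightarrow> 'a" where "inj_on f (carrier S)"
    using countable_inj_infinite fin_generated_countable[OF S assms(4)] by blast
  then show ?thesis
    using assms copy_variety[OF S] copy_fin_generated[OF S] copy_H_finite[OF S] by metis
qed

lemma locally_finite_transfer:
  fixes S :: "'x semigrp"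
  assumes "\<And>S :: 'a::infinite semigrp. S \<in> variety E \<Longrightarrow> locally_finite S"
    and "semigroup_identities E" "S \<in> variety E" "fin_generated S"
  shows "finite (carrier S)"
proof -
  have S: "is_semigroup S" using assms(3) by (rule variety_semigroup)
  obtain f :: "'x \<Rightarrow> 'a" where inj: "inj_on f (carrier S)"
    using countable_inj_infinite fin_generated_countable[OF S assms(4)] by blast
  have "finite (carrier (copy f S))"
    using assms(1)[OF copy_variety[OF S inj assms(2,3)]] copy_fin_generated[OF S inj assms(4)]
    unfolding locally_finite_def fin_generated_def by metis
  then show ?thesis using inj by (simp add: carrier_copy[OF S inj] finite_image_iff)
qed

section \<open>Identities failing in small semigroups\<close>

text \<open>Unlike \<open>word_val\<close> it gives the empty word a value, so recursions may start
  there; on nonempty words the two agree in \<open>adj S\<close>.\<close>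

definition wval :: "('m, 'x) monoid_scheme \<Rightarrow> (nat \<Rightarrow> 'm) \<Rightarrow> nat list \<Rightarrow> 'm" where
  "wval M \<phi> w = foldr (\<lambda>i y. \<phi> i \<otimes>\<^bsub>M\<^esub> y) w \<one>\<^bsub>M\<^esub>"

lemma wval_simps [simp]:
  "wval M \<phi> [] = \<one>\<^bsub>M\<^esub>" "wval M \<phi> (i # w) = \<phi> i \<otimes>\<^bsub>M\<^esub> wval M \<phi> w"
  by (simp_all add: wval_def)

lemma wval_adj: "w \<noteq> [] \<Longrightarrow> wval (adj S) (\<lambda>i. Some (\<phi> i)) w = Some (word_val S \<phi> w)"
  by (induction w rule: induct_list012) auto

text \<open>Letters may only be replaced by elements of \<open>S\<close>: an identity of
  \<open>S\<close> can fail once the adjoined identity is substituted. Hence the care below that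
  exponents are positive.\<close>

lemma identity_wval:
  assumes "semigroup_identities E" "S \<in> variety E" "(u, v) \<in> E" "\<And>i. \<phi> i \<in> Some ` carrier S"
  shows "wval (adj S) \<phi> u = wval (adj S) \<phi> v"
proof -
  define \<psi> where "\<psi> i = the (\<phi> i)" for i
  have \<psi>: "\<phi> i = Some (\<psi> i)" "\<psi> i \<in> carrier S" for i
    using assms(4)[of i] by (auto simp: \<psi>_def)
  have "\<phi> = (\<lambda>i. Some (\<psi> i))" using \<psi>(1) by (rule ext)
  then show ?thesis
    using wval_adj[of _ S \<psi>] identity_nonempty[OF assms(1,3)] identityD[OF assms(2,3) \<psi>(2)] by simp
qed

lemma adj_pow_carrier:
  assumes "is_semigroup S" "x \<in> Some ` carrier S" "n \<ge> 1"
  shows "x [^]\<^bsub>adj S\<^esub> (n::nat) \<in> Some ` carrier S"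
  using assms(3)
proof (induction n rule: dec_induct)
  case (step n)
  then show ?case using assms by (auto simp: semigroup_closed)
qed (use assms in auto)

lemma adj_pow_opp:
  assumes "is_semigroup S" "x \<in> carrier (adj S)"
  shows "x [^]\<^bsub>adj (opp S)\<^esub> (n::nat) = x [^]\<^bsub>adj S\<^esub> n"
proof (induction n)
  case (Suc n)
  then show ?case using monoid.nat_pow_Suc2[OF monoid_adj[OF assms(1)] assms(2), of n] by simp
qed simp

lemma not_in_variety:
  assumes "is_semigroup S" "S \<notin> variety E"
  obtains u v \<phi> where "(u, v) \<in> E" "\<And>i. \<phi> i \<in> carrier S" "word_val S \<phi> u \<noteq> word_val S \<phi> v"
proof -
  obtain p where "p \<in> E" "\<not> satisfies S p" using assms by (auto simp: variety_def)
  moreover obtain u v where "p = (u, v)" by (cases p)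
  ultimately show ?thesis using that by (auto simp: satisfies_def)
qed

lemma sub_adj_pow: "x [^]\<^bsub>adj (sub_semigrp S T)\<^esub> (n::nat) = x [^]\<^bsub>adj S\<^esub> n"
proof (induction n)
  case (Suc n)
  have "u \<otimes>\<^bsub>adj (sub_semigrp S T)\<^esub> v = u \<otimes>\<^bsub>adj S\<^esub> v" for u v
    by (cases u; cases v) auto
  then show ?case using Suc by simp
qed simp

context Group.monoid
begin

lemma left_identity_pow:
  assumes "e \<in> carrier G" "b \<in> carrier G" "e \<otimes> b = b" "k \<ge> 1"
  shows "e \<otimes> b [^] (k::nat) = b [^] k"
proof -
  have k: "b [^] k = b \<otimes> b [^] (k - 1)" using nat_pow_Suc2[of b "k - 1"] assms by simp
  show ?thesis unfolding k using m_assoc[OF assms(1,2) nat_pow_closed] assms(2,3) by metis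
qed

lemma right_identity_pow:
  assumes "e \<in> carrier G" "b \<in> carrier G" "b \<otimes> e = b" "k \<ge> 1"
  shows "b [^] (k::nat) \<otimes> e = b [^] k"
proof -
  have k: "b [^] k = b [^] (k - 1) \<otimes> b" using nat_pow_Suc[of b "k - 1"] assms by simp
  show ?thesis unfolding k using m_assoc[OF nat_pow_closed assms(2,1)] assms(2,3) by metis
qed

end

subsection \<open>Positive integers\<close>

definition posN :: "nat semigrp" where
  "posN = \<lparr>carrier = {1..}, sprod = (+)\<rparr>"

lemma posN_simps [simp]: "carrier posN = {1..}" "x \<cdot>\<^bsub>posN\<^esub> y = x + y"
  by (simp_all add: posN_def)

lemma is_semigroup_posN: "is_semigroup posN"
  by (auto simp: is_semigroup_def)

lemma word_val_posN: "w \<noteq> [] \<Longrightarrow> word_val posN \<phi> w = sum_list (map \<phi> w)"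
  by (induction w rule: induct_list012) auto

text \<open>An identity fails in the positive integers under some \<phi>. Substituting the power of
  x with exponent \<phi> i for letter i turns its sides into powers of x with two different
  exponents. The smaller one is \<open>p\<close>, the difference is \<open>q\<close>, and neither
  depends on x.\<close>

lemma exponents:
  fixes S :: "'a semigrp" and M (structure)
  defines M_def: "M \<equiv> adj S"
  assumes E: "semigroup_identities E" "posN \<notin> variety E" "S \<in> variety E"
  obtains p q :: nat where "p \<ge> 1" "q \<ge> 1"
    "\<And>x. x \<in> carrier M \<Longrightarrow> x [^] (p + q) = x [^] p"
proof -
  have S: "is_semigroup S" using E(3) by (rule variety_semigroup)
  interpret M: Group.monoid M unfolding M_def using S by (rule monoid_adj)
  obtain u v \<phi> where uv: "(u, v) \<in> E" "\<And>i. \<phi> i \<ge> 1" "word_val posN \<phi> u \<noteq> word_val posN \<phi> v"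
    using not_in_variety[OF is_semigroup_posN E(2)] by auto
  have ne: "u \<noteq> []" "v \<noteq> []" using identity_nonempty[OF E(1) uv(1)] by auto
  have val: "wval M (\<lambda>i. x [^] \<phi> i) w = x [^] sum_list (map \<phi> w)"
    if "x \<in> carrier M" for x w
    using that by (induction w) (auto simp: M.nat_pow_mult)
  have eq: "x [^] sum_list (map \<phi> u) = x [^] sum_list (map \<phi> v)"
    if "x \<in> carrier M" for x
  proof (cases x)
    case (Some y)
    then have "x [^] \<phi> i \<in> Some ` carrier S" for i
      using that adj_pow_carrier[OF S] uv(2) by (auto simp: M_def)
    then show ?thesis
      using identity_wval[OF E(1,3) uv(1), of "\<lambda>i. x [^] \<phi> i", folded M_def] val that by simp
  next
    case None
    then show ?thesis using M.nat_pow_one by (simp add: M_def)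
  qed
  have pos: "sum_list (map \<phi> w) \<ge> 1" if "w \<noteq> []" for w
    using that uv(2)[of "hd w"] by (cases w) auto
  have "\<exists>p q :: nat. p \<ge> 1 \<and> q \<ge> 1 \<and> (\<forall>x\<in>carrier M. x [^] (p + q) = x [^] p)"
    if ab: "a < b" "a \<ge> 1" "\<And>x. x \<in> carrier M \<Longrightarrow> x [^] a = x [^] b" for a b :: nat
  proof -
    have "\<forall>x\<in>carrier M. x [^] (a + (b - a)) = x [^] a" "b - a \<ge> 1"
      using ab by simp_all
    then show ?thesis using ab(2) by blast
  qed
  note exps = this
  have "sum_list (map \<phi> u) < sum_list (map \<phi> v) \<or> sum_list (map \<phi> v) < sum_list (map \<phi> u)"
    using uv(3) ne by (simp add: word_val_posN neq_iff)
  then have "\<exists>p q :: nat. p \<ge> 1 \<and> q \<ge> 1 \<and> (\<forall>x\<in>carrier M. x [^] (p + q) = x [^] p)"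
    using exps[OF _ pos[OF ne(1)] eq] exps[OF _ pos[OF ne(2)] eq[symmetric]] by blast
  then show ?thesis using that by blast
qed

text \<open>The exponent is p * q: it is a multiple of the period \<open>q\<close> and at least
  \<open>p\<close>, from where on the powers are periodic. Doubling it therefore changes
  nothing.\<close>

lemma idempotent_exponent:
  fixes S :: "'a semigrp" and M (structure)
  defines M_def: "M \<equiv> adj S"
  assumes E: "semigroup_identities E" "posN \<notin> variety E" "S \<in> variety E"
  obtains k :: nat where "k \<ge> 1" "\<And>x. x \<in> carrier M \<Longrightarrow> x [^] k \<otimes> x [^] k = x [^] k"
proof -
  interpret M: Group.monoid M unfolding M_def using variety_semigroup[OF E(3)] by (rule monoid_adj)
  obtain p q :: nat where pq: "p \<ge> 1" "q \<ge> 1"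
    "\<And>x. x \<in> carrier M \<Longrightarrow> x [^] (p + q) = x [^] p"
    by (rule exponents[OF E, folded M_def]) (rule that)
  have "x [^] (p * q) \<otimes> x [^] (p * q) = x [^] (p * q)"
    if x: "x \<in> carrier M" for x
  proof -
    have p: "x [^] (p + j * q) = x [^] p" for j
    proof (induction j)
      case (Suc j)
      have "x [^] (p + Suc j * q) = x [^] (p + q) \<otimes> x [^] (j * q)"
        using M.nat_pow_mult[OF x, of "p + q" "j * q"] by (simp add: algebra_simps)
      also have "\<dots> = x [^] (p + j * q)" using pq(3)[OF x] M.nat_pow_mult[OF x] by simp
      finally show ?case using Suc by simp
    qed simp
    have "p \<le> p * q" using pq by simp
    then have "p * q + p * q = (p + p * q) + (p * q - p)" "p + (p * q - p) = p * q" by arith+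
    note pq2 = this
    have "x [^] (p * q + p * q) = x [^] (p + p * q) \<otimes> x [^] (p * q - p)"
      unfolding M.nat_pow_mult[OF x] pq2(1) ..
    also have "\<dots> = x [^] (p + (p * q - p))" unfolding p by (rule M.nat_pow_mult[OF x])
    finally show ?thesis using M.nat_pow_mult[OF x, of "p * q" "p * q"] pq2(2) by simp
  qed
  then show ?thesis using pq that[of "p * q"] by auto
qed

subsection \<open>The semigroup \<open>\<langle>e, a | ee = e, ea = a, ae = aa = 0\<rangle>\<close>\<close>

text \<open>The elements \<open>e\<close>, \<open>a\<close>, \<open>0\<close> are represented by the numbers 0, 1, 2.\<close>

definition P3 :: "nat semigrp" where
  "P3 = \<lparr>carrier = {0, 1, 2}, sprod = (\<lambda>x y. if x = 0 then y else 2)\<rparr>"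

lemma P3_simps [simp]: "carrier P3 = {0, 1, 2}" "x \<cdot>\<^bsub>P3\<^esub> y = (if x = 0 then y else 2)"
  by (simp_all add: P3_def)

lemma is_semigroup_P3: "is_semigroup P3"
  by (auto simp: is_semigroup_def)

text \<open>Letters of value 0, 1, 2 in \<open>P3\<close> are sent to e, b, b^2. A word of value 0
  or 1 then becomes e or b, and a word of value 2 lands in the set \<open>X\<close>. An identity
  failing in \<open>P3\<close> makes two of e, b, \<open>X\<close> meet, and each coincidence gives
  the conclusion.\<close>

lemma P3_not_in_variety:
  fixes S :: "'a semigrp" and M (structure)
  defines M_def: "M \<equiv> adj S"
  assumes E: "semigroup_identities E" "P3 \<notin> variety E" "S \<in> variety E"
    and e: "e \<in> Some ` carrier S" "e \<otimes> e = e" and b: "b \<in> Some ` carrier S" "e \<otimes> b = b"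
  shows "b \<otimes> e = b \<or> (\<exists>n\<ge>2. b [^] (n::nat) = b)"
proof -
  have S: "is_semigroup S" using E(3) by (rule variety_semigroup)
  interpret M: Group.monoid M unfolding M_def using S by (rule monoid_adj)
  have eM: "e \<in> carrier M" and bM: "b \<in> carrier M" using e b by (auto simp: M_def)
  obtain u v \<phi> where uv: "(u, v) \<in> E" "\<And>i. \<phi> i \<in> {0, 1, 2::nat}" "word_val P3 \<phi> u \<noteq> word_val P3 \<phi> v"
    using not_in_variety[OF is_semigroup_P3 E(2)] unfolding P3_simps by blast
  have ne: "u \<noteq> []" "v \<noteq> []" using identity_nonempty[OF E(1) uv(1)] by auto
  define \<psi> where "\<psi> i = (if \<phi> i = 0 then e else b [^] \<phi> i)" for i
  \<comment> \<open>The possible images of words with value zero in \<open>P3\<close>: a zero arises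
    from a followed by e or by a, and left multiplication by e or b stays inside this set.\<close>
  define X where "X = {b [^] k | k::nat. k \<ge> 2} \<union> {b [^] k \<otimes> e | k::nat. k \<ge> 1}"
  have X_left: "b [^] j \<otimes> y \<in> X" if y: "y \<in> X" for y and j :: nat
  proof -
    consider k :: nat where "k \<ge> 2" "y = b [^] k"
      | k :: nat where "k \<ge> 1" "y = b [^] k \<otimes> e"
      using y by (auto simp: X_def)
    then show ?thesis
    proof cases
      case (1 k)
      then have "b [^] j \<otimes> y = b [^] (j + k)" by (simp add: M.nat_pow_mult bM)
      then show ?thesis using 1(1) by (auto simp: X_def intro!: exI[of _ "j + k"])
    next
      case (2 k)
      then have "b [^] j \<otimes> y = b [^] (j + k) \<otimes> e"
        by (simp add: M.nat_pow_mult[symmetric] bM eM M.m_assoc)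
      then show ?thesis using 2(1) by (auto simp: X_def intro!: exI[of _ "j + k"])
    qed
  qed
  note e_pow = M.left_identity_pow[OF eM bM b(2)]
  have e_X: "e \<otimes> y = y" if "y \<in> X" for y
    using that unfolding X_def
  proof (elim UnE CollectE exE conjE)
    fix k :: nat assume k: "y = b [^] k \<otimes> e" "1 \<le> k"
    show ?thesis unfolding k using M.m_assoc[OF eM M.nat_pow_closed[OF bM] eM] e_pow[OF k(2)] by metis
  qed (use e_pow in auto)
  have pow_X: "b [^] k \<in> X" if "k \<ge> 2" for k :: nat using that by (auto simp: X_def)
  have be_X: "b [^] k \<otimes> e \<in> X" if "k \<ge> 1" for k :: nat using that by (auto simp: X_def)
  have val: "(word_val P3 \<phi> w = 0 \<and> wval M \<psi> w = e) \<or> (word_val P3 \<phi> w = 1 \<and> wval M \<psi> w = b) \<or>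
      (word_val P3 \<phi> w = 2 \<and> wval M \<psi> w \<in> X)" if "w \<noteq> []" for w
    using that
  proof (induction w rule: induct_list012)
    case (2 x)
    show ?case using uv(2)[of x] pow_X[of 2] bM eM by (auto simp: \<psi>_def)
  next
    case (3 x y zs)
    have split: "wval M \<psi> (x # y # zs) = \<psi> x \<otimes> wval M \<psi> (y # zs)"
      "word_val P3 \<phi> (x # y # zs) = (if \<phi> x = 0 then word_val P3 \<phi> (y # zs) else 2)" by simp_all
    note IH = "3.IH"(2)[OF list.distinct(2)]
    show ?case
    proof (cases "\<phi> x = 0")
      case True
      then have "\<psi> x = e" by (simp add: \<psi>_def)
      then show ?thesis unfolding split using IH e(2) b(2) e_X True by (auto simp del: wval_simps)
    next
      case False
      then have 1: "\<phi> x \<ge> 1" and \<psi>x: "\<psi> x = b [^] \<phi> x" by (simp_all add: \<psi>_def)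
      have "b [^] \<phi> x \<otimes> b \<in> X" using pow_X[of "Suc (\<phi> x)"] 1 by simp
      then have "\<psi> x \<otimes> wval M \<psi> (y # zs) \<in> X"
        using IH X_left be_X[OF 1] \<psi>x by (auto simp del: wval_simps)
      then show ?thesis unfolding split using False by simp
    qed
  qed simp
  have "\<psi> i \<in> Some ` carrier S" for i
    using adj_pow_carrier[OF S b(1), of "\<phi> i", folded M_def] e(1) by (auto simp: \<psi>_def)
  from identity_wval[OF E(1,3) uv(1) this, folded M_def] have eq: "wval M \<psi> u = wval M \<psi> v" .
  have "e = b \<or> e \<in> X \<or> b \<in> X"
    using val[OF ne(1)] val[OF ne(2)] eq uv(3) by auto
  moreover have ?thesis if "e = b" using that e(2) by simp
  moreover have ?thesis if "e \<in> X"
    using that unfolding X_def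
  proof (elim UnE CollectE exE conjE)
    fix k :: nat assume k: "e = b [^] k" "2 \<le> k"
    then have "b [^] Suc k = b" using b(2) by simp
    then show ?thesis using k(2) by (intro disjI2 exI[of _ "Suc k"]) auto
  next
    fix k :: nat assume k: "e = b [^] k \<otimes> e" "1 \<le> k"
    then have "b = b [^] k \<otimes> e \<otimes> b" using b(2) by metis
    also have "\<dots> = b [^] Suc k"
      using M.m_assoc[OF M.nat_pow_closed[OF bM] eM bM] b(2) by simp
    finally show ?thesis using k(2) by (intro disjI2 exI[of _ "Suc k"]) auto
  qed
  moreover have ?thesis if "b \<in> X"
    using that unfolding X_def
  proof (elim UnE CollectE exE conjE)
    fix k :: nat assume k: "b = b [^] k \<otimes> e" "1 \<le> k"
    then have "b \<otimes> e = b"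
      using M.m_assoc[OF M.nat_pow_closed[OF bM] eM eM] e(2) by metis
    then show ?thesis ..
  qed metis
  ultimately show ?thesis by blast
qed

subsection \<open>The monogenic monoid \<open>\<langle>a | a\<^sup>2 = 0\<rangle>\<close>\<close>

text \<open>The number k stands for the power a^k; truncation at 2 makes 2 the zero element.\<close>

definition N21 :: "nat semigrp" where
  "N21 = \<lparr>carrier = {0, 1, 2}, sprod = (\<lambda>x y. min 2 (x + y))\<rparr>"

lemma N21_simps [simp]: "carrier N21 = {0, 1, 2}" "x \<cdot>\<^bsub>N21\<^esub> y = min 2 (x + y)"
  by (simp_all add: N21_def)

lemma is_semigroup_N21: "is_semigroup N21"
  by (auto simp: is_semigroup_def)

text \<open>Since e is a two-sided identity for b, the powers of b with e as zeroth power multiply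
  by adding exponents. An identity failing in \<open>N21\<close> equates two such powers whose
  exponents differ and the smaller of which is 0 or 1. So e or b equals a higher power of b, and b
  has finite order.\<close>

lemma N21_not_in_variety:
  fixes S :: "'a semigrp" and M (structure)
  defines M_def: "M \<equiv> adj S"
  assumes E: "semigroup_identities E" "N21 \<notin> variety E" "S \<in> variety E"
    and e: "e \<in> Some ` carrier S" "e \<otimes> e = e"
    and b: "b \<in> Some ` carrier S" "e \<otimes> b = b" "b \<otimes> e = b"
  shows "\<exists>n\<ge>2. b [^] (n::nat) = b"
proof -
  have S: "is_semigroup S" using E(3) by (rule variety_semigroup)
  interpret M: Group.monoid M unfolding M_def using S by (rule monoid_adj)
  have eM: "e \<in> carrier M" and bM: "b \<in> carrier M" using e b by (auto simp: M_def)
  obtain u v \<phi> where uv: "(u, v) \<in> E" "\<And>i. \<phi> i \<in> {0, 1, 2::nat}" "word_val N21 \<phi> u \<noteq> word_val N21 \<phi> v"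
    using not_in_variety[OF is_semigroup_N21 E(2)] unfolding N21_simps by blast
  have ne: "u \<noteq> []" "v \<noteq> []" using identity_nonempty[OF E(1) uv(1)] by auto
  have N21: "word_val N21 \<phi> w = min 2 (sum_list (map \<phi> w))" if "w \<noteq> []" for w
    using that
  proof (induction w rule: induct_list012)
    case (2 x)
    then show ?case using uv(2)[of x] by auto
  qed auto
  define epow where "epow k = (if k = 0 then e else b [^] k)" for k :: nat
  note e_pow = M.left_identity_pow[OF eM bM b(2)]
  have epow_add: "epow j \<otimes> epow k = epow (j + k)" for j k
    using e(2) e_pow M.right_identity_pow[OF eM bM b(3)] M.nat_pow_mult[OF bM, of j k]
    by (auto simp: epow_def)
  have val: "wval M (\<lambda>i. epow (\<phi> i)) w = epow (sum_list (map \<phi> w))" if "w \<noteq> []" for w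
    using that
  proof (induction w rule: induct_list012)
    case (3 x y zs)
    then show ?case using epow_add by (simp)
  qed (use eM bM in \<open>auto simp: epow_def\<close>)
  have "epow (\<phi> i) \<in> Some ` carrier S" for i
    using adj_pow_carrier[OF S b(1), of "\<phi> i", folded M_def] e(1) by (auto simp: epow_def)
  then have eq: "epow (sum_list (map \<phi> u)) = epow (sum_list (map \<phi> v))"
    using identity_wval[OF E(1,3) uv(1), of "\<lambda>i. epow (\<phi> i)", folded M_def] val ne by simp
  have key: ?thesis if "epow i = epow j" "i < j" "i < 2" for i j
  proof (cases "i = 0")
    case True
    then have "e = b [^] j" using that by (auto simp: epow_def)
    then have "b [^] Suc j = b" using b(2) by simp
    then show ?thesis using that by (intro exI[of _ "Suc j"]) auto
  next
    case False
    then have "i = 1" using that by simp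
    then have "b = b [^] j" using that bM by (auto simp: epow_def)
    then show ?thesis using that \<open>i = 1\<close> by (intro exI[of _ j]) auto
  qed
  have "min 2 (sum_list (map \<phi> u)) \<noteq> min 2 (sum_list (map \<phi> v))" using uv(3) N21 ne by simp
  then have "sum_list (map \<phi> u) < sum_list (map \<phi> v) \<and> sum_list (map \<phi> u) < 2 \<or>
    sum_list (map \<phi> v) < sum_list (map \<phi> u) \<and> sum_list (map \<phi> v) < 2" by linarith
  then show ?thesis using key eq by metis
qed

section \<open>Elements of finite order\<close>

text \<open>These are the elements that generate a finite cyclic group.\<close>

definition Gr :: "'a semigrp \<Rightarrow> 'a set" where
  "Gr S = {x \<in> carrier S. \<exists>n\<ge>2. Some x [^]\<^bsub>adj S\<^esub> (n::nat) = Some x}"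

lemma Gr_opp: "is_semigroup S \<Longrightarrow> Gr (opp S) = Gr S"
  by (auto simp: Gr_def adj_pow_opp)

lemma (in Group.monoid) idempotent_of_power:
  assumes "x \<in> carrier G" "x [^] (n::nat) = x" "n \<ge> 2"
  shows "x [^] (n - 1) \<otimes> x [^] (n - 1) = x [^] (n - 1)" "x [^] (n - 1) \<otimes> x = x"
    "x \<otimes> x [^] (n - 1) = x"
proof -
  have "n - 1 + (n - 1) = (n - 2) + n" "n - 2 + 1 = n - 1" using assms(3) by auto
  then have "x [^] (n - 1) \<otimes> x [^] (n - 1) = x [^] (n - 2) \<otimes> x [^] n"
    using assms(1) by (simp add: nat_pow_mult)
  also have "\<dots> = x [^] (n - 1)"
    using nat_pow_Suc[of x "n - 2"] assms(2) \<open>n - 2 + 1 = n - 1\<close> by (metis Suc_eq_plus1)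
  finally show "x [^] (n - 1) \<otimes> x [^] (n - 1) = x [^] (n - 1)" .
  show "x [^] (n - 1) \<otimes> x = x" using nat_pow_Suc[of x "n - 1"] assms by simp
  show "x \<otimes> x [^] (n - 1) = x" using nat_pow_Suc2[of x "n - 1"] assms by simp
qed

text \<open>Excluding \<open>P3\<close> turns the left identity of b into a two-sided one unless b
  already has finite order; excluding \<open>N21\<close> settles the two-sided case.\<close>

lemma Gr_left_identity:
  assumes "semigroup_identities E" "P3 \<notin> variety E" "N21 \<notin> variety E" "S \<in> variety E"
    and "e \<in> carrier S" "e \<cdot>\<^bsub>S\<^esub> e = e" "b \<in> carrier S" "e \<cdot>\<^bsub>S\<^esub> b = b"
  shows "b \<in> Gr S"
proof -
  have "\<exists>n\<ge>2. Some b [^]\<^bsub>adj S\<^esub> (n::nat) = Some b"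
    using P3_not_in_variety[OF assms(1,2,4), of "Some e" "Some b"]
      N21_not_in_variety[OF assms(1,3,4), of "Some e" "Some b"] assms by auto
  then show ?thesis using assms by (simp add: Gr_def)
qed

lemma opp_N21: "opp N21 = N21"
  by (simp add: opp_def N21_def add.commute)

text \<open>The identity of the cyclic group generated by x is an idempotent left identity of every
  product of x with s.\<close>

lemma Gr_right_mult:
  assumes "semigroup_identities E" "P3 \<notin> variety E" "N21 \<notin> variety E" "S \<in> variety E"
    and "x \<in> Gr S" "s \<in> carrier S"
  shows "x \<cdot>\<^bsub>S\<^esub> s \<in> Gr S"
proof -
  have S: "is_semigroup S" using assms(4) by (rule variety_semigroup)
  interpret M: Group.monoid "adj S" using S by (rule monoid_adj)
  obtain n :: nat where n: "x \<in> carrier S" "n \<ge> 2" "Some x [^]\<^bsub>adj S\<^esub> n = Some x"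
    using assms(5) by (auto simp: Gr_def)
  have "n - 1 \<ge> 1" using n(2) by simp
  then obtain e where e: "e \<in> carrier S" "Some x [^]\<^bsub>adj S\<^esub> (n - 1) = Some e"
    using adj_pow_carrier[OF S, of "Some x" "n - 1"] n(1) by blast
  have "e \<cdot>\<^bsub>S\<^esub> e = e" "e \<cdot>\<^bsub>S\<^esub> x = x"
    using M.idempotent_of_power[OF _ n(3,2)] n(1) e(2) by auto
  moreover have "e \<cdot>\<^bsub>S\<^esub> (x \<cdot>\<^bsub>S\<^esub> s) = x \<cdot>\<^bsub>S\<^esub> s"
    using \<open>e \<cdot>\<^bsub>S\<^esub> x = x\<close> semigroup_assoc[OF S e(1) n(1) assms(6)] by simp
  ultimately show ?thesis
    using Gr_left_identity[OF assms(1-4) e(1)] semigroup_closed[OF S n(1) assms(6)] by blast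
qed

text \<open>Left multiplication is the same statement for the opposite semigroup. \<open>N21\<close>
  is commutative and so self-dual, whereas \<open>P3\<close> has to be excluded for the reversed
  identities as well. An idempotent power of any element shows nonemptiness.\<close>

lemma Gr_ideal:
  assumes "semigroup_identities E" "posN \<notin> variety E" "P3 \<notin> variety E"
    "P3 \<notin> variety (rev_ids E)" "N21 \<notin> variety E" "S \<in> variety E"
  shows "is_ideal (Gr S) S"
proof -
  have S: "is_semigroup S" using assms(6) by (rule variety_semigroup)
  interpret M: Group.monoid "adj S" using S by (rule monoid_adj)
  have "N21 \<notin> variety (rev_ids E)"
    using opp_variety_iff[OF assms(1), of N21] assms(5) by (simp add: opp_N21)
  moreover have "opp S \<in> variety (rev_ids E)" using assms opp_variety by blast
  ultimately have left: "s \<cdot>\<^bsub>S\<^esub> x \<in> Gr S" if "x \<in> Gr S" "s \<in> carrier S" for x s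
    using Gr_right_mult[of "rev_ids E" "opp S" x s] assms that by (simp add: Gr_opp[OF S])
  obtain k :: nat where k: "k \<ge> 1" "\<And>x. x \<in> carrier (adj S) \<Longrightarrow>
    x [^]\<^bsub>adj S\<^esub> k \<otimes>\<^bsub>adj S\<^esub> x [^]\<^bsub>adj S\<^esub> k = x [^]\<^bsub>adj S\<^esub> k"
    by (rule idempotent_exponent[OF assms(1,2,6)]) (rule that)
  obtain x where x: "x \<in> carrier S" using semigroup_nonempty[OF S] by blast
  obtain e where e: "e \<in> carrier S" "Some x [^]\<^bsub>adj S\<^esub> k = Some e"
    using adj_pow_carrier[OF S, of "Some x" k] x k by auto
  have "Some e [^]\<^bsub>adj S\<^esub> (2::nat) = Some e"
    using k(2)[of "Some x"] x e by (simp add: numeral_2_eq_2)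
  then have "e \<in> Gr S" using e(1) by (auto simp: Gr_def)
  moreover have "Gr S \<subseteq> carrier S" by (auto simp: Gr_def)
  ultimately show ?thesis
    using left Gr_right_mult[OF assms(1,3,5,6)] unfolding is_ideal_def by blast
qed

section \<open>Periodicity and complete regularity of the ideal\<close>

lemma (in Group.monoid) finite_powers:
  assumes "x \<in> carrier G" "x [^] (p + q) = x [^] (p::nat)" "q \<ge> 1"
  shows "finite (range (\<lambda>n::nat. x [^] n))"
proof -
  have "\<exists>j<p + q. x [^] n = x [^] j" for n :: nat
  proof (induction n)
    case (Suc n)
    then obtain j where j: "j < p + q" "x [^] Suc n = x [^] Suc j" by auto
    show ?case
    proof (cases "Suc j < p + q")
      case False
      then have "Suc j = p + q" using j(1) by simp
      then have "x [^] Suc n = x [^] p" using j(2) assms(2) by metis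
      then show ?thesis using assms(3) by (intro exI[of _ p]) auto
    qed (use j in blast)
  qed (use assms(3) in \<open>auto intro!: exI[of _ "0::nat"]\<close>)
  then have "range (\<lambda>n::nat. x [^] n) \<subseteq> (\<lambda>j. x [^] j) ` {..<p + q}" by blast
  then show ?thesis using finite_subset by blast
qed

lemma finite_order_ideal:
  assumes S: "is_semigroup S" and J: "is_ideal J S"
    and fo: "\<And>x. x \<in> J \<Longrightarrow> \<exists>n\<ge>2. Some x [^]\<^bsub>adj S\<^esub> (n::nat) = Some x"
  shows "periodic (sub_semigrp S J)" "completely_regular (sub_semigrp S J)"
proof -
  interpret M: Group.monoid "adj S" using S by (rule monoid_adj)
  have JS: "J \<subseteq> carrier S" using J by (simp add: is_ideal_def)
  have power: "\<exists>i::nat. i \<ge> 1 \<and> Some y = Some x [^]\<^bsub>adj S\<^esub> i" if "x \<in> J" "y \<in> sgenerate S {x}" for x y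
    using that(2)
  proof induction
    case (base y)
    then show ?case using that(1) JS by (intro exI[of _ 1]) auto
  next
    case (prod y z)
    then obtain i j :: nat where ij: "i \<ge> 1" "Some y = Some x [^]\<^bsub>adj S\<^esub> i" "Some z = Some x [^]\<^bsub>adj S\<^esub> j"
      by blast
    have "Some x [^]\<^bsub>adj S\<^esub> (i + j) = Some y \<otimes>\<^bsub>adj S\<^esub> Some z"
      unfolding ij(2,3) using M.nat_pow_mult[of "Some x" i j] \<open>x \<in> J\<close> JS by auto
    then show ?case using ij(1) by (intro exI[of _ "i + j"]) simp
  qed
  have power': "\<exists>y. Some x [^]\<^bsub>adj S\<^esub> i = Some y \<and> y \<in> sgenerate S {x}" if "x \<in> J" "i \<ge> 1" for x and i :: nat
    using that(2)
  proof (induction i rule: dec_induct)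
    case base
    then show ?case using that(1) JS by (auto intro: sgenerate.base)
  next
    case (step i)
    then obtain y where "Some x [^]\<^bsub>adj S\<^esub> i = Some y" "y \<in> sgenerate S {x}" by blast
    then show ?case using sgenerate.prod[of y S "{x}" x] by (auto intro: sgenerate.base)
  qed
  have gen_J: "sgenerate S {x} \<subseteq> J" if "x \<in> J" for x
  proof
    fix y assume "y \<in> sgenerate S {x}"
    then show "y \<in> J"
    proof induction
      case (prod y z)
      then show ?case using J JS unfolding is_ideal_def by blast
    qed (use that in simp)
  qed
  have "finite (sgenerate S {x})" if x: "x \<in> J" for x
  proof -
    obtain n :: nat where n: "n \<ge> 2" "Some x [^]\<^bsub>adj S\<^esub> n = Some x" using fo[OF x] by blast
    have xM: "Some x \<in> carrier (adj S)" using x JS by auto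
    have "finite (range (\<lambda>i::nat. Some x [^]\<^bsub>adj S\<^esub> i))"
      by (rule M.finite_powers[OF xM, of 1 "n - 1"]) (use n xM in auto)
    moreover have "Some ` sgenerate S {x} \<subseteq> range (\<lambda>i::nat. Some x [^]\<^bsub>adj S\<^esub> i)"
      using power[OF x] by blast
    ultimately show ?thesis by (meson finite_imageD finite_subset inj_Some)
  qed
  then show "periodic (sub_semigrp S J)" by (simp add: periodic_def)
  have "is_subgroup_of (sgenerate S {x}) (sub_semigrp S J)" if x: "x \<in> J" for x
    unfolding is_subgroup_of_def
  proof (intro conjI)
    show "sgenerate S {x} \<subseteq> carrier (sub_semigrp S J)" using gen_J[OF x] by simp
    obtain n :: nat where n: "n \<ge> 2" "Some x [^]\<^bsub>adj S\<^esub> n = Some x" using fo[OF x] by blast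
    have xS: "Some x \<in> carrier (adj S)" using x JS by auto
    define m where "m = n - 1"
    have m: "m \<ge> 1" using n(1) by (simp add: m_def)
    obtain e where e: "Some x [^]\<^bsub>adj S\<^esub> m = Some e" "e \<in> sgenerate S {x}" using power'[OF x m] by blast
    have ee: "e \<cdot>\<^bsub>S\<^esub> e = e" "e \<cdot>\<^bsub>S\<^esub> x = x"
      using M.idempotent_of_power[OF xS n(2,1)] e(1) by (auto simp: m_def)
    have gen_S: "y \<in> carrier S" if "y \<in> sgenerate S {x}" for y using that gen_J[OF x] JS by blast
    have "Group.group \<lparr>carrier = sgenerate S {x}, mult = sprod S, one = e\<rparr>"
    proof (rule groupI, unfold monoid.simps partial_object.simps)
      fix y assume y: "y \<in> sgenerate S {x}"
      then show "e \<cdot>\<^bsub>S\<^esub> y = y"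
      proof induction
        case (prod y z)
        then show ?case using semigroup_assoc[OF S gen_S[OF e(2)] gen_S gen_S] by metis
      qed (use ee in simp)
      obtain i :: nat where i: "i \<ge> 1" "Some y = Some x [^]\<^bsub>adj S\<^esub> i" using power[OF x y] by blast
      \<comment> \<open>The inverse of y = x^i is x^j, because j + i = m (i + 1) and the power of x
        with this exponent is a power of e. The subtraction is genuine since m is at least 1; the
        added \<open>m\<close> keeps j positive, so that x^j lies in the subsemigroup.\<close>
      define j where "j = i * m - i + m"
      have "i \<le> i * m" using m by simp
      then have "j \<ge> 1 \<and> j + i = i * m + m" using m unfolding j_def by linarith
      then have j: "j \<ge> 1" "j + i = m * Suc i" by (auto simp: mult.commute)
      obtain z where z: "Some x [^]\<^bsub>adj S\<^esub> j = Some z" "z \<in> sgenerate S {x}" using power'[OF x j(1)] by blast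
      have "Some e [^]\<^bsub>adj S\<^esub> Suc l = Some e" for l
        by (induction l) (use ee(1) in auto)
      then have "Some x [^]\<^bsub>adj S\<^esub> (j + i) = Some e"
        unfolding j(2) M.nat_pow_pow[OF xS, symmetric] e(1) .
      then have "z \<cdot>\<^bsub>S\<^esub> y = e" using M.nat_pow_mult[OF xS, of j i] z(1) i(2) by (metis adj_simps(4) option.inject)
      then show "\<exists>z\<in>sgenerate S {x}. z \<cdot>\<^bsub>S\<^esub> y = e" using z(2) by blast
    qed (use e(2) gen_S semigroup_assoc[OF S] in \<open>auto intro: sgenerate.prod\<close>)
    then show "\<exists>e. Group.group \<lparr>carrier = sgenerate S {x}, mult = sprod (sub_semigrp S J), one = e\<rparr>" by auto
  qed
  then have "J \<subseteq> \<Union>{T. is_subgroup_of T (sub_semigrp S J)}" by (blast intro: sgenerate.base)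
  moreover have "\<Union>{T. is_subgroup_of T (sub_semigrp S J)} \<subseteq> J" by (auto simp: is_subgroup_of_def)
  ultimately show "completely_regular (sub_semigrp S J)"
    unfolding completely_regular_def by auto
qed

section \<open>Locally H-finite varieties\<close>

text \<open>Fixing the type \<open>nat\<close> loses nothing: finitely generated semigroups are
  countable, and \<open>locally_H_finiteD\<close> recovers the property on every type.\<close>

definition locally_H_finite :: "(nat list \<times> nat list) set \<Rightarrow> bool" where
  "locally_H_finite E \<longleftrightarrow> (\<forall>S :: nat semigrp. S \<in> variety E \<and> fin_generated S \<longrightarrow> H_finite S)"

lemma locally_H_finiteD:
  "semigroup_identities E \<Longrightarrow> locally_H_finite E \<Longrightarrow> S \<in> variety E \<Longrightarrow> fin_generated S \<Longrightarrow> H_finite S"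
  unfolding locally_H_finite_def using H_finite_transfer[where ?'a = nat, of E S] by blast

lemma locally_H_finite_rev:
  assumes "semigroup_identities E" "locally_H_finite E"
  shows "locally_H_finite (rev_ids E)"
  unfolding locally_H_finite_def
proof (intro allI impI)
  fix S :: "nat semigrp" assume S: "S \<in> variety (rev_ids E) \<and> fin_generated S"
  then have "opp S \<in> variety E" using opp_variety[of "rev_ids E" S] assms by simp
  then show "H_finite S" using S assms unfolding locally_H_finite_def
    by (metis H_finite_opp fin_generated_opp)
qed

section \<open>Semigroups that a locally H-finite variety cannot contain\<close>

lemma fin_generated_posN: "fin_generated posN"
proof -
  have "n \<in> sgenerate posN {1}" if "n \<ge> 1" for n :: nat
    using that
  proof (induction n rule: dec_induct)
    case (step n)
    then show ?case using sgenerate.prod[of n posN "{1}" 1] by (auto intro: sgenerate.base)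
  qed (auto intro: sgenerate.base)
  then have "sgenerate posN {1} = carrier posN"
    using sgenerate_subset[OF is_semigroup_posN, of "{1}"] by auto
  then show ?thesis unfolding fin_generated_def by (intro exI[of _ "{1}"]) auto
qed

lemma posN_not_locally_H_finite:
  assumes "locally_H_finite E"
  shows "posN \<notin> variety E"
proof
  assume "posN \<in> variety E"
  then have "H_finite posN" using assms fin_generated_posN by (simp add: locally_H_finite_def)
  from H_finite_trivial_R[OF is_semigroup_posN this subset_refl] have "finite (carrier posN)" by auto
  then show False by (simp add: infinite_Ici)
qed

text \<open>In P x S0 any right factor moves a pair (a, w) to first component zero, from which
  nothing leads back. So every such pair is its own R-class, and there are as many of them as
  elements of \<open>S\<close>.\<close>

lemma P3_not_locally_H_finite:
  fixes S :: "'a semigrp"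
  assumes E: "semigroup_identities E" "locally_H_finite E"
    and S: "S \<in> variety E" "fin_generated S" "infinite (carrier S)"
  shows "P3 \<notin> variety E"
proof
  assume P3: "P3 \<in> variety E"
  have semi: "is_semigroup S" using S(1) by (rule variety_semigroup)
  define U :: "(nat \<times> 'a) semigrp" where
    "U = \<lparr>carrier = {0, 1, 2} \<times> carrier S,
      sprod = (\<lambda>x y. (fst x \<cdot>\<^bsub>P3\<^esub> fst y, snd x \<cdot>\<^bsub>S\<^esub> snd y))\<rparr>"
  have U: "U \<in> variety E"
    by (rule variety_subdirect[where A = P3 and B = S and f = fst and I = UNIV and g = "\<lambda>_. snd", OF E(1) P3 S(1)])
      (use semigroup_nonempty[OF semi] in \<open>auto simp: U_def semigroup_closed[OF semi] prod_eq_iff\<close>)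
  obtain X where X: "finite X" "X \<subseteq> carrier S" "sgenerate S X = carrier S"
    using S(2) by (auto simp: fin_generated_def)
  \<comment> \<open>With first components e and a on the generators, (a, w) is a product of pairs
    (e, x) for the letters of w except the last, which carries a.\<close>
  define A where "A = {0, 1 :: nat} \<times> X"
  define T where "T = sgenerate U A"
  have "X \<noteq> {}" using X(3) S(3) by auto
  then have A: "finite A" "A \<subseteq> carrier U" "A \<noteq> {}" using X by (auto simp: A_def U_def)
  have TV: "sub_semigrp U T \<in> variety E" unfolding T_def using variety_sub[OF E(1) U A(2,3)] .
  have "(1, w) \<in> T" if "w \<in> carrier S" for w
  proof -
    have "w \<in> sgenerate S X" using that X by simp
    with semi X(2) show ?thesis
    proof (induction rule: sgenerate_induct_left)
      case (base a)
      then show ?case by (auto simp: T_def A_def intro: sgenerate.base)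
    next
      case (step x a)
      have "(0, a) \<in> sgenerate U A" using step by (auto simp: A_def intro: sgenerate.base)
      from sgenerate.prod[OF this step.IH[unfolded T_def]] show ?case by (simp add: U_def T_def)
    qed
  qed
  then have "{1} \<times> carrier S \<subseteq> carrier (sub_semigrp U T)" by auto
  moreover have "H_finite (sub_semigrp U T)"
    using locally_H_finiteD[OF E TV] fin_generated_sub[OF A(1), of U] by (simp add: T_def)
  ultimately have "finite ({1::nat} \<times> carrier S)"
    by (rule_tac H_finite_trivial_R[OF variety_semigroup[OF TV]]) (auto simp: U_def)
  then show False using S(3) semigroup_nonempty[OF semi] by (auto simp: finite_cartesian_product_iff)
qed

lemma L_semigrp_simps:
  "x \<cdot>\<^bsub>L_semigrp G\<^esub> y = L_prod G x y" "carrier (L_semigrp G) = carrier G <+> carrier G"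
  by (simp_all add: L_semigrp_def)

lemma L_semigrp_not_locally_H_finite:
  assumes E: "semigroup_identities E" "locally_H_finite E" and G: "novikov_adian G"
  shows "L_semigrp G \<notin> variety E"
proof
  assume L: "L_semigrp G \<in> variety E"
  interpret G: Group.group G using G by (simp add: novikov_adian_def)
  obtain A where A: "finite A" "A \<subseteq> carrier G" "generate G A = carrier G"
    using G by (auto simp: novikov_adian_def)
  obtain n :: nat where n: "n > 0" "\<And>x. x \<in> carrier G \<Longrightarrow> x [^]\<^bsub>G\<^esub> n = \<one>\<^bsub>G\<^esub>"
    using G by (auto simp: novikov_adian_def)
  \<comment> \<open>Finite exponent makes inverses positive powers, so group generators already
    generate \<open>G\<close> as a semigroup. Left multiplication of the barred identity by
    \<open>G\<close> then yields all barred elements.\<close>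
  define B where "B = insert (Inl \<one>\<^bsub>G\<^esub>) (insert (Inr \<one>\<^bsub>G\<^esub>) (Inl ` A))"
  have B: "finite B" "B \<subseteq> carrier (L_semigrp G)" using A by (auto simp: B_def L_semigrp_simps(2))
  have pow: "Inl (h [^]\<^bsub>G\<^esub> k) \<in> sgenerate (L_semigrp G) B" if "h \<in> A" for h and k :: nat
  proof (induction k)
    case (Suc k)
    have "Inl h \<in> sgenerate (L_semigrp G) B" using that by (auto simp: B_def intro: sgenerate.base)
    from sgenerate.prod[OF Suc this] show ?case by (simp add: L_semigrp_simps(1))
  qed (auto simp: B_def intro: sgenerate.base)
  have Inl: "Inl g \<in> sgenerate (L_semigrp G) B" if "g \<in> generate G A" for g
    using that
  proof induction
    case one
    then show ?case by (auto simp: B_def intro: sgenerate.base)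
  next
    case (incl h)
    then show ?case by (auto simp: B_def intro: sgenerate.base)
  next
    case (inv h)
    then have h: "h \<in> carrier G" using A by auto
    have "h [^]\<^bsub>G\<^esub> (n - 1) \<otimes>\<^bsub>G\<^esub> h = \<one>\<^bsub>G\<^esub>"
      using n h G.nat_pow_Suc[of h "n - 1"] by simp
    then have "inv\<^bsub>G\<^esub> h = h [^]\<^bsub>G\<^esub> (n - 1)" using h by (simp add: G.inv_equality)
    then show ?case using pow[OF inv] by simp
  next
    case (eng h1 h2)
    from sgenerate.prod[OF eng(3,4)] show ?case by (simp add: L_semigrp_simps(1))
  qed
  have "Inr g \<in> sgenerate (L_semigrp G) B" if "g \<in> carrier G" for g
  proof -
    have "Inr \<one>\<^bsub>G\<^esub> \<in> sgenerate (L_semigrp G) B" by (auto simp: B_def intro: sgenerate.base)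
    from sgenerate.prod[OF Inl this, of g] show ?thesis using that A(3) by (simp add: L_semigrp_simps(1))
  qed
  then have "carrier (L_semigrp G) \<subseteq> sgenerate (L_semigrp G) B"
    using Inl A(3) by (auto simp: L_semigrp_simps(2))
  then have "fin_generated (L_semigrp G)"
    unfolding fin_generated_def using B sgenerate_subset[OF variety_semigroup[OF L] B(2)] by blast
  then have "H_finite (L_semigrp G)" using locally_H_finiteD[OF E L] by blast
  then have "finite ((Inr :: _ \<Rightarrow> 'a + 'a) ` carrier G)"
    by (rule_tac H_finite_trivial_R[OF variety_semigroup[OF L]]) (auto simp: L_semigrp_simps)
  then have "finite (carrier G)" by (simp add: finite_image_iff)
  then show False using G by (simp add: novikov_adian_def)
qed

subsection \<open>The nilpotent monoid\<close>

lemma count_list_eq_set: "count_list l = count_list l' \<Longrightarrow> set l = set l'"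
  by (metis count_list_0_iff subsetI subset_antisym)

context Group.monoid
begin

definition mprod :: "'a list \<Rightarrow> 'a" where
  "mprod l = foldr (\<otimes>) l \<one>"

lemma mprod_simps [simp]: "mprod [] = \<one>" "mprod (x # l) = x \<otimes> mprod l"
  by (simp_all add: mprod_def)

lemma mprod_closed: "set l \<subseteq> carrier G \<Longrightarrow> mprod l \<in> carrier G"
  by (induction l) auto

lemma mprod_append:
  "set l \<subseteq> carrier G \<Longrightarrow> set l' \<subseteq> carrier G \<Longrightarrow> mprod (l @ l') = mprod l \<otimes> mprod l'"
  by (induction l) (auto simp: m_assoc mprod_closed)

text \<open>Equal values of \<open>count_list\<close> express that the words are rearrangements of
  each other. Collecting equal letters gives a product of powers, one for each letter, and each
  power takes finitely many values.\<close>

lemma finite_sorted_products: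
  assumes "set ks \<subseteq> carrier G" "\<And>k. k \<in> set ks \<Longrightarrow> finite (range (\<lambda>n::nat. k [^] n))"
  obtains B where "finite B" "B \<subseteq> carrier G"
    "\<And>l. set l \<subseteq> set ks \<Longrightarrow> \<exists>l'. count_list l' = count_list l \<and> mprod l' \<in> B"
proof -
  have "\<exists>B. finite B \<and> B \<subseteq> carrier G \<and> (\<forall>l. set l \<subseteq> set ks \<longrightarrow> (\<exists>l'. count_list l' = count_list l \<and> mprod l' \<in> B))"
    using assms
  proof (induction ks)
    case Nil
    show ?case
    proof (intro exI[of _ "{\<one>}"] conjI allI impI)
      show "\<exists>l'. count_list l' = count_list l \<and> mprod l' \<in> {\<one>}" if "set l \<subseteq> set []" for l :: "'a list"
        using that by (intro exI[of _ "[]"]) simp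
    qed simp_all
  next
    case (Cons k ks)
    have "\<exists>B. finite B \<and> B \<subseteq> carrier G \<and>
        (\<forall>l. set l \<subseteq> set ks \<longrightarrow> (\<exists>l'. count_list l' = count_list l \<and> mprod l' \<in> B))"
      by (rule Cons.IH) (use Cons.prems in simp_all)
    then obtain B where B': "finite B" "B \<subseteq> carrier G"
      "\<forall>l. set l \<subseteq> set ks \<longrightarrow> (\<exists>l'. count_list l' = count_list l \<and> mprod l' \<in> B)"
      by (elim exE conjE) (rule that)
    note B = B'(1,2) B'(3)[rule_format]
    have k: "k \<in> carrier G" "finite (range (\<lambda>n::nat. k [^] n))" using Cons.prems by auto
    define D where "D = (\<lambda>(x, b). x \<otimes> b) ` (range (\<lambda>n::nat. k [^] n) \<times> B)"
    have "\<exists>l'. count_list l' = count_list l \<and> mprod l' \<in> D" if l: "set l \<subseteq> set (k # ks)" for l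
    proof -
      have "set (filter (\<lambda>x. x \<noteq> k) l) \<subseteq> set ks" using l by auto
      then obtain l' where l': "count_list l' = count_list (filter (\<lambda>x. x \<noteq> k) l)" "mprod l' \<in> B"
        using B(3) by blast
      have pow: "mprod (replicate n k) = k [^] n" for n
        using k(1) by (induction n) (auto simp: nat_pow_comm[of k 1, simplified])
      have eq: "filter (\<lambda>x. x = k) l = replicate (count_list l k) k"
        by (induction l) auto
      have "set l' \<subseteq> carrier G" using l'(1) l Cons.prems(1) by (metis (no_types, lifting) count_list_eq_set filter_is_subset order_trans)
      then have "mprod (replicate (count_list l k) k @ l') = k [^] count_list l k \<otimes> mprod l'"
        using mprod_append[of "replicate (count_list l k) k" l'] k(1) pow by (auto simp: set_replicate_conv_if)
      moreover have "k [^] count_list l k \<otimes> mprod l' \<in> D"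
        unfolding D_def using l'(2) by (auto intro!: image_eqI[of _ _ "(k [^] count_list l k, mprod l')"])
      moreover have "count_list (replicate (count_list l k) k @ l') = count_list l"
      proof
        fix x
        have "count_list l x = count_list (filter (\<lambda>x. x = k) l) x + count_list (filter (\<lambda>x. x \<noteq> k) l) x"
          by (induction l) auto
        then show "count_list (replicate (count_list l k) k @ l') x = count_list l x"
          unfolding eq count_list_append l'(1) by simp
      qed
      ultimately show ?thesis by metis
    qed
    moreover have "finite D" "D \<subseteq> carrier G" using B(1,2) k by (auto simp: D_def)
    ultimately show ?case by blast
  qed
  then show ?thesis using that by blast
qed

text \<open>Rewriting \<open>w \<otimes> y\<close> letter by letter gives \<open>w \<otimes> y = s \<otimes> y \<otimes> mprod l\<close>, with \<open>s\<close> in a finite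
  set, where each prefix of \<open>l\<close> commutes with everything to the right of \<open>s \<otimes> y\<close>. Hence the
  letters of \<open>l\<close> may be permuted, and periodicity leaves finitely many values.\<close>

lemma finite_left_translates:
  assumes Y: "Y \<subseteq> carrier G" "\<And>x y. x \<in> carrier G \<Longrightarrow> y \<in> Y \<Longrightarrow> x \<otimes> y \<in> Y"
      "\<And>x y. x \<in> carrier G \<Longrightarrow> y \<in> Y \<Longrightarrow> y \<otimes> x \<in> Y"
    and A: "finite A" "A \<subseteq> carrier G"
      "\<And>P w. w \<in> carrier G \<Longrightarrow> P \<one> \<Longrightarrow> (\<And>x a. x \<in> carrier G \<Longrightarrow> P x \<Longrightarrow> a \<in> A \<Longrightarrow> P (x \<otimes> a)) \<Longrightarrow> P w"
    and W: "finite W" "W \<subseteq> carrier G"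
      "\<And>w. w \<in> carrier G \<Longrightarrow> \<exists>s\<in>W. \<exists>t\<in>carrier G. \<forall>y\<in>Y. w \<otimes> y = s \<otimes> y \<otimes> t"
    and powers: "\<And>x. x \<in> carrier G \<Longrightarrow> finite (range (\<lambda>n::nat. x [^] n))"
    and y: "y \<in> Y"
  shows "finite ((\<lambda>w. w \<otimes> y) ` carrier G)"
proof -
  \<comment> \<open>The rewriting of a word starts from the empty word, hence from
    \<open>\<one>\<close>, which may be missing in \<open>W\<close>.\<close>
  define W' where "W' = insert \<one> W"
  have W': "finite W'" "W' \<subseteq> carrier G" using W by (auto simp: W'_def)
  have ex_r: "\<forall>p\<in>W' \<times> A. \<exists>r. fst r \<in> W \<and> snd r \<in> carrier G \<and> (\<forall>y\<in>Y. fst p \<otimes> snd p \<otimes> y = fst r \<otimes> y \<otimes> snd r)"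
  proof
    fix p assume "p \<in> W' \<times> A"
    then have "fst p \<in> carrier G" "snd p \<in> carrier G" using W'(2) A(2) by auto
    then have "fst p \<otimes> snd p \<in> carrier G" by simp
    from W(3)[OF this] obtain s t where "s \<in> W" "t \<in> carrier G" "\<forall>y\<in>Y. fst p \<otimes> snd p \<otimes> y = s \<otimes> y \<otimes> t"
      by blast
    then show "\<exists>r. fst r \<in> W \<and> snd r \<in> carrier G \<and> (\<forall>y\<in>Y. fst p \<otimes> snd p \<otimes> y = fst r \<otimes> y \<otimes> snd r)"
      by (intro exI[of _ "(s, t)"]) simp
  qed
  obtain r where "\<forall>p\<in>W' \<times> A. fst (r p) \<in> W \<and> snd (r p) \<in> carrier G \<and>
      (\<forall>y\<in>Y. fst p \<otimes> snd p \<otimes> y = fst (r p) \<otimes> y \<otimes> snd (r p))"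
    using bchoice[OF ex_r] by (elim exE) (rule that)
  then have r: "fst (r (s, a)) \<in> W'" "snd (r (s, a)) \<in> carrier G"
    "\<And>y. y \<in> Y \<Longrightarrow> s \<otimes> a \<otimes> y = fst (r (s, a)) \<otimes> y \<otimes> snd (r (s, a))" if "s \<in> W'" "a \<in> A" for s a
    using that by (auto simp: W'_def)
  define K where "K = (\<lambda>p. snd (r p)) ` (W' \<times> A)"
  have K: "finite K" "K \<subseteq> carrier G" using W'(1) A(1) r(2) by (auto simp: K_def)
  \<comment> \<open>The commutation is required for all y in \<open>Y\<close> at once, since the
    next rewriting step applies it with y replaced by a \<otimes> y.\<close>
  define C where "C s l \<longleftrightarrow> set l \<subseteq> K \<and> (\<forall>\<pi> \<rho>. l = \<pi> @ \<rho> \<longrightarrow>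
    (\<forall>y\<in>Y. \<forall>x\<in>carrier G. s \<otimes> y \<otimes> mprod \<pi> \<otimes> x = s \<otimes> y \<otimes> x \<otimes> mprod \<pi>))" for s l
  have rewrite: "\<exists>s\<in>W'. \<exists>l. C s l \<and> (\<forall>y\<in>Y. w \<otimes> y = s \<otimes> y \<otimes> mprod l)" if "w \<in> carrier G" for w
    using that
  proof (rule A(3))
    show "\<exists>s\<in>W'. \<exists>l. C s l \<and> (\<forall>y\<in>Y. \<one> \<otimes> y = s \<otimes> y \<otimes> mprod l)"
      using Y(1) by (intro bexI[of _ \<one>] exI[of _ "[]"]) (auto simp: C_def W'_def)
  next
    fix w a assume w: "w \<in> carrier G" "a \<in> A"
      and "\<exists>s\<in>W'. \<exists>l. C s l \<and> (\<forall>y\<in>Y. w \<otimes> y = s \<otimes> y \<otimes> mprod l)"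
    then obtain s l where s: "s \<in> W'" "C s l" "\<And>y. y \<in> Y \<Longrightarrow> w \<otimes> y = s \<otimes> y \<otimes> mprod l" by blast
    define s' where "s' = fst (r (s, a))"
    define k where "k = snd (r (s, a))"
    have s': "s' \<in> W'" "k \<in> K" "\<And>y. y \<in> Y \<Longrightarrow> s \<otimes> a \<otimes> y = s' \<otimes> y \<otimes> k"
      using r[OF s(1) w(2)] s(1) w(2) by (auto simp: s'_def k_def K_def)
    have mem: "a \<in> carrier G" "s \<in> carrier G" "s' \<in> carrier G" "k \<in> carrier G" "set l \<subseteq> carrier G"
      using w A s s' K W' by (auto simp: C_def)
    have "w \<otimes> a \<otimes> y = s' \<otimes> y \<otimes> mprod (k # l)" if "y \<in> Y" for y
    proof -
      have yG: "y \<in> carrier G" using that Y by blast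
      have "w \<otimes> a \<otimes> y = w \<otimes> (a \<otimes> y)" using w mem yG by (simp add: m_assoc)
      also have "\<dots> = s \<otimes> (a \<otimes> y) \<otimes> mprod l" using s(3) Y(2) mem that by blast
      also have "\<dots> = s \<otimes> a \<otimes> y \<otimes> mprod l" using mem yG by (simp add: m_assoc)
      also have "\<dots> = s' \<otimes> y \<otimes> mprod (k # l)" using s'(3)[OF that] mem yG by (simp add: m_assoc mprod_closed)
      finally show ?thesis .
    qed
    moreover have "C s' (k # l)"
      unfolding C_def
    proof (intro conjI allI impI ballI)
      show "set (k # l) \<subseteq> K" using s' s by (simp add: C_def)
      fix \<pi> \<rho> y x assume \<pi>: "k # l = \<pi> @ \<rho>" and y: "y \<in> Y" and x: "x \<in> carrier G"
      have yG: "y \<in> carrier G" using y Y by blast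
      show "s' \<otimes> y \<otimes> mprod \<pi> \<otimes> x = s' \<otimes> y \<otimes> x \<otimes> mprod \<pi>"
      proof (cases \<pi>)
        case Nil
        then show ?thesis using x yG mem by simp
      next
        case (Cons k' \<pi>')
        then have \<pi>': "\<pi> = k # \<pi>'" "l = \<pi>' @ \<rho>" using \<pi> by auto
        have p: "mprod \<pi>' \<in> carrier G" using \<pi>' mem by (auto intro: mprod_closed)
        \<comment> \<open>The rule rewriting s \<otimes> a is uniform in y. It is undone at y, the
          factor x is moved in front of the old prefix, and the rule is applied again at y \<otimes>
          x. The net effect is that x has passed the new letter k too.\<close>
        have "s' \<otimes> y \<otimes> mprod \<pi> \<otimes> x = s' \<otimes> y \<otimes> k \<otimes> mprod \<pi>' \<otimes> x"
          using \<pi>' mem yG x p by (simp add: m_assoc)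
        also have "\<dots> = s \<otimes> a \<otimes> y \<otimes> mprod \<pi>' \<otimes> x" using s'(3)[OF y] by simp
        also have "\<dots> = s \<otimes> (a \<otimes> y) \<otimes> mprod \<pi>' \<otimes> x" using mem yG by (simp add: m_assoc)
        also have "\<dots> = s \<otimes> (a \<otimes> y) \<otimes> x \<otimes> mprod \<pi>'"
          using s(2) \<pi>'(2) Y(2)[OF mem(1) y] x unfolding C_def by blast
        also have "\<dots> = s \<otimes> a \<otimes> (y \<otimes> x) \<otimes> mprod \<pi>'" using mem yG x by (simp add: m_assoc)
        also have "\<dots> = s' \<otimes> (y \<otimes> x) \<otimes> k \<otimes> mprod \<pi>'" using s'(3)[OF Y(3)[OF x y]] by simp
        also have "\<dots> = s' \<otimes> y \<otimes> x \<otimes> mprod \<pi>" using \<pi>' mem yG x p by (simp add: m_assoc)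
        finally show ?thesis .
      qed
    qed
    ultimately show "\<exists>s\<in>W'. \<exists>l. C s l \<and> (\<forall>y\<in>Y. w \<otimes> a \<otimes> y = s \<otimes> y \<otimes> mprod l)"
      using s'(1) by blast
  qed
  have permute: "s \<otimes> y \<otimes> mprod \<pi> \<otimes> mprod \<rho> = s \<otimes> y \<otimes> mprod \<pi> \<otimes> mprod \<rho>'"
    if "s \<in> W'" "C s (\<pi> @ \<rho>)" "count_list \<rho> = count_list \<rho>'" for s \<pi> \<rho> \<rho>'
    using that(2,3)
  proof (induction \<rho> arbitrary: \<pi> \<rho>')
    case Nil
    have "\<rho>' = []" using count_list_eq_set[OF Nil.prems(2)] by simp
    then show ?case by simp
  next
    case (Cons k \<rho>)
    have "k \<in> set \<rho>'" using Cons.prems(2) by (metis list.set_intros(1) count_list_eq_set)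
    then obtain p q where pq: "\<rho>' = p @ k # q" by (meson split_list)
    have \<rho>: "count_list \<rho> = count_list (p @ q)" using Cons.prems(2) pq by (auto simp: fun_eq_iff split: if_splits)
    have sub: "set \<pi> \<subseteq> K" "k \<in> K" "set \<rho> \<subseteq> K" using Cons.prems(1) by (auto simp: C_def)
    have "set p \<union> set q \<subseteq> K" using count_list_eq_set[OF \<rho>] sub by auto
    then have mem: "mprod \<pi> \<in> carrier G" "k \<in> carrier G" "mprod \<rho> \<in> carrier G" "mprod p \<in> carrier G"
      "mprod q \<in> carrier G" "s \<in> carrier G" "y \<in> carrier G"
      "set \<pi> \<subseteq> carrier G" "set p \<subseteq> carrier G" "set q \<subseteq> carrier G"
      using sub K that(1) W' y Y by (auto intro!: mprod_closed)
    have comm: "s \<otimes> y \<otimes> mprod \<pi> \<otimes> x = s \<otimes> y \<otimes> x \<otimes> mprod \<pi>"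
      "s \<otimes> y \<otimes> mprod (\<pi> @ [k]) \<otimes> x = s \<otimes> y \<otimes> x \<otimes> mprod (\<pi> @ [k])"
      if "x \<in> carrier G" for x
    proof -
      have "\<pi> @ k # \<rho> = \<pi> @ (k # \<rho>)" "\<pi> @ k # \<rho> = (\<pi> @ [k]) @ \<rho>" by auto
      then show "s \<otimes> y \<otimes> mprod \<pi> \<otimes> x = s \<otimes> y \<otimes> x \<otimes> mprod \<pi>"
        "s \<otimes> y \<otimes> mprod (\<pi> @ [k]) \<otimes> x = s \<otimes> y \<otimes> x \<otimes> mprod (\<pi> @ [k])"
        using Cons.prems(1) y that unfolding C_def by blast+
    qed
    have \<pi>k: "mprod (\<pi> @ [k]) = mprod \<pi> \<otimes> k" using mem by (simp add: mprod_append)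
    \<comment> \<open>The letter k is brought in front of p by two exchanges: first p passes the
      prefix \<pi> to the left, then it passes \<pi> followed by k back to the right.\<close>
    have "s \<otimes> y \<otimes> mprod \<pi> \<otimes> mprod \<rho>' = s \<otimes> y \<otimes> mprod \<pi> \<otimes> mprod p \<otimes> k \<otimes> mprod q"
      using mem by (simp add: pq mprod_append m_assoc)
    also have "\<dots> = s \<otimes> y \<otimes> mprod p \<otimes> mprod (\<pi> @ [k]) \<otimes> mprod q"
      unfolding comm(1)[OF mem(4)] \<pi>k using mem by (simp add: m_assoc)
    also have "\<dots> = s \<otimes> y \<otimes> mprod (\<pi> @ [k]) \<otimes> mprod p \<otimes> mprod q"
      unfolding comm(2)[OF mem(4)] ..
    also have "\<dots> = s \<otimes> y \<otimes> mprod (\<pi> @ [k]) \<otimes> mprod (p @ q)"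
      using mem by (simp add: \<pi>k m_assoc mprod_append)
    also have "\<dots> = s \<otimes> y \<otimes> mprod (\<pi> @ [k]) \<otimes> mprod \<rho>"
      using Cons.IH[of "\<pi> @ [k]" "p @ q"] Cons.prems(1) \<rho> by simp
    also have "\<dots> = s \<otimes> y \<otimes> mprod \<pi> \<otimes> mprod (k # \<rho>)" unfolding \<pi>k using mem by (simp add: m_assoc)
    finally show ?case by simp
  qed
  obtain ks where ks: "set ks = K" using finite_list[OF K(1)] by blast
  obtain B where B: "finite B" "B \<subseteq> carrier G"
    "\<And>l. set l \<subseteq> K \<Longrightarrow> \<exists>l'. count_list l' = count_list l \<and> mprod l' \<in> B"
    by (rule finite_sorted_products[of ks]) (use ks K powers in auto)
  have "(\<lambda>w. w \<otimes> y) ` carrier G \<subseteq> (\<lambda>(s, b). s \<otimes> y \<otimes> b) ` (W' \<times> B)"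
  proof
    fix z assume "z \<in> (\<lambda>w. w \<otimes> y) ` carrier G"
    then obtain w where "w \<in> carrier G" "z = w \<otimes> y" by blast
    then obtain s l where s: "s \<in> W'" "C s l" "z = s \<otimes> y \<otimes> mprod l" using rewrite y by blast
    then have "set l \<subseteq> K" by (simp add: C_def)
    then obtain l' where l': "count_list l' = count_list l" "mprod l' \<in> B" using B(3) by blast
    have "s \<otimes> y \<otimes> mprod [] \<otimes> mprod l = s \<otimes> y \<otimes> mprod [] \<otimes> mprod l'"
      by (rule permute) (use s(1,2) l'(1) in simp_all)
    moreover have "s \<otimes> y \<in> carrier G" using s(1) W'(2) y Y(1) by blast
    ultimately have "z = s \<otimes> y \<otimes> mprod l'" unfolding s(3) by simp
    then show "z \<in> (\<lambda>(s, b). s \<otimes> y \<otimes> b) ` (W' \<times> B)" using s(1) l'(2) by force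
  qed
  then show ?thesis using W'(1) B(1) by (meson finite_SigmaI finite_imageI finite_subset)
qed

end

lemma adj_induct_right:
  assumes "is_semigroup S" "X \<subseteq> carrier S" "sgenerate S X = carrier S" "w \<in> carrier (adj S)"
    and one: "P \<one>\<^bsub>adj S\<^esub>"
    and step: "\<And>x a. x \<in> carrier (adj S) \<Longrightarrow> P x \<Longrightarrow> a \<in> Some ` X \<Longrightarrow> P (x \<otimes>\<^bsub>adj S\<^esub> a)"
  shows "P w"
proof (cases w)
  case (Some s)
  then have "s \<in> sgenerate S X" using assms(3,4) by simp
  with assms(1,2) have "P (Some s)"
  proof (induction rule: sgenerate_induct_right)
    case (base a)
    then show ?case using step[of None "Some a"] one by simp
  next
    case (step x a)
    then show ?case using assms(6)[of "Some x" "Some a"] assms(3) by simp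
  qed
  then show ?thesis using Some by simp
qed (use one in simp)

text \<open>Left multiplication by w is a map \<open>F w\<close> on \<open>S\<close>, and (1, F w)
  lies in the finitely generated \<open>T\<close>. If two such pairs are R-related, the connecting
  factor is a constant with first component 0, so w y = s y t for all y with one fixed t. Finitely
  many R-classes thus give the hypothesis of \<open>finite_left_translates\<close>.\<close>

lemma N21_not_locally_H_finite:
  fixes S :: "'a semigrp"
  assumes E: "semigroup_identities E" "locally_H_finite E"
    and S: "S \<in> variety E" "fin_generated S" "infinite (carrier S)"
  shows "N21 \<notin> variety E"
proof
  assume N21: "N21 \<in> variety E"
  have semi: "is_semigroup S" using S(1) by (rule variety_semigroup)
  interpret M: Group.monoid "adj S" using semi by (rule monoid_adj)
  obtain X where X: "finite X" "X \<subseteq> carrier S" "sgenerate S X = carrier S"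
    using S(2) by (auto simp: fin_generated_def)
  define pt where "pt f g = (\<lambda>y\<in>carrier S. f y \<cdot>\<^bsub>S\<^esub> g y)" for f g :: "'a \<Rightarrow> 'a"
  define const where "const s = (\<lambda>y\<in>carrier S. s)" for s :: 'a
  define U :: "(nat \<times> ('a \<Rightarrow> 'a)) semigrp" where
    "U = \<lparr>carrier = {0, 1, 2} \<times> (carrier S \<rightarrow>\<^sub>E carrier S),
      sprod = (\<lambda>x y. (fst x \<cdot>\<^bsub>N21\<^esub> fst y, pt (snd x) (snd y)))\<rparr>"
  have U_mult: "(m, f) \<cdot>\<^bsub>U\<^esub> (n, g) = (min 2 (m + n), pt f g)" for m f n g by (simp add: U_def)
  have const_mem: "const s \<in> carrier S \<rightarrow>\<^sub>E carrier S" if "s \<in> carrier S" for s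
    using that by (auto simp: const_def)
  have U: "U \<in> variety E"
  proof (rule variety_subdirect[where A = N21 and B = S and f = fst and I = "carrier S" and
        g = "\<lambda>i x. snd x i", OF E(1) N21 S(1)])
    show "carrier U \<noteq> {}" using semigroup_nonempty[OF semi] const_mem by (auto simp: U_def)
    show "x = y" if "x \<in> carrier U" "y \<in> carrier U" "fst x = fst y" "\<forall>i\<in>carrier S. snd x i = snd y i" for x y
    proof (rule prod_eqI)
      show "snd x = snd y"
        by (rule PiE_ext[of _ "carrier S" "\<lambda>_. carrier S"]) (use that in \<open>auto simp: U_def\<close>)
    qed (rule that(3))
  qed (auto simp: U_def pt_def PiE_iff semigroup_closed[OF semi])
  define one where "one = (1::nat, \<lambda>y\<in>carrier S. y)"
  define A where "A = insert one ((\<lambda>x. (0, const x)) ` X)"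
  define T where "T = sgenerate U A"
  have A: "finite A" "A \<subseteq> carrier U" "A \<noteq> {}"
    using X const_mem by (auto simp: A_def one_def U_def)
  have TV: "sub_semigrp U T \<in> variety E" unfolding T_def using variety_sub[OF E(1) U A(2,3)] .
  have Tsemi: "is_semigroup (sub_semigrp U T)" using TV by (rule variety_semigroup)
  have pt_const: "pt (const s) (const t) = const (s \<cdot>\<^bsub>S\<^esub> t)" for s t
    by (auto simp: pt_def const_def)
  have const_T: "(0, const w) \<in> T" if "w \<in> carrier S" for w
  proof -
    have "w \<in> sgenerate S X" using that X by simp
    with semi X(2) show ?thesis
    proof (induction rule: sgenerate_induct_left)
      case (base a)
      then show ?case by (auto simp: T_def A_def intro: sgenerate.base)
    next
      case (step x a)
      have "(0, const a) \<in> sgenerate U A" using step by (auto simp: A_def intro: sgenerate.base)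
      from sgenerate.prod[OF this step.IH[unfolded T_def]] show ?case by (simp add: U_mult T_def pt_const)
    qed
  qed
  have T_const: "fst u = 0 \<longrightarrow> (\<exists>t\<in>carrier S. snd u = const t)" if "u \<in> T" for u
    using that unfolding T_def
  proof induction
    case (base a)
    then show ?case using X(2) by (auto simp: A_def one_def)
  next
    case (prod u v)
    obtain m f n g where uv: "u = (m, f)" "v = (n, g)" by (cases u; cases v)
    show ?case
      using prod(3,4) pt_const semigroup_closed[OF semi] unfolding uv U_mult by (auto simp: min_def split: if_splits)
  qed
  define F where "F w = (\<lambda>y\<in>carrier S. the (w \<otimes>\<^bsub>adj S\<^esub> Some y))" for w
  have F_T: "(1, F w) \<in> T" if "w \<in> carrier (adj S)" for w
  proof (cases w)
    case None
    then have "(1, F w) = one" by (auto simp: F_def one_def)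
    then show ?thesis by (auto simp: T_def A_def intro: sgenerate.base)
  next
    case (Some s)
    then have s: "s \<in> carrier S" using that by simp
    have "one \<in> T" by (auto simp: T_def A_def intro: sgenerate.base)
    then have "(0, const s) \<cdot>\<^bsub>U\<^esub> one \<in> T" using const_T[OF s] unfolding T_def by (rule_tac sgenerate.prod)
    moreover have "(0, const s) \<cdot>\<^bsub>U\<^esub> one = (1, F w)"
      unfolding one_def U_mult by (auto simp: pt_def F_def const_def Some)
    ultimately show ?thesis by simp
  qed
  have HT: "H_finite (sub_semigrp U T)"
    using locally_H_finiteD[OF E TV] fin_generated_sub[OF A(1), of U] by (simp add: T_def)
  then obtain R where R: "finite R" "\<forall>x\<in>T. \<exists>y\<in>R. (x, y) \<in> greenR (sub_semigrp U T)"
    unfolding H_finite_iff using finite_quotient_iff[OF green_equiv(1), of "sub_semigrp U T"] by auto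
  define rep where "rep y = (SOME w. w \<in> carrier (adj S) \<and> ((1, F w), y) \<in> greenR (sub_semigrp U T))" for y
  define W where "W = rep ` {y \<in> R. \<exists>w. w \<in> carrier (adj S) \<and> ((1, F w), y) \<in> greenR (sub_semigrp U T)}"
  have rep: "rep y \<in> carrier (adj S) \<and> ((1, F (rep y)), y) \<in> greenR (sub_semigrp U T)"
    if "w \<in> carrier (adj S)" "((1, F w), y) \<in> greenR (sub_semigrp U T)" for w y
    unfolding rep_def using that by (rule_tac someI) auto
  have W: "finite W" "W \<subseteq> carrier (adj S)" using R(1) rep by (auto simp: W_def)
  have key: "\<exists>s\<in>W. \<exists>t\<in>carrier (adj S). \<forall>y\<in>Some ` carrier S. w \<otimes>\<^bsub>adj S\<^esub> y = s \<otimes>\<^bsub>adj S\<^esub> y \<otimes>\<^bsub>adj S\<^esub> t"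
    if w: "w \<in> carrier (adj S)" for w
  proof -
    obtain z where z: "z \<in> R" "((1, F w), z) \<in> greenR (sub_semigrp U T)" using R(2) F_T[OF w] by blast
    define s where "s = rep z"
    have s: "s \<in> W" "s \<in> carrier (adj S)" "((1, F s), z) \<in> greenR (sub_semigrp U T)"
      using rep[OF w z(2)] z w by (auto simp: s_def W_def)
    have FS: "Some (F v y) = v \<otimes>\<^bsub>adj S\<^esub> Some y" "F v y \<in> carrier S"
      if "v \<in> carrier (adj S)" "y \<in> carrier S" for v y
      using that semigroup_closed[OF semi] by (auto simp: F_def carrier_adj)
    have "((1, F s), (1, F w)) \<in> greenR (sub_semigrp U T)"
      using z(2) s(3) green_equiv(1)[of "sub_semigrp U T"] unfolding equiv_def by (meson symE transE)
    then consider "(1::nat, F s) = (1, F w)" | u where "u \<in> T" "(1, F s) \<cdot>\<^bsub>U\<^esub> u = (1, F w)"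
      unfolding greenR_iff[OF Tsemi] by auto
    then show ?thesis
    proof cases
      case 1
      then have "w \<otimes>\<^bsub>adj S\<^esub> Some y = s \<otimes>\<^bsub>adj S\<^esub> Some y" if "y \<in> carrier S" for y
        using FS(1)[OF w that] FS(1)[OF s(2) that] by simp
      then show ?thesis using s(1) by (intro bexI[of _ s] bexI[of _ None]) auto
    next
      case 2
      obtain m g where u: "u = (m, g)" by (cases u)
      \<comment> \<open>Adding m must leave the first component at 1, short of the
        truncation.\<close>
      have "m = 0" using 2(2) by (simp add: u U_mult min_def split: if_splits)
      then obtain t where t: "t \<in> carrier S" "g = const t" using T_const[OF 2(1)] u by auto
      have "w \<otimes>\<^bsub>adj S\<^esub> Some y = s \<otimes>\<^bsub>adj S\<^esub> Some y \<otimes>\<^bsub>adj S\<^esub> Some t" if "y \<in> carrier S" for y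
      proof -
        have "F w = pt (F s) (const t)" using 2(2) by (simp add: u U_mult t)
        then have "F w y = F s y \<cdot>\<^bsub>S\<^esub> t" using that by (simp add: pt_def const_def)
        then show ?thesis using FS(1)[OF w that] FS(1)[OF s(2) that] by (metis adj_simps(4))
      qed
      then show ?thesis using s(1) t(1) by (intro bexI[of _ s] bexI[of _ "Some t"]) auto
    qed
  qed
  obtain p q :: nat where pq: "p \<ge> 1" "q \<ge> 1"
    "\<And>x. x \<in> carrier (adj S) \<Longrightarrow> x [^]\<^bsub>adj S\<^esub> (p + q) = x [^]\<^bsub>adj S\<^esub> p"
    by (rule exponents[OF E(1) posN_not_locally_H_finite[OF E(2)] S(1)]) (rule that)
  have fin: "finite ((\<lambda>w. w \<otimes>\<^bsub>adj S\<^esub> Some y) ` carrier (adj S))" if "y \<in> carrier S" for y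
  proof (rule M.finite_left_translates[where Y = "Some ` carrier S" and A = "Some ` X" and W = W])
    show "finite (range (\<lambda>n::nat. x [^]\<^bsub>adj S\<^esub> n))" if "x \<in> carrier (adj S)" for x
      using M.finite_powers[OF that pq(3)[OF that] pq(2)] .
    show "P w" if "w \<in> carrier (adj S)" "P \<one>\<^bsub>adj S\<^esub>"
      "\<And>x a. x \<in> carrier (adj S) \<Longrightarrow> P x \<Longrightarrow> a \<in> Some ` X \<Longrightarrow> P (x \<otimes>\<^bsub>adj S\<^esub> a)" for P w
      by (rule adj_induct_right[OF semi X(2,3)]) (use that in auto)
  qed (use X W key that semigroup_closed[OF semi] in \<open>auto simp: carrier_adj\<close>)
  \<comment> \<open>Every element ends in a generator, so \<open>S\<close> is covered by the left
    translates of finitely many elements.\<close>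
  have "Some ` carrier S \<subseteq> (\<Union>x\<in>X. (\<lambda>w. w \<otimes>\<^bsub>adj S\<^esub> Some x) ` carrier (adj S))"
  proof clarify
    fix s assume "s \<in> carrier S"
    then have "s \<in> sgenerate S X" using X by simp
    with semi X(2) show "Some s \<in> (\<Union>x\<in>X. (\<lambda>w. w \<otimes>\<^bsub>adj S\<^esub> Some x) ` carrier (adj S))"
    proof (induction rule: sgenerate_induct_right)
      case (base a)
      then show ?case by (auto intro!: bexI[of _ a] image_eqI[of _ _ None])
    next
      case (step x a)
      then have "Some (x \<cdot>\<^bsub>S\<^esub> a) \<in> (\<lambda>w. w \<otimes>\<^bsub>adj S\<^esub> Some a) ` carrier (adj S)"
        using X(3) by (intro image_eqI[of _ _ "Some x"]) auto
      then show ?case using step.hyps by blast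
    qed
  qed
  then have "finite (Some ` carrier S)"
    using X(1,2) fin by (meson finite_UN_I finite_subset subsetD)
  then show False using S(3) by (simp add: finite_image_iff)
qed

subsection \<open>The necessary condition\<close>

text \<open>The role of \<open>S0\<close> is to exclude \<open>P3\<close>, its dual and
  \<open>N21\<close> from the variety; \<open>S\<close> itself may be finite or not finitely
  generated. The ideal is \<open>Gr S\<close>.\<close>

lemma locally_H_finite_imp_extension:
  fixes S :: "'c semigrp" and S0 :: "'x semigrp"
  assumes E: "semigroup_identities E" "locally_H_finite E"
    and S0: "S0 \<in> variety E" "fin_generated S0" "infinite (carrier S0)"
    and S: "S \<in> variety E"
  shows "\<exists>J. locally_finite_extension S J \<and>
    periodic (sub_semigrp S J) \<and> completely_regular (sub_semigrp S J)"
proof -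
  have semi: "is_semigroup S" using S by (rule variety_semigroup)
  interpret M: Group.monoid "adj S" using semi by (rule monoid_adj)
  note posN = posN_not_locally_H_finite[OF E(2)]
  have P3: "P3 \<notin> variety E" "P3 \<notin> variety (rev_ids E)"
    using P3_not_locally_H_finite[OF E S0]
      P3_not_locally_H_finite[OF _ locally_H_finite_rev[OF E] opp_variety[OF E(1) S0(1)]] E(1) S0
    by simp_all
  note N21 = N21_not_locally_H_finite[OF E S0]
  have J: "is_ideal (Gr S) S" using Gr_ideal[OF E(1) posN P3 N21 S] .
  have "locally_finite (rees_quotient S (Gr S))"
    unfolding locally_finite_def
  proof (intro allI impI)
    fix A assume A: "finite A \<and> A \<subseteq> carrier (rees_quotient S (Gr S))"
    define B where "B = {x. Some x \<in> A}"
    have B: "finite B" "B \<subseteq> carrier S"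
    proof -
      have "Some ` B \<subseteq> A" by (auto simp: B_def)
      then show "finite B" using A by (metis finite_image_iff finite_subset inj_Some)
    qed (use A in \<open>auto simp: B_def rees_quotient_def\<close>)
    have "finite (sgenerate S B - Gr S)"
    proof (cases "B = {}")
      case False
      define T where "T = sub_semigrp S (sgenerate S B)"
      have T: "T \<in> variety E" "fin_generated T" "carrier T = sgenerate S B"
        using variety_sub[OF E(1) S B(2) False] fin_generated_sub[OF B(1)] by (simp_all add: T_def)
      have sub: "sgenerate S B \<subseteq> carrier S" using sgenerate_subset[OF semi B(2)] .
      obtain k :: nat where k: "k \<ge> 1" "\<And>x. x \<in> carrier (adj S) \<Longrightarrow>
          x [^]\<^bsub>adj S\<^esub> k \<otimes>\<^bsub>adj S\<^esub> x [^]\<^bsub>adj S\<^esub> k = x [^]\<^bsub>adj S\<^esub> k"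
        by (rule idempotent_exponent[OF E(1) posN S]) (rule that)
      have "x \<in> Gr S" if x: "x \<in> carrier S" and u: "u \<in> carrier S" and v: "v \<in> carrier S" and xuv: "x \<cdot>\<^bsub>S\<^esub> u \<cdot>\<^bsub>S\<^esub> v = x" for x u v
      proof -
        \<comment> \<open>From x = x d follows x = x d^k with d^k idempotent, so the dual of
          \<open>Gr_left_identity\<close> applies to x. Hence outside \<open>Gr S\<close> no product
          x u leads back to x, and R-classes there are trivial.\<close>
        define d where "d = u \<cdot>\<^bsub>S\<^esub> v"
        have d: "d \<in> carrier S" "x \<cdot>\<^bsub>S\<^esub> d = x"
          using semigroup_closed[OF semi u v] semigroup_assoc[OF semi x u v] xuv by (auto simp: d_def)
        have xd: "Some x \<otimes>\<^bsub>adj S\<^esub> Some d [^]\<^bsub>adj S\<^esub> n = Some x" for n :: nat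
        proof (induction n)
          case (Suc n)
          then show ?case
            using M.m_assoc[of "Some x" "Some d [^]\<^bsub>adj S\<^esub> n" "Some d"] x d by simp
        qed (use x in simp)
        obtain e where e: "e \<in> carrier S" "Some d [^]\<^bsub>adj S\<^esub> k = Some e"
          using adj_pow_carrier[OF semi, of "Some d" k] k(1) d(1) by blast
        have "e \<cdot>\<^bsub>S\<^esub> e = e" "x \<cdot>\<^bsub>S\<^esub> e = x" using k(2)[of "Some d"] xd[of k] e d by auto
        moreover have "N21 \<notin> variety (rev_ids E)"
          using opp_variety_iff[OF E(1), of N21] N21 by (simp add: opp_N21)
        ultimately have "x \<in> Gr (opp S)"
          using Gr_left_identity[of "rev_ids E" "opp S" e x] P3 opp_variety[OF E(1) S] E(1) e(1) x by simp
        then show ?thesis by (simp add: Gr_opp[OF semi])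
      qed
      note in_Gr = this
      show ?thesis
      proof (rule H_finite_trivial_R[OF variety_semigroup[OF T(1)] locally_H_finiteD[OF E T(1,2)]])
        fix x u assume xu: "x \<in> sgenerate S B - Gr S" "u \<in> carrier T" "\<exists>v\<in>carrier T. x \<cdot>\<^bsub>T\<^esub> u \<cdot>\<^bsub>T\<^esub> v = x"
        then obtain v where "v \<in> carrier S" "x \<cdot>\<^bsub>S\<^esub> u \<cdot>\<^bsub>S\<^esub> v = x" using sub T(3) by (auto simp: T_def)
        then have "x \<in> Gr S" using in_Gr xu(1,2) sub T(3) by blast
        then show "x \<cdot>\<^bsub>T\<^esub> u = x" using xu(1) by simp
      qed (simp add: T(3))
    qed simp
    moreover have "y \<in> insert None (Some ` (sgenerate S B - Gr S))" if "y \<in> sgenerate (rees_quotient S (Gr S)) A" for y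
      using that
    proof induction
      case (base a)
      then show ?case using A by (cases a) (auto simp: B_def rees_quotient_def intro: sgenerate.base)
    next
      case (prod y z)
      show ?case
      proof (cases "y = None \<or> z = None")
        case True
        then show ?thesis by (cases y; cases z) (auto simp: rees_quotient_def)
      next
        case False
        then obtain a b where ab: "y = Some a" "z = Some b" "a \<in> sgenerate S B" "b \<in> sgenerate S B"
          using prod(3,4) by auto
        then have "a \<cdot>\<^bsub>S\<^esub> b \<in> sgenerate S B" by (intro sgenerate.prod)
        then show ?thesis by (simp add: ab(1,2) rees_quotient_def)
      qed
    qed
    ultimately show "finite (sgenerate (rees_quotient S (Gr S)) A)"
      by (meson finite_imageI finite_insert finite_subset subsetI)
  qed
  then show ?thesis
    using J finite_order_ideal[OF semi J] unfolding locally_finite_extension_def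
    by (intro exI[of _ "Gr S"]) (auto simp: Gr_def)
qed

section \<open>Green's relations in monoids\<close>

text \<open>Used in \<open>adj S\<close>, where the adjoined identity absorbs the separate case of
  equal elements.\<close>

definition Rrel :: "('m, 'x) monoid_scheme \<Rightarrow> 'm \<Rightarrow> 'm \<Rightarrow> bool" where
  "Rrel M x y \<longleftrightarrow> (\<exists>u\<in>carrier M. y = x \<otimes>\<^bsub>M\<^esub> u) \<and> (\<exists>v\<in>carrier M. x = y \<otimes>\<^bsub>M\<^esub> v)"

definition Lrel :: "('m, 'x) monoid_scheme \<Rightarrow> 'm \<Rightarrow> 'm \<Rightarrow> bool" where
  "Lrel M x y \<longleftrightarrow> (\<exists>u\<in>carrier M. y = u \<otimes>\<^bsub>M\<^esub> x) \<and> (\<exists>v\<in>carrier M. x = v \<otimes>\<^bsub>M\<^esub> y)"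

lemma adj_bex:
  "(\<exists>u\<in>carrier (adj S). P u) \<longleftrightarrow> P None \<or> (\<exists>s\<in>carrier S. P (Some s))"
  by (auto simp: carrier_adj)

lemma greenR_Rrel:
  assumes "is_semigroup S"
  shows "(x, y) \<in> greenR S \<longleftrightarrow> x \<in> carrier S \<and> y \<in> carrier S \<and> Rrel (adj S) (Some x) (Some y)"
  unfolding greenR_iff[OF assms] Rrel_def adj_bex by simp metis

lemma greenL_Lrel:
  assumes "is_semigroup S"
  shows "(x, y) \<in> greenL S \<longleftrightarrow> x \<in> carrier S \<and> y \<in> carrier S \<and> Lrel (adj S) (Some x) (Some y)"
  unfolding greenL_iff[OF assms] Lrel_def adj_bex by simp metis

context Group.monoid
begin

lemma Rrel_refl: "x \<in> carrier G \<Longrightarrow> Rrel G x x"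
  unfolding Rrel_def by (intro conjI bexI[of _ \<one>]) auto

lemma Lrel_refl: "x \<in> carrier G \<Longrightarrow> Lrel G x x"
  unfolding Lrel_def by (intro conjI bexI[of _ \<one>]) auto

lemma Rrel_sym: "Rrel G x y \<Longrightarrow> Rrel G y x"
  unfolding Rrel_def by blast

lemma Lrel_sym: "Lrel G x y \<Longrightarrow> Lrel G y x"
  unfolding Lrel_def by blast

lemma Rrel_trans:
  assumes "x \<in> carrier G" "z \<in> carrier G" "Rrel G x y" "Rrel G y z"
  shows "Rrel G x z"
proof -
  obtain u v u' v' where uv: "u \<in> carrier G" "v \<in> carrier G" "u' \<in> carrier G" "v' \<in> carrier G"
    and eq: "y = x \<otimes> u" "x = y \<otimes> v" "z = y \<otimes> u'" "y = z \<otimes> v'"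
    using assms(3,4) unfolding Rrel_def by blast
  have "z = x \<otimes> (u \<otimes> u')" using m_assoc[OF assms(1) uv(1,3)] eq(1,3) by simp
  moreover have "x = z \<otimes> (v' \<otimes> v)" using m_assoc[OF assms(2) uv(4,2)] eq(2,4) by simp
  ultimately show ?thesis
    unfolding Rrel_def using m_closed[OF uv(1,3)] m_closed[OF uv(4,2)] by blast
qed

lemma Lrel_trans:
  assumes "x \<in> carrier G" "z \<in> carrier G" "Lrel G x y" "Lrel G y z"
  shows "Lrel G x z"
proof -
  obtain u v u' v' where uv: "u \<in> carrier G" "v \<in> carrier G" "u' \<in> carrier G" "v' \<in> carrier G"
    and eq: "y = u \<otimes> x" "x = v \<otimes> y" "z = u' \<otimes> y" "y = v' \<otimes> z"
    using assms(3,4) unfolding Lrel_def by blast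
  have "z = u' \<otimes> u \<otimes> x" using m_assoc[OF uv(3,1) assms(1)] eq(1,3) by simp
  moreover have "x = v \<otimes> v' \<otimes> z" using m_assoc[OF uv(2,4) assms(2)] eq(2,4) by simp
  ultimately show ?thesis
    unfolding Lrel_def using m_closed[OF uv(3,1)] m_closed[OF uv(2,4)] by blast
qed

lemma Rrel_left_cong:
  assumes "x \<in> carrier G" "y \<in> carrier G" "c \<in> carrier G" "Rrel G x y"
  shows "Rrel G (c \<otimes> x) (c \<otimes> y)"
  using assms unfolding Rrel_def by (metis m_assoc)

lemma Lrel_right_cong:
  assumes "x \<in> carrier G" "y \<in> carrier G" "c \<in> carrier G" "Lrel G x y"
  shows "Lrel G (x \<otimes> c) (y \<otimes> c)"
  using assms unfolding Lrel_def by (metis m_assoc)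

lemma pow_mult_shift:
  assumes "a \<in> carrier G" "b \<in> carrier G"
  shows "(a \<otimes> b) [^] Suc n = a \<otimes> (b \<otimes> a) [^] n \<otimes> b"
proof (induction n)
  case (Suc n)
  have "(a \<otimes> b) [^] Suc (Suc n) = a \<otimes> (b \<otimes> a) [^] n \<otimes> b \<otimes> (a \<otimes> b)" using Suc by simp
  also have "\<dots> = a \<otimes> ((b \<otimes> a) [^] n \<otimes> (b \<otimes> a)) \<otimes> b" using assms by (simp add: m_assoc)
  finally show ?case by simp
qed (use assms in simp)

text \<open>An element of finite order inside an ideal of such elements stays in its
  \<open>\<R>\<close>-class when multiplied by one of its divisors, even if the divisor lies outside the ideal.\<close>

lemma Rrel_mult_divisor:
  assumes J: "J \<subseteq> carrier G" "\<And>x y. x \<in> carrier G \<Longrightarrow> y \<in> J \<Longrightarrow> x \<otimes> y \<in> J"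
      "\<And>x. x \<in> J \<Longrightarrow> \<exists>n\<ge>2. x [^] (n::nat) = x"
    and k: "(k::nat) \<ge> 1" "\<And>x. x \<in> carrier G \<Longrightarrow> x [^] k \<otimes> x [^] k = x [^] k"
    and x: "x \<in> J" "u \<in> carrier G" "a \<in> carrier G" "v \<in> carrier G" "x = u \<otimes> a \<otimes> v"
  shows "Rrel G x (x \<otimes> a)"
proof -
  have xG: "x \<in> carrier G" using x J by blast
  \<comment> \<open>The divisor a may lie outside \<open>J\<close>, but a \<otimes> b contains x and
    so has finite order. Expanding a power of a \<otimes> b that equals it reproduces x followed by
    a \<otimes> b.\<close>
  define b where "b = v \<otimes> x"
  have bG: "b \<in> carrier G" using x xG by (simp add: b_def)
  have "a \<otimes> b \<in> J" using x J xG by (simp add: b_def)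
  then obtain n :: nat where n: "n \<ge> 2" "(a \<otimes> b) [^] n = a \<otimes> b" using J(3) by blast
  define m where "m = n - 2"
  have "n = Suc (Suc m)" using n(1) by (simp add: m_def)
  then have "a \<otimes> b = a \<otimes> (b \<otimes> a) [^] Suc m \<otimes> b"
    using n(2) pow_mult_shift[OF x(3) bG, of "Suc m"] by simp
  also have "\<dots> = a \<otimes> (b \<otimes> a) [^] m \<otimes> v \<otimes> x \<otimes> (a \<otimes> b)"
    using x xG bG by (simp add: b_def m_assoc)
  finally have ab: "a \<otimes> b = a \<otimes> (b \<otimes> a) [^] m \<otimes> v \<otimes> x \<otimes> (a \<otimes> b)" .
  define c where "c = a \<otimes> b"
  have cG: "c \<in> carrier G" using x bG by (simp add: c_def)
  obtain p :: nat where p: "p \<ge> 2" "x [^] p = x" using J(3) x(1) by blast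
  define \<alpha> where "\<alpha> = x [^] (p - 2) \<otimes> u \<otimes> (a \<otimes> (b \<otimes> a) [^] m \<otimes> v)"
  have \<alpha>: "\<alpha> \<in> carrier G" using x xG bG by (simp add: \<alpha>_def)
  have "p - 2 + 2 = p" using p(1) by simp
  then have "x = x [^] (p - 2) \<otimes> x [^] (2::nat)" using nat_pow_mult[OF xG, of "p - 2" 2] p(2) by simp
  also have "x [^] (2::nat) = x \<otimes> x" using xG by (simp add: numeral_2_eq_2)
  also have "x \<otimes> x = u \<otimes> (a \<otimes> b)"
  proof -
    have "x \<otimes> x = u \<otimes> a \<otimes> v \<otimes> x" using x(5) by simp
    then show ?thesis using x(2-4) xG by (simp add: b_def m_assoc)
  qed
  also have "x [^] (p - 2) \<otimes> (u \<otimes> (a \<otimes> b)) = \<alpha> \<otimes> x \<otimes> c"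
    by (subst ab) (use x(2-4) xG bG in \<open>simp add: \<alpha>_def c_def m_assoc\<close>)
  finally have step: "x = \<alpha> \<otimes> x \<otimes> c" .
  have "x = \<alpha> [^] j \<otimes> x \<otimes> c [^] j" for j :: nat
  proof (induction j)
    case (Suc j)
    have "\<alpha> [^] Suc j \<otimes> x \<otimes> c [^] Suc j = \<alpha> [^] j \<otimes> (\<alpha> \<otimes> x \<otimes> c) \<otimes> c [^] j"
      using \<alpha> cG xG nat_pow_Suc2[OF cG, of j] by (simp add: m_assoc)
    then show ?case using Suc step by simp
  qed (use xG in simp)
  \<comment> \<open>Iterating x = \<alpha> x c brings in c^k, which is idempotent; multiplying once
    more by c^k changes nothing, so x c^k = x. As k is positive, x c^k has x a as a prefix.\<close>
  then have "x \<otimes> c [^] k = \<alpha> [^] k \<otimes> x \<otimes> c [^] k \<otimes> c [^] k" by metis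
  also have "\<dots> = \<alpha> [^] k \<otimes> x \<otimes> c [^] k" using \<alpha> cG xG k(2)[OF cG] by (simp add: m_assoc)
  also have "\<dots> = x" using \<open>\<And>j. x = \<alpha> [^] j \<otimes> x \<otimes> c [^] j\<close> by metis
  finally have "x = x \<otimes> c [^] k" ..
  also have "c [^] k = c \<otimes> c [^] (k - 1)" using nat_pow_Suc2[OF cG, of "k - 1"] k(1) by simp
  also have "x \<otimes> (c \<otimes> c [^] (k - 1)) = x \<otimes> a \<otimes> (b \<otimes> c [^] (k - 1))"
    using x(3) bG cG xG unfolding c_def by (simp add: m_assoc)
  finally have "x = x \<otimes> a \<otimes> (b \<otimes> c [^] (k - 1))" .
  moreover have "b \<otimes> c [^] (k - 1) \<in> carrier G" using bG cG by simp
  ultimately show ?thesis unfolding Rrel_def using x(3) by blast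
qed

subsection \<open>Maximal subgroups\<close>

text \<open>The units of the local monoid eGe.\<close>

definition max_subgroup :: "'a \<Rightarrow> 'a monoid" where
  "max_subgroup e = units_of \<lparr>carrier = {x \<in> carrier G. e \<otimes> x = x \<and> x \<otimes> e = x}, mult = (\<otimes>), one = e\<rparr>"

context
  fixes e assumes e: "e \<in> carrier G" "e \<otimes> e = e"
begin

lemma local_monoid:
  "Group.monoid \<lparr>carrier = {x \<in> carrier G. e \<otimes> x = x \<and> x \<otimes> e = x}, mult = (\<otimes>), one = e\<rparr>"
proof (rule monoidI, unfold monoid.simps partial_object.simps)
  fix x y assume "x \<in> {x \<in> carrier G. e \<otimes> x = x \<and> x \<otimes> e = x}" "y \<in> {x \<in> carrier G. e \<otimes> x = x \<and> x \<otimes> e = x}"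
  then have "x \<in> carrier G" "y \<in> carrier G" "e \<otimes> x = x" "y \<otimes> e = y" by auto
  then show "x \<otimes> y \<in> {x \<in> carrier G. e \<otimes> x = x \<and> x \<otimes> e = x}"
    using e m_assoc[of e x y] m_assoc[of x y e] by simp
qed (use e m_assoc in auto)

lemma group_max_subgroup: "Group.group (max_subgroup e)"
  unfolding max_subgroup_def using local_monoid by (rule monoid.units_group)

lemma max_subgroup_simps:
  "mult (max_subgroup e) = (\<otimes>)" "\<one>\<^bsub>max_subgroup e\<^esub> = e"
  by (simp_all add: max_subgroup_def units_of_def)

text \<open>Being R- and L-related to e makes e a two-sided identity of x. If x v = e and v' x = e,
  then y = e v e satisfies x y = e, and y x = v' x y x = v' x = e, so it is the inverse.\<close>

lemma max_subgroup_carrier: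
  "x \<in> carrier (max_subgroup e) \<longleftrightarrow> x \<in> carrier G \<and> Rrel G e x \<and> Lrel G e x"
proof
  assume "x \<in> carrier (max_subgroup e)"
  then obtain y where x: "x \<in> carrier G" "e \<otimes> x = x" "x \<otimes> e = x" and "y \<in> carrier G"
    "y \<otimes> x = e" "x \<otimes> y = e"
    by (auto simp: max_subgroup_def units_of_def Units_def)
  then show "x \<in> carrier G \<and> Rrel G e x \<and> Lrel G e x"
    unfolding Rrel_def Lrel_def by metis
next
  assume x: "x \<in> carrier G \<and> Rrel G e x \<and> Lrel G e x"
  then obtain u v u' v' where uv: "u \<in> carrier G" "x = e \<otimes> u" "v \<in> carrier G" "e = x \<otimes> v"
    "u' \<in> carrier G" "x = u' \<otimes> e" "v' \<in> carrier G" "e = v' \<otimes> x"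
    unfolding Rrel_def Lrel_def by blast
  have ex: "e \<otimes> x = x" using uv(1,2) e by (metis m_assoc)
  have xe: "x \<otimes> e = x" using uv(5,6) e by (metis m_assoc)
  define y where "y = e \<otimes> v \<otimes> e"
  have y: "y \<in> carrier G" "e \<otimes> y = y" "y \<otimes> e = y"
    using e uv(3) by (simp_all add: y_def m_assoc) (simp add: m_assoc[symmetric])
  have "x \<otimes> y = x \<otimes> e \<otimes> v \<otimes> e" using x e uv(3) by (simp add: y_def m_assoc)
  then have xy: "x \<otimes> y = e" using xe uv(4) e(2) by simp
  have "y \<otimes> x = v' \<otimes> x \<otimes> (y \<otimes> x)" using y x e uv(8) by (metis m_assoc)
  also have "\<dots> = v' \<otimes> (x \<otimes> y) \<otimes> x" using y x uv(7) by (simp add: m_assoc)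
  also have "\<dots> = e" using xy ex e x uv(7) uv(8) by (simp add: m_assoc)
  finally have yx: "y \<otimes> x = e" .
  show "x \<in> carrier (max_subgroup e)"
    using x ex xe xy yx y by (auto simp: max_subgroup_def units_of_def Units_def)
qed

lemma max_subgroup_e:
  assumes "x \<in> carrier (max_subgroup e)"
  shows "x \<in> carrier G" "e \<otimes> x = x" "x \<otimes> e = x"
  using assms by (auto simp: max_subgroup_def units_of_def Units_def)

text \<open>Schreier's argument, with representatives of the \<open>\<L>\<close>-classes meeting the
  \<open>\<R>\<close>-class of \<open>e\<close> in the role of coset representatives.\<close>

lemma max_subgroup_finitely_generated:
  assumes A: "finite A" "A \<subseteq> carrier G"
      "\<And>P w. w \<in> carrier G \<Longrightarrow> P \<one> \<Longrightarrow> (\<And>x a. x \<in> carrier G \<Longrightarrow> P x \<Longrightarrow> a \<in> A \<Longrightarrow> P (x \<otimes> a)) \<Longrightarrow> P w"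
    and F: "finite F" "F \<subseteq> carrier G"
      "\<And>x. x \<in> carrier G \<Longrightarrow> Rrel G e x \<Longrightarrow> \<exists>r\<in>F. Rrel G e r \<and> Lrel G x r"
  obtains Y where "finite Y" "Y \<subseteq> carrier (max_subgroup e)"
    "generate (max_subgroup e) Y = carrier (max_subgroup e)"
proof -
  let ?H = "max_subgroup e"
  interpret H: Group.group ?H by (rule group_max_subgroup)
  define F' where "F' = {r \<in> F. Rrel G e r}"
  have F': "finite F'" "F' \<subseteq> carrier G" using F by (auto simp: F'_def)
  have eF: "e \<otimes> r = r" if r: "r \<in> F'" for r
  proof -
    obtain u where "u \<in> carrier G" "r = e \<otimes> u" using r by (auto simp: F'_def Rrel_def)
    then show ?thesis using e by (metis m_assoc)
  qed
  have "\<forall>r\<in>F'. \<exists>s. s \<in> carrier G \<and> r \<otimes> s = e" by (auto simp: F'_def Rrel_def)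
  then obtain \<rho> where \<rho>: "\<And>r. r \<in> F' \<Longrightarrow> \<rho> r \<in> carrier G" "\<And>r. r \<in> F' \<Longrightarrow> r \<otimes> \<rho> r = e"
    by metis
  \<comment> \<open>The products are Schreier generators: a step by the letter b from r, then the
    way back to e from the representative t. The representatives inside the group itself handle the
    two ends of the rewriting.\<close>
  define Y where "Y = (F' \<union> (\<lambda>(r, b, t). r \<otimes> b \<otimes> \<rho> t) ` (F' \<times> A \<times> F')) \<inter> carrier ?H"
  have Y: "finite Y" "Y \<subseteq> carrier ?H" using F' A by (auto simp: Y_def)
  have gen_sub: "generate ?H Y \<subseteq> carrier ?H" using H.generate_incl[OF Y(2)] .
  have gen_group: "\<And>g h. g \<in> generate ?H Y \<Longrightarrow> h \<in> generate ?H Y \<Longrightarrow> g \<otimes> h \<in> generate ?H Y"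
    using generate.eng[of _ ?H Y] by (simp add: max_subgroup_simps)
  have inv_mult: "inv\<^bsub>?H\<^esub> g \<otimes> g = e" "g \<otimes> inv\<^bsub>?H\<^esub> g = e" if "g \<in> carrier ?H" for g
    using H.l_inv[OF that] H.r_inv[OF that] by (simp_all add: max_subgroup_simps)
  have main: "Rrel G e (e \<otimes> w) \<longrightarrow> (\<exists>\<gamma>\<in>generate ?H Y. \<exists>r\<in>F'. e \<otimes> w = \<gamma> \<otimes> r)"
    if "w \<in> carrier G" for w
    using that
  proof (rule A(3))
    show "Rrel G e (e \<otimes> \<one>) \<longrightarrow> (\<exists>\<gamma>\<in>generate ?H Y. \<exists>r\<in>F'. e \<otimes> \<one> = \<gamma> \<otimes> r)"
    proof
      obtain r where r: "r \<in> F" "Rrel G e r" "Lrel G e r" using F(3)[OF e(1) Rrel_refl[OF e(1)]] by blast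
      then have rH: "r \<in> carrier ?H" using max_subgroup_carrier F(2) by blast
      then have rY: "r \<in> F'" "r \<in> Y" using r by (auto simp: F'_def Y_def)
      have "inv\<^bsub>?H\<^esub> r \<in> generate ?H Y" using rY(2) by (rule generate.inv)
      then show "\<exists>\<gamma>\<in>generate ?H Y. \<exists>r\<in>F'. e \<otimes> \<one> = \<gamma> \<otimes> r"
        using inv_mult(1)[OF rH] rY(1) e by (metis r_one)
    qed
  next
    fix w b assume w: "w \<in> carrier G" "b \<in> A"
      and IH: "Rrel G e (e \<otimes> w) \<longrightarrow> (\<exists>\<gamma>\<in>generate ?H Y. \<exists>r\<in>F'. e \<otimes> w = \<gamma> \<otimes> r)"
    have bG: "b \<in> carrier G" using w A by blast
    show "Rrel G e (e \<otimes> (w \<otimes> b)) \<longrightarrow> (\<exists>\<gamma>\<in>generate ?H Y. \<exists>r\<in>F'. e \<otimes> (w \<otimes> b) = \<gamma> \<otimes> r)"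
    proof
      assume R: "Rrel G e (e \<otimes> (w \<otimes> b))"
      then obtain v where v: "v \<in> carrier G" "e = e \<otimes> (w \<otimes> b) \<otimes> v" by (auto simp: Rrel_def)
      \<comment> \<open>The R-class of e is closed under prefixes: what leads from e w b back to e
        also leads back from e w.\<close>
      then have "e = e \<otimes> w \<otimes> (b \<otimes> v)" using e w bG by (simp add: m_assoc)
      then have "Rrel G e (e \<otimes> w)" unfolding Rrel_def using w bG v by blast
      then obtain \<gamma> r where \<gamma>: "\<gamma> \<in> generate ?H Y" "r \<in> F'" "e \<otimes> w = \<gamma> \<otimes> r" using IH by blast
      have \<gamma>H: "\<gamma> \<in> carrier ?H" using \<gamma>(1) gen_sub by blast
      define \<gamma>' where "\<gamma>' = inv\<^bsub>?H\<^esub> \<gamma>"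
      have \<gamma>': "\<gamma>' \<in> carrier ?H" "\<gamma>' \<otimes> \<gamma> = e" using \<gamma>H inv_mult by (auto simp: \<gamma>'_def)
      have rG: "r \<in> carrier G" using \<gamma>(2) F'(2) by blast
      note cl = max_subgroup_e(1)[OF \<gamma>H] max_subgroup_e(1)[OF \<gamma>'(1)] rG bG w(1) e(1)
      have ewb: "e \<otimes> (w \<otimes> b) = \<gamma> \<otimes> (r \<otimes> b)"
        using \<gamma>(3) cl by (metis m_assoc)
      have "\<gamma>' \<otimes> (\<gamma> \<otimes> (r \<otimes> b)) = e \<otimes> r \<otimes> b" using \<gamma>'(2) cl by (metis m_assoc m_closed)
      then have "Rrel G (\<gamma>' \<otimes> e) (r \<otimes> b)"
        using Rrel_left_cong[OF _ _ cl(2) R] cl eF[OF \<gamma>(2)] unfolding ewb by simp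
      moreover have "Rrel G e (\<gamma>' \<otimes> e)"
        using max_subgroup_carrier \<gamma>'(1) max_subgroup_e[OF \<gamma>'(1)] by simp
      ultimately have Rrb: "Rrel G e (r \<otimes> b)" using Rrel_trans cl by (meson m_closed)
      then obtain t where t: "t \<in> F" "Rrel G e t" "Lrel G (r \<otimes> b) t"
        using F(3)[of "r \<otimes> b"] cl by auto
      then have tF: "t \<in> F'" "t \<in> carrier G" using F' by (auto simp: F'_def)
      \<comment> \<open>Since t is L-related to r b and \<rho> t leads from t to e, right
        multiplication by t undoes \<rho> t: \<delta> t = r b. So \<delta> is the factor in
        \<open>H\<close> picked up by the letter b.\<close>
      define \<delta> where "\<delta> = r \<otimes> b \<otimes> \<rho> t"
      have \<delta>G: "\<delta> \<in> carrier G" using cl \<rho>(1)[OF tF(1)] by (simp add: \<delta>_def)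
      obtain y where y: "y \<in> carrier G" "r \<otimes> b = y \<otimes> t" using t(3) by (auto simp: Lrel_def)
      have "\<delta> \<otimes> t = y \<otimes> (t \<otimes> \<rho> t) \<otimes> t"
        using y tF(2) \<rho>(1)[OF tF(1)] by (simp add: \<delta>_def m_assoc)
      then have \<delta>t: "\<delta> \<otimes> t = r \<otimes> b"
        using \<rho>(2)[OF tF(1)] eF[OF tF(1)] y tF(2) e(1) by (simp add: m_assoc)
      obtain v' where v': "v' \<in> carrier G" "e = r \<otimes> b \<otimes> v'" using Rrb by (auto simp: Rrel_def)
      have "e = \<delta> \<otimes> (t \<otimes> v')" using v' \<delta>t \<delta>G tF(2) by (simp add: m_assoc[symmetric])
      moreover have "\<delta> = e \<otimes> \<delta>"
      proof -
        have "e \<otimes> \<delta> = e \<otimes> r \<otimes> b \<otimes> \<rho> t" using cl \<rho>(1)[OF tF(1)] by (simp add: \<delta>_def m_assoc)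
        then show ?thesis using eF[OF \<gamma>(2)] by (simp add: \<delta>_def)
      qed
      ultimately have "Rrel G e \<delta>" unfolding Rrel_def using tF(2) v'(1) \<delta>G by blast
      moreover have "Lrel G e \<delta>"
        using Lrel_right_cong[OF _ tF(2) \<rho>(1)[OF tF(1)] t(3)] cl \<rho>(2)[OF tF(1)] Lrel_sym
        by (simp add: \<delta>_def)
      ultimately have \<delta>H: "\<delta> \<in> carrier ?H" using max_subgroup_carrier \<delta>G by blast
      then have "\<delta> \<in> Y" unfolding Y_def \<delta>_def using \<gamma>(2) w(2) tF(1) by force
      then have "\<gamma> \<otimes> \<delta> \<in> generate ?H Y" using gen_group[OF \<gamma>(1) generate.incl] by simp
      moreover have "e \<otimes> (w \<otimes> b) = \<gamma> \<otimes> \<delta> \<otimes> t" unfolding ewb \<delta>t[symmetric] using cl \<delta>G tF(2) by (simp add: m_assoc)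
      ultimately show "\<exists>\<gamma>\<in>generate ?H Y. \<exists>r\<in>F'. e \<otimes> (w \<otimes> b) = \<gamma> \<otimes> r" using tF(1) by blast
    qed
  qed
  have "g \<in> generate ?H Y" if g: "g \<in> carrier ?H" for g
  proof -
    have "Rrel G e (e \<otimes> g)" using g max_subgroup_carrier max_subgroup_e[OF g] by simp
    then obtain \<gamma> r where \<gamma>: "\<gamma> \<in> generate ?H Y" "r \<in> F'" "g = \<gamma> \<otimes> r"
      using main[of g] max_subgroup_e[OF g] by auto
    have \<gamma>H: "\<gamma> \<in> carrier ?H" using \<gamma>(1) gen_sub by blast
    have i\<gamma>: "inv\<^bsub>?H\<^esub> \<gamma> \<in> carrier ?H" using \<gamma>H by simp
    have rG: "r \<in> carrier G" using \<gamma>(2) F' by blast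
    have "inv\<^bsub>?H\<^esub> \<gamma> \<otimes> g = e \<otimes> r"
      unfolding \<gamma>(3) using inv_mult(1)[OF \<gamma>H] max_subgroup_e(1)[OF \<gamma>H] max_subgroup_e(1)[OF i\<gamma>] rG by (metis m_assoc)
    then have "r = inv\<^bsub>?H\<^esub> \<gamma> \<otimes>\<^bsub>?H\<^esub> g" using eF[OF \<gamma>(2)] by (simp add: max_subgroup_simps)
    then have "r \<in> carrier ?H" using i\<gamma> g by simp
    then have "r \<in> generate ?H Y" using \<gamma>(2) by (auto simp: Y_def intro: generate.incl)
    then show ?thesis using gen_group[OF \<gamma>(1)] \<gamma>(3) by simp
  qed
  then have "generate ?H Y = carrier ?H" using gen_sub by blast
  then show ?thesis using Y that by blast
qed

end

end

section \<open>Semigroups with an ideal of elements of finite order\<close>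

text \<open>What condition (2) amounts to for a finitely generated semigroup: local finiteness of
  the Rees quotient leaves finitely many elements outside, and periodic group elements have finite
  order.\<close>

definition good_ideal :: "'a set \<Rightarrow> 'a semigrp \<Rightarrow> bool" where
  "good_ideal J S \<longleftrightarrow> is_ideal J S \<and> finite (carrier S - J) \<and>
    (\<forall>x\<in>J. \<exists>n\<ge>2. Some x [^]\<^bsub>adj S\<^esub> (n::nat) = Some x)"

lemma good_ideal_adj:
  assumes "is_semigroup S" "good_ideal J S"
  shows "Some ` J \<subseteq> carrier (adj S)"
    and "x \<in> carrier (adj S) \<Longrightarrow> y \<in> Some ` J \<Longrightarrow> x \<otimes>\<^bsub>adj S\<^esub> y \<in> Some ` J"
    and "x \<in> carrier (adj S) \<Longrightarrow> y \<in> Some ` J \<Longrightarrow> y \<otimes>\<^bsub>adj S\<^esub> x \<in> Some ` J"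
    and "y \<in> Some ` J \<Longrightarrow> \<exists>n\<ge>2. y [^]\<^bsub>adj S\<^esub> (n::nat) = y"
  using assms unfolding good_ideal_def is_ideal_def by (auto simp: carrier_adj)

lemma good_ideal_opp:
  assumes "is_semigroup S" "good_ideal J S"
  shows "good_ideal J (opp S)"
proof -
  have "J \<subseteq> carrier S" using assms(2) by (simp add: good_ideal_def is_ideal_def)
  then show ?thesis
    using assms(2) unfolding good_ideal_def is_ideal_def
    by (auto simp: adj_pow_opp[OF assms(1)] subset_iff)
qed

lemma good_ideal_Rrel_mult:
  assumes E: "semigroup_identities E" "posN \<notin> variety E" "S \<in> variety E" and J: "good_ideal J S"
    and x: "x \<in> Some ` J" "u \<in> carrier (adj S)" "a \<in> carrier (adj S)" "v \<in> carrier (adj S)"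
      "x = u \<otimes>\<^bsub>adj S\<^esub> a \<otimes>\<^bsub>adj S\<^esub> v"
  shows "Rrel (adj S) x (x \<otimes>\<^bsub>adj S\<^esub> a)"
proof -
  have S: "is_semigroup S" using E(3) by (rule variety_semigroup)
  interpret M: Group.monoid "adj S" using S by (rule monoid_adj)
  obtain k :: nat where k: "k \<ge> 1" "\<And>x. x \<in> carrier (adj S) \<Longrightarrow>
    x [^]\<^bsub>adj S\<^esub> k \<otimes>\<^bsub>adj S\<^esub> x [^]\<^bsub>adj S\<^esub> k = x [^]\<^bsub>adj S\<^esub> k"
    by (rule idempotent_exponent[OF E]) (rule that)
  note J' = good_ideal_adj[OF S J]
  show ?thesis by (rule M.Rrel_mult_divisor[OF J'(1,2,4) k x])
qed

text \<open>The representatives need not lie in \<open>X\<close>, which makes the notion pass to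
  subsets.\<close>

definition R_small :: "'a semigrp \<Rightarrow> 'a option set \<Rightarrow> bool" where
  "R_small S X \<longleftrightarrow> (\<exists>F. finite F \<and> F \<subseteq> carrier (adj S) \<and> (\<forall>x\<in>X. \<exists>y\<in>F. Rrel (adj S) x y))"

lemma R_small_finite:
  assumes "is_semigroup S" "finite X" "X \<subseteq> carrier (adj S)"
  shows "R_small S X"
  unfolding R_small_def using assms monoid.Rrel_refl[OF monoid_adj] by blast

lemma R_small_UN:
  assumes "finite I" "\<And>i. i \<in> I \<Longrightarrow> R_small S (X i)"
  shows "R_small S (\<Union>i\<in>I. X i)"
proof -
  have "\<forall>i\<in>I. \<exists>F. finite F \<and> F \<subseteq> carrier (adj S) \<and> (\<forall>x\<in>X i. \<exists>y\<in>F. Rrel (adj S) x y)"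
    using assms(2) by (simp add: R_small_def)
  from bchoice[OF this] obtain F where F: "\<forall>i\<in>I. finite (F i) \<and> F i \<subseteq> carrier (adj S) \<and>
      (\<forall>x\<in>X i. \<exists>y\<in>F i. Rrel (adj S) x y)" by blast
  then have "\<forall>x\<in>(\<Union>i\<in>I. X i). \<exists>y\<in>(\<Union>i\<in>I. F i). Rrel (adj S) x y" by blast
  then show ?thesis unfolding R_small_def using F assms(1) by (intro exI[of _ "\<Union>i\<in>I. F i"]) auto
qed

lemma R_small_Un:
  assumes "R_small S X" "R_small S Y"
  shows "R_small S (X \<union> Y)"
proof -
  have "R_small S (\<Union>b. if b then X else Y)" by (rule R_small_UN) (use assms in auto)
  then show ?thesis by (simp add: UNIV_bool Un_commute)
qed

lemma R_small_mono: "R_small S X \<Longrightarrow> Y \<subseteq> X \<Longrightarrow> R_small S Y"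
  unfolding R_small_def by blast

subsection \<open>Novikov--Adian groups from infinite orbits\<close>

text \<open>A subgroup \<open>H\<close> inside the ideal acts on the left on \<open>\<R>\<close>-classes. Let \<open>K\<close> be the
  kernel of its action on the orbit of \<open>e a\<close>. Modulo \<open>\<R>\<close>, right multiples of elements \<open>h a\<close> by
  products of elements \<open>h\<close>, \<open>h a\<close> are absorbed, exactly as barred elements absorb in
  \<open>L(H/K)\<close>; so identities pass from \<open>S\<close> to \<open>L(H/K)\<close>.\<close>

lemma L_quotient_in_variety:
  fixes S :: "'x semigrp" and H :: "'x option monoid" and M (structure)
  defines M_def: "M \<equiv> adj S"
  assumes E: "semigroup_identities E" "posN \<notin> variety E" "S \<in> variety E" and J: "good_ideal J S"
    and H: "Group.group H" "mult H = mult M" "carrier H \<subseteq> Some ` J"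
    and Y: "finite Y" "Y \<subseteq> carrier H" "generate H Y = carrier H"
    and a: "a \<in> carrier M"
    and large: "\<not> R_small S ((\<lambda>g. g \<otimes> a) ` carrier H)"
  shows "\<exists>G :: 'x option set monoid. novikov_adian G \<and> L_semigrp G \<in> variety E"
proof -
  have S: "is_semigroup S" using E(3) by (rule variety_semigroup)
  interpret M: Group.monoid M unfolding M_def using S by (rule monoid_adj)
  interpret H: Group.group H by (rule H(1))
  note J' = good_ideal_adj[OF S J, folded M_def]
  have HM: "g \<in> carrier M" if "g \<in> carrier H" for g
    using that H(3) J'(1) by blast
  have mult: "g \<otimes>\<^bsub>H\<^esub> h = g \<otimes> h" for g h by (simp add: H(2) M_def)
  have Hcl: "g \<otimes> h \<in> carrier H" if "g \<in> carrier H" "h \<in> carrier H" for g h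
    using H.m_closed[OF that] by (simp add: mult)
  have inv: "g \<otimes> inv\<^bsub>H\<^esub> g = \<one>\<^bsub>H\<^esub>" "inv\<^bsub>H\<^esub> g \<otimes> g = \<one>\<^bsub>H\<^esub>"
    "\<one>\<^bsub>H\<^esub> \<otimes> g = g" "g \<otimes> \<one>\<^bsub>H\<^esub> = g" if "g \<in> carrier H" for g
    using that H.r_inv[OF that] H.l_inv[OF that] H.l_one[OF that] H.r_one[OF that] by (simp_all add: mult)
  have inv_cancel: "inv\<^bsub>H\<^esub> g \<otimes> (g \<otimes> h) = h" "g \<otimes> (inv\<^bsub>H\<^esub> g \<otimes> h) = h"
    if "g \<in> carrier H" "h \<in> carrier H" for g h
    using that inv M.m_assoc HM H.inv_closed by metis+
  have ha: "h \<otimes> a \<in> carrier M" if "h \<in> carrier H" for h using HM[OF that] a by simp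
  have inf: "\<exists>g\<in>carrier H. \<forall>h\<in>F. \<not> Rrel M (g \<otimes> a) (h \<otimes> a)" if "finite F" "F \<subseteq> carrier H" for F
  proof (rule ccontr)
    assume "\<not> ?thesis"
    then have "R_small S ((\<lambda>g. g \<otimes> a) ` carrier H)"
      unfolding R_small_def M_def[symmetric] using that ha
      by (intro exI[of _ "(\<lambda>h. h \<otimes> a) ` F"]) auto
    with large show False ..
  qed
  have act: "Rrel M (c \<otimes> g \<otimes> a) (c \<otimes> h \<otimes> a)"
    if "Rrel M (g \<otimes> a) (h \<otimes> a)" "c \<in> carrier H" "g \<in> carrier H" "h \<in> carrier H" for c g h
    using M.Rrel_left_cong[OF ha[OF that(3)] ha[OF that(4)] HM[OF that(2)] that(1)]
      HM[OF that(2)] HM[OF that(3)] HM[OF that(4)] a by (simp add: M.m_assoc)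
  \<comment> \<open>Fixing the R-class of every d \<otimes> a, and not of a single point, makes this
    the kernel of the action rather than a stabilizer, hence normal.\<close>
  define K where "K = {g \<in> carrier H. \<forall>d\<in>carrier H. Rrel M (g \<otimes> d \<otimes> a) (d \<otimes> a)}"
  have subgroup: "subgroup K H"
  proof (rule H.subgroupI)
    show "K \<subseteq> carrier H" by (auto simp: K_def)
    have "\<one>\<^bsub>H\<^esub> \<in> K" using M.Rrel_refl ha by (auto simp: K_def inv)
    then show "K \<noteq> {}" by blast
  next
    fix g assume g: "g \<in> K"
    then have gH: "g \<in> carrier H" by (simp add: K_def)
    have "Rrel M (inv\<^bsub>H\<^esub> g \<otimes> d \<otimes> a) (d \<otimes> a)" if d: "d \<in> carrier H" for d
    proof -
      have "Rrel M (g \<otimes> (inv\<^bsub>H\<^esub> g \<otimes> d) \<otimes> a) (inv\<^bsub>H\<^esub> g \<otimes> d \<otimes> a)"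
        using g Hcl[OF H.inv_closed[OF gH] d] by (simp add: K_def)
      then show ?thesis unfolding inv_cancel(2)[OF gH d] by (rule M.Rrel_sym)
    qed
    then show "inv\<^bsub>H\<^esub> g \<in> K" using gH by (simp add: K_def)
  next
    fix g h assume gh: "g \<in> K" "h \<in> K"
    then have gH: "g \<in> carrier H" "h \<in> carrier H" by (auto simp: K_def)
    have "Rrel M (g \<otimes> h \<otimes> d \<otimes> a) (d \<otimes> a)" if d: "d \<in> carrier H" for d
    proof -
      have hd: "h \<otimes> d \<in> carrier H" using Hcl gH d by blast
      have "Rrel M (g \<otimes> (h \<otimes> d) \<otimes> a) (h \<otimes> d \<otimes> a)"
        using gh(1) hd by (simp add: K_def)
      moreover have "Rrel M (h \<otimes> d \<otimes> a) (d \<otimes> a)" using gh(2) d by (simp add: K_def)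
      ultimately have "Rrel M (g \<otimes> (h \<otimes> d) \<otimes> a) (d \<otimes> a)"
        using M.Rrel_trans ha[OF Hcl[OF gH(1) hd]] ha[OF d] by blast
      then show ?thesis using HM[OF gH(1)] HM[OF gH(2)] HM[OF d] by (simp add: M.m_assoc)
    qed
    then show "g \<otimes>\<^bsub>H\<^esub> h \<in> K" using Hcl[OF gH] by (simp add: K_def mult)
  qed
  have normal: "K \<lhd> H"
    unfolding H.normal_inv_iff
  proof (intro conjI ballI subgroup)
    fix x g assume x: "x \<in> carrier H" and g: "g \<in> K"
    then have gH: "g \<in> carrier H" by (simp add: K_def)
    have "Rrel M (x \<otimes> g \<otimes> inv\<^bsub>H\<^esub> x \<otimes> d \<otimes> a) (d \<otimes> a)" if d: "d \<in> carrier H" for d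
    proof -
      define d' where "d' = inv\<^bsub>H\<^esub> x \<otimes> d"
      have d': "d' \<in> carrier H" "x \<otimes> d' = d"
        using Hcl x d inv_cancel(2)[OF x d] by (auto simp: d'_def)
      have "Rrel M (g \<otimes> d' \<otimes> a) (d' \<otimes> a)" using g d' by (simp add: K_def)
      then have "Rrel M (x \<otimes> (g \<otimes> d') \<otimes> a) (x \<otimes> d' \<otimes> a)"
        using act x d' Hcl[OF gH d'(1)] by blast
      then show ?thesis
        unfolding d'(2) using HM[OF x] HM[OF gH] HM[OF d] HM[OF H.inv_closed[OF x]]
        by (simp add: M.m_assoc d'_def)
    qed
    then show "x \<otimes>\<^bsub>H\<^esub> g \<otimes>\<^bsub>H\<^esub> inv\<^bsub>H\<^esub> x \<in> K"
      using Hcl x gH by (simp add: K_def mult)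
  qed
  interpret N: normal K H by (rule normal)
  define G where "G = H Mod K"
  define cl where "cl g = K #>\<^bsub>H\<^esub> g" for g
  interpret G: Group.group G unfolding G_def by (rule N.factorgroup_is_group)
  have cl_hom: "cl \<in> hom H G" unfolding cl_def G_def by (rule N.r_coset_hom_Mod)
  interpret cl: group_hom H G cl by unfold_locales (rule cl_hom)
  have carrier_G: "carrier G = cl ` carrier H" by (simp add: G_def cl_def carrier_FactGroup)
  have cl_mult: "cl g \<otimes>\<^bsub>G\<^esub> cl h = cl (g \<otimes> h)" if "g \<in> carrier H" "h \<in> carrier H" for g h
    using cl.hom_mult[OF that] by (simp add: mult)
  have cl_eqD: "Rrel M (g \<otimes> d \<otimes> a) (h \<otimes> d \<otimes> a)"
    if "cl g = cl h" "g \<in> carrier H" "h \<in> carrier H" "d \<in> carrier H" for g h d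
  proof -
    have "g \<in> K #>\<^bsub>H\<^esub> h" using H.rcos_self[OF that(2) subgroup] that(1) by (simp add: cl_def)
    then obtain k where k: "k \<in> K" "g = k \<otimes> h" by (auto simp: r_coset_def mult)
    have kH: "k \<in> carrier H" "\<forall>d\<in>carrier H. Rrel M (k \<otimes> d \<otimes> a) (d \<otimes> a)"
      using k(1) unfolding K_def by blast+
    have "k \<otimes> (h \<otimes> d) = g \<otimes> d"
      unfolding k(2) using M.m_assoc[OF HM[OF kH(1)] HM[OF that(3)] HM[OF that(4)]] by (rule sym)
    then show ?thesis using bspec[OF kH(2) Hcl[OF that(3,4)]] by simp
  qed
  have cl_eqI: "cl g = cl h"
    if "\<And>d. d \<in> carrier H \<Longrightarrow> Rrel M (g \<otimes> d \<otimes> a) (h \<otimes> d \<otimes> a)"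
      "g \<in> carrier H" "h \<in> carrier H" for g h
  proof -
    define k where "k = g \<otimes> inv\<^bsub>H\<^esub> h"
    have kH: "k \<in> carrier H" using that Hcl by (simp add: k_def)
    have "Rrel M (k \<otimes> d \<otimes> a) (d \<otimes> a)" if d: "d \<in> carrier H" for d
    proof -
      have "inv\<^bsub>H\<^esub> h \<otimes> d \<in> carrier H" using Hcl d \<open>h \<in> carrier H\<close> by simp
      from \<open>\<And>d. d \<in> carrier H \<Longrightarrow> Rrel M (g \<otimes> d \<otimes> a) (h \<otimes> d \<otimes> a)\<close>[OF this]
      have "Rrel M (g \<otimes> (inv\<^bsub>H\<^esub> h \<otimes> d) \<otimes> a) (d \<otimes> a)"
        unfolding inv_cancel(2)[OF \<open>h \<in> carrier H\<close> d] .
      moreover have "g \<otimes> (inv\<^bsub>H\<^esub> h \<otimes> d) = k \<otimes> d"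
        unfolding k_def using HM[OF \<open>g \<in> carrier H\<close>] HM[OF H.inv_closed[OF \<open>h \<in> carrier H\<close>]] HM[OF d]
        by (simp add: M.m_assoc)
      ultimately show ?thesis by simp
    qed
    then have kK: "k \<in> K" unfolding K_def using kH by blast
    have "k \<otimes> h = g \<otimes> (inv\<^bsub>H\<^esub> h \<otimes> h)"
      unfolding k_def by (rule M.m_assoc[OF HM[OF that(2)] HM[OF H.inv_closed[OF that(3)]] HM[OF that(3)]])
    then have "g = k \<otimes>\<^bsub>H\<^esub> h" using inv(2)[OF that(3)] inv(4)[OF that(2)] by (simp add: mult)
    then have "g \<in> K #>\<^bsub>H\<^esub> h" using kK by (auto simp: r_coset_def)
    from H.repr_independence[OF this that(3) subgroup] show ?thesis by (simp add: cl_def)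
  qed
  have "infinite (carrier G)"
  proof
    assume "finite (carrier G)"
    then obtain F where F: "F \<subseteq> carrier H" "finite F" "carrier G = cl ` F"
      unfolding carrier_G by (metis finite_subset_image subset_refl)
    obtain g where g: "g \<in> carrier H" "\<forall>h\<in>F. \<not> Rrel M (g \<otimes> a) (h \<otimes> a)" using inf[OF F(2,1)] by blast
    then obtain h where h: "h \<in> F" "cl g = cl h" using F(3) unfolding carrier_G by blast
    then have "Rrel M (g \<otimes> a) (h \<otimes> a)"
      using cl_eqD[OF h(2) g(1) _ H.one_closed] F(1) g(1) inv(4) by auto
    with g(2) h(1) show False by blast
  qed
  moreover have "\<exists>n::nat. n > 0 \<and> (\<forall>x\<in>carrier G. x [^]\<^bsub>G\<^esub> n = \<one>\<^bsub>G\<^esub>)"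
  proof -
    obtain k :: nat where k: "k \<ge> 1" "\<And>x. x \<in> carrier M \<Longrightarrow>
      x [^] k \<otimes> x [^] k = x [^] k"
      by (rule idempotent_exponent[OF E, folded M_def]) (rule that)
    \<comment> \<open>Powers in \<open>H\<close> and in \<open>M\<close> agree from exponent 1 on
      only: the zeroth powers are the different identities.\<close>
    have pow: "g [^]\<^bsub>H\<^esub> j = g [^] j" if "g \<in> carrier H" "j \<ge> 1" for g and j :: nat
      using that(2)
    proof (induction j rule: dec_induct)
      case base
      then show ?case using that(1) HM by simp
    qed (simp add: mult)
    have "g [^]\<^bsub>H\<^esub> k = \<one>\<^bsub>H\<^esub>" if g: "g \<in> carrier H" for g
    proof -
      have "g [^]\<^bsub>H\<^esub> k \<otimes>\<^bsub>H\<^esub> g [^]\<^bsub>H\<^esub> k = g [^]\<^bsub>H\<^esub> k"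
        using k(2)[OF HM[OF g]] pow[OF g k(1)] by (simp add: mult)
      then show ?thesis using g by simp
    qed
    then have "x [^]\<^bsub>G\<^esub> k = \<one>\<^bsub>G\<^esub>" if "x \<in> carrier G" for x
      using that unfolding carrier_G by (metis cl.hom_nat_pow cl.hom_one image_iff)
    then show ?thesis using k(1) by (intro exI[of _ k]) auto
  qed
  moreover have "\<exists>A. finite A \<and> A \<subseteq> carrier G \<and> generate G A = carrier G"
    using cl.generate_img[OF Y(2)] Y unfolding carrier_G
    by (intro exI[of _ "cl ` Y"]) auto
  ultimately have "novikov_adian G" unfolding novikov_adian_def using G.is_group by blast
  moreover have "L_semigrp G \<in> variety E"
  proof -
    have semi: "is_semigroup (L_semigrp G)"
      unfolding is_semigroup_def L_semigrp_simps
      using G.one_closed by (auto simp: G.m_assoc elim!: PlusE)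
    \<comment> \<open>\<open>I d l s\<close> says that s represents l at the base point d: an
      element of the group part by any member of its coset, a barred one by anything in the R-class
      of g \<otimes> d \<otimes> a.\<close>
    define I where "I d l s \<longleftrightarrow> (\<exists>g\<in>carrier H. l = Inl (cl g) \<and> s = g) \<or>
      (\<exists>g\<in>carrier H. l = Inr (cl g) \<and> s \<in> carrier M \<and> Rrel M s (g \<otimes> d \<otimes> a))" for d l s
    have I_carrier: "s \<in> carrier M" if "I d l s" for d l s using that HM by (auto simp: I_def)
    \<comment> \<open>Group inverses make t a divisor of s in both cases, so right multiplication by
      t keeps s in its R-class. This mirrors how barred elements of L(G) ignore their right
      factors.\<close>
    have absorb: "Rrel M s (s \<otimes> t)"
      if I: "I d l t" and g: "g \<in> carrier H" and d: "d \<in> carrier H" and s: "s \<in> carrier M"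
        and R: "Rrel M s (g \<otimes> d \<otimes> a)" for d l s t g
    proof -
      define g' where "g' = g \<otimes> d"
      have g': "g' \<in> carrier H" using Hcl g d by (simp add: g'_def)
      obtain v where v: "v \<in> carrier M" "s = g' \<otimes> a \<otimes> v" using R by (auto simp: Rrel_def g'_def)
      have sJ: "s \<in> Some ` J" using v J'(3) g' H(3) a by auto
      have "\<exists>u\<in>carrier M. \<exists>w\<in>carrier M. s = u \<otimes> t \<otimes> w"
        using I unfolding I_def
      proof (elim disjE bexE conjE)
        fix h assume h: "h \<in> carrier H" "t = h"
        define w where "w = inv\<^bsub>H\<^esub> h \<otimes> g'"
        have w: "w \<in> carrier H" "t \<otimes> w = g'"
          using Hcl h g' inv_cancel(2)[OF h(1) g'] by (auto simp: w_def)
        have "s = \<one> \<otimes> t \<otimes> (w \<otimes> a \<otimes> v)"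
          using v a HM[OF h(1)] HM[OF w(1)] h(2) w(2) by (simp add: M.m_assoc[symmetric])
        then show ?thesis using ha[OF w(1)] v(1) by blast
      next
        fix h assume h: "h \<in> carrier H" "t \<in> carrier M" "Rrel M t (h \<otimes> d \<otimes> a)"
        define h' where "h' = h \<otimes> d"
        have h': "h' \<in> carrier H" using Hcl h d by (simp add: h'_def)
        obtain w where w: "w \<in> carrier M" "h' \<otimes> a = t \<otimes> w" using h(3) by (auto simp: Rrel_def h'_def)
        define c where "c = g' \<otimes> inv\<^bsub>H\<^esub> h'"
        have c: "c \<in> carrier H" using Hcl g' h' by (simp add: c_def)
        have "c \<otimes> h' = g' \<otimes> (inv\<^bsub>H\<^esub> h' \<otimes> h')"
          unfolding c_def by (rule M.m_assoc[OF HM[OF g'] HM[OF H.inv_closed[OF h']] HM[OF h']])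
        then have ch: "c \<otimes> h' = g'" using inv(2)[OF h'] inv(4)[OF g'] by simp
        have "s = c \<otimes> h' \<otimes> a \<otimes> v" using v(2) ch by simp
        also have "\<dots> = c \<otimes> (h' \<otimes> a) \<otimes> v" using HM[OF c] HM[OF h'] a by (simp add: M.m_assoc)
        also have "\<dots> = c \<otimes> t \<otimes> (w \<otimes> v)" unfolding w(2) using HM[OF c] h(2) w(1) v(1) by (simp add: M.m_assoc)
        finally show ?thesis using HM[OF c] w(1) v(1) by blast
      qed
      then obtain u w where "u \<in> carrier M" "w \<in> carrier M" "s = u \<otimes> t \<otimes> w" by blast
      then show ?thesis
        using good_ideal_Rrel_mult[OF E J sJ] I_carrier[OF I] by (simp add: M_def)
    qed
    have I_mult: "I d (l \<cdot>\<^bsub>L_semigrp G\<^esub> l') (s \<otimes> s')" if I: "I d l s" "I d l' s'" and d: "d \<in> carrier H" for d l l' s s'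
      using I(1) unfolding I_def[of d l s]
    proof (elim disjE bexE conjE)
      fix g assume g: "g \<in> carrier H" "l = Inl (cl g)" "s = g"
      show ?thesis using I(2) unfolding I_def[of d l' s']
      proof (elim disjE bexE conjE)
        fix h assume "h \<in> carrier H" "l' = Inl (cl h)" "s' = h"
        then show ?thesis using g Hcl cl_mult by (auto simp: I_def L_semigrp_simps(1))
      next
        fix h assume h: "h \<in> carrier H" "l' = Inr (cl h)" "s' \<in> carrier M" "Rrel M s' (h \<otimes> d \<otimes> a)"
        have "Rrel M (g \<otimes> s') (g \<otimes> (h \<otimes> d \<otimes> a))"
          using M.Rrel_left_cong[OF h(3) _ HM[OF g(1)] h(4)] ha[OF Hcl[OF h(1) d]] by blast
        also have "g \<otimes> (h \<otimes> d \<otimes> a) = g \<otimes> h \<otimes> d \<otimes> a"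
          using HM[OF g(1)] HM[OF h(1)] HM[OF d] a by (simp add: M.m_assoc)
        finally show ?thesis
          using g h Hcl[OF g(1) h(1)] cl_mult[OF g(1) h(1)] HM[OF g(1)] by (auto simp: I_def L_semigrp_simps(1))
      qed
    next
      fix g assume g: "g \<in> carrier H" "l = Inr (cl g)" "s \<in> carrier M" "Rrel M s (g \<otimes> d \<otimes> a)"
      have "Rrel M (s \<otimes> s') s" using absorb[OF I(2) g(1) d g(3,4)] by (rule M.Rrel_sym)
      then have "Rrel M (s \<otimes> s') (g \<otimes> d \<otimes> a)"
        using M.Rrel_trans[OF _ ha[OF Hcl[OF g(1) d]] _ g(4)] g(3) I_carrier[OF I(2)] by simp
      moreover have "l \<cdot>\<^bsub>L_semigrp G\<^esub> l' = Inr (cl g)" unfolding L_semigrp_simps(1) g(2) by (cases l') auto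
      ultimately show ?thesis using g(1,3) I_carrier[OF I(2)] by (auto simp: I_def)
    qed
    have "satisfies (L_semigrp G) (u, v)" if uv: "(u, v) \<in> E" for u v
      unfolding satisfies_def fst_conv snd_conv
    proof (intro allI impI)
      fix \<phi> :: "nat \<Rightarrow> _" assume \<phi>: "\<forall>i. \<phi> i \<in> carrier (L_semigrp G)"
      have ne: "u \<noteq> []" "v \<noteq> []" using identity_nonempty[OF E(1) uv] by auto
      let ?u = "word_val (L_semigrp G) \<phi> u" and ?v = "word_val (L_semigrp G) \<phi> v"
      have key: "\<exists>s. I d ?u s \<and> I d ?v s" if d: "d \<in> carrier H" for d
      proof -
        have "\<exists>s. I d (\<phi> i) s \<and> s \<in> Some ` carrier S" for i
        proof -
          have "\<phi> i \<in> carrier G <+> carrier G" using \<phi> by (simp add: L_semigrp_simps(2))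
          then consider g where "g \<in> carrier H" "\<phi> i = Inl (cl g)" | g where "g \<in> carrier H" "\<phi> i = Inr (cl g)"
            unfolding carrier_G by blast
          then show ?thesis
          proof cases
            case 1
            then show ?thesis using H(3) J unfolding good_ideal_def is_ideal_def by (intro exI[of _ g]) (auto simp: I_def)
          next
            case 2
            have "g \<otimes> d \<otimes> a \<in> Some ` J" using J'(3)[OF a] Hcl[OF 2(1) d] H(3) by blast
            moreover have "J \<subseteq> carrier S" using J by (simp add: good_ideal_def is_ideal_def)
            moreover have "I d (\<phi> i) (g \<otimes> d \<otimes> a)"
              using 2 ha[OF Hcl[OF 2(1) d]] M.Rrel_refl by (auto simp: I_def)
            ultimately show ?thesis by blast
          qed
        qed
        then obtain \<psi> where \<psi>: "\<And>i. I d (\<phi> i) (\<psi> i)" "\<And>i. \<psi> i \<in> Some ` carrier S" by metis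
        have "I d (word_val (L_semigrp G) \<phi> w) (wval M \<psi> w)" if "w \<noteq> []" for w
          using that
        proof (induction w rule: induct_list012)
          case (2 x)
          then show ?case using \<psi>(1)[of x] I_carrier[OF \<psi>(1)] by simp
        next
          case (3 x y zs)
          then show ?case using I_mult[OF \<psi>(1) _ d] by simp
        qed simp
        then show ?thesis using ne identity_wval[OF E(1,3) uv, of \<psi>] \<psi>(2) unfolding M_def by metis
      qed
      \<comment> \<open>Were one side in the group part and the other barred, the identity of
        \<open>H\<close> would be R-related to h \<otimes> d \<otimes> a for every d. The whole
        orbit would then collapse to a single R-class.\<close>
      have mixed: False if 1: "\<exists>x. l = Inl x" and 2: "\<exists>x. l' = Inr x"
        and s: "\<And>d. d \<in> carrier H \<Longrightarrow> \<exists>s. I d l s \<and> I d l' s" for l l'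
      proof -
        obtain s0 where "I \<one>\<^bsub>H\<^esub> l' s0" using s[OF H.one_closed] by blast
        then obtain h where h: "h \<in> carrier H" "l' = Inr (cl h)" using 2 by (auto simp: I_def)
        have R: "Rrel M \<one>\<^bsub>H\<^esub> (h \<otimes> d \<otimes> a)" if d: "d \<in> carrier H" for d
        proof -
          obtain g where "I d l g" "I d l' g" using s[OF d] by blast
          then obtain h' where g: "g \<in> carrier H" and h': "h' \<in> carrier H" "cl h' = cl h" "Rrel M g (h' \<otimes> d \<otimes> a)"
            using 1 h(2) by (auto simp: I_def)
          have "Rrel M \<one>\<^bsub>H\<^esub> g"
            unfolding Rrel_def using inv[OF g] HM[OF g] HM[OF H.inv_closed[OF g]] by metis
          moreover have "Rrel M g (h \<otimes> d \<otimes> a)"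
            using M.Rrel_trans[OF HM[OF g] ha[OF Hcl[OF h(1) d]] h'(3) cl_eqD[OF h'(2,1) h(1) d]] .
          ultimately show ?thesis
            using M.Rrel_trans HM[OF H.one_closed] ha[OF Hcl[OF h(1) d]] by blast
        qed
        obtain g where g: "g \<in> carrier H" "\<not> Rrel M (g \<otimes> a) (\<one>\<^bsub>H\<^esub> \<otimes> a)"
          using inf[of "{\<one>\<^bsub>H\<^esub>}"] by auto
        have hg: "h \<otimes> g \<in> carrier H" "h \<otimes> \<one>\<^bsub>H\<^esub> \<in> carrier H" using Hcl h(1) g(1) by auto
        have "Rrel M (h \<otimes> g \<otimes> a) (h \<otimes> \<one>\<^bsub>H\<^esub> \<otimes> a)"
          using M.Rrel_trans[OF ha[OF hg(1)] ha[OF hg(2)] M.Rrel_sym[OF R[OF g(1)]] R[OF H.one_closed]] .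
        from act[OF this H.inv_closed[OF h(1)] hg]
        show False using inv_cancel(1)[OF h(1)] g by simp
      qed
      show "?u = ?v"
      proof (cases ?u)
        case (Inl x)
        show ?thesis
        proof (cases ?v)
          case (Inl y)
          then show ?thesis using key[OF H.one_closed] \<open>?u = Inl x\<close> by (auto simp: I_def)
        next
          case (Inr y)
          then show ?thesis using mixed[of ?u ?v] key \<open>?u = Inl x\<close> by auto
        qed
      next
        case (Inr x)
        show ?thesis
        proof (cases ?v)
          case (Inl y)
          then have "\<exists>s. I d ?v s \<and> I d ?u s" if "d \<in> carrier H" for d using key[OF that] by blast
          then show ?thesis using mixed[of ?v ?u] Inl \<open>?u = Inr x\<close> by auto
        next
          case (Inr y)
          obtain s0 where "I \<one>\<^bsub>H\<^esub> ?u s0" "I \<one>\<^bsub>H\<^esub> ?v s0" using key[OF H.one_closed] by blast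
          then obtain g h where gh: "g \<in> carrier H" "h \<in> carrier H" "?u = Inr (cl g)" "?v = Inr (cl h)"
            using \<open>?u = Inr x\<close> \<open>?v = Inr y\<close> by (auto simp: I_def)
          \<comment> \<open>A common representative at each base point d makes g d a and h d a
            R-related. Only all d together put g and h into the same coset of the kernel.\<close>
          have "cl g = cl h"
          proof (rule cl_eqI[OF _ gh(1,2)])
            fix d assume d: "d \<in> carrier H"
            obtain s where "I d ?u s" "I d ?v s" using key[OF d] by blast
            then obtain g' h' where g': "g' \<in> carrier H" "cl g' = cl g" "Rrel M s (g' \<otimes> d \<otimes> a)"
              and h': "h' \<in> carrier H" "cl h' = cl h" "Rrel M s (h' \<otimes> d \<otimes> a)" and s: "s \<in> carrier M"
              unfolding gh(3,4) by (auto simp: I_def)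
            have "Rrel M s (g \<otimes> d \<otimes> a)"
              using M.Rrel_trans[OF s ha[OF Hcl[OF gh(1) d]] g'(3) cl_eqD[OF g'(2,1) gh(1) d]] .
            moreover have "Rrel M s (h \<otimes> d \<otimes> a)"
              using M.Rrel_trans[OF s ha[OF Hcl[OF gh(2) d]] h'(3) cl_eqD[OF h'(2,1) gh(2) d]] .
            ultimately show "Rrel M (g \<otimes> d \<otimes> a) (h \<otimes> d \<otimes> a)"
              using M.Rrel_trans M.Rrel_sym ha[OF Hcl[OF gh(1) d]] ha[OF Hcl[OF gh(2) d]] by blast
          qed
          then show ?thesis using gh by simp
        qed
      qed
    qed
    then show ?thesis using semi by (auto simp: variety_def)
  qed
  ultimately show ?thesis by blast
qed

subsection \<open>Finiteness of the number of \<open>\<R>\<close>-classes\<close>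

lemma adj_sub_mult: "mult (adj (sub_semigrp S T)) = mult (adj S)"
proof (intro ext)
  fix u v show "u \<otimes>\<^bsub>adj (sub_semigrp S T)\<^esub> v = u \<otimes>\<^bsub>adj S\<^esub> v"
    by (cases u; cases v) auto
qed

text \<open>The H-classes are those of the subsemigroup \<open>T\<close> generated by
  \<open>B\<close>, while R-classes are counted in \<open>S\<close>. Each finite H-class of
  \<open>T\<close> contributes finitely many translates; an infinite one lies in a finitely
  generated subgroup, to which \<open>L_quotient_in_variety\<close> applies.\<close>

lemma translates_R_finite:
  fixes S :: "'x semigrp"
  assumes E: "semigroup_identities E" "posN \<notin> variety E" "S \<in> variety E" and J: "good_ideal J S"
    and no_L: "\<And>G :: 'x option set monoid. novikov_adian G \<Longrightarrow> L_semigrp G \<notin> variety E"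
    and B: "finite B" "B \<subseteq> carrier S" "B \<noteq> {}"
    and HT: "H_finite (sub_semigrp S (sgenerate S B))"
    and a: "a \<in> carrier (adj S)"
  shows "R_small S ((\<lambda>x. Some x \<otimes>\<^bsub>adj S\<^esub> a) ` sgenerate S B)"
proof -
  have S: "is_semigroup S" using E(3) by (rule variety_semigroup)
  interpret M: Group.monoid "adj S" using S by (rule monoid_adj)
  define T where "T = sub_semigrp S (sgenerate S B)"
  have TV: "T \<in> variety E" unfolding T_def by (rule variety_sub[OF E(1,3) B(2,3)])
  then have T: "is_semigroup T" by (rule variety_semigroup)
  interpret N: Group.monoid "adj T" using T by (rule monoid_adj)
  have carrier_T: "carrier T = sgenerate S B" by (simp add: T_def)
  have TS: "sgenerate S B \<subseteq> carrier S" using sgenerate_subset[OF S B(2)] .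
  have NM: "carrier (adj T) \<subseteq> carrier (adj S)" using TS by (auto simp: carrier_adj carrier_T)
  have mult: "mult (adj T) = mult (adj S)" unfolding T_def by (rule adj_sub_mult)
  have JS: "J \<subseteq> carrier S" using J by (simp add: good_ideal_def is_ideal_def)
  have small: "R_small S ((\<lambda>x. Some x \<otimes>\<^bsub>adj S\<^esub> a) ` c)" if c: "c \<in> carrier T // greenH T" for c
  proof -
    obtain x0 where x0: "x0 \<in> carrier T" "c = greenH T `` {x0}" using c by (rule quotientE)
    have cT: "c \<subseteq> carrier T" using in_quotient_imp_subset[OF green_equiv(3) c] .
    show ?thesis
    proof (cases "finite c")
      case True
      have "Some x \<otimes>\<^bsub>adj S\<^esub> a \<in> carrier (adj S)" if "x \<in> c" for x
        using that cT TS a by (auto simp: carrier_T)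
      then show ?thesis using True by (intro R_small_finite[OF S]) auto
    next
      case False
      have "finite (carrier S - J)" using J by (simp add: good_ideal_def)
      \<comment> \<open>The complement of \<open>J\<close> is finite, so an infinite H-class
        contains an element of finite order. Its idempotent power belongs to the same H-class and
        makes it a group.\<close>
      then have "\<not> c \<subseteq> carrier S - J" using False finite_subset by blast
      then obtain x where x: "x \<in> c" "x \<in> J" "x \<in> carrier T" using cT TS carrier_T by blast
      obtain n :: nat where n: "n \<ge> 2" "Some x [^]\<^bsub>adj S\<^esub> n = Some x" using J x(2) by (auto simp: good_ideal_def)
      have xN: "Some x \<in> carrier (adj T)" using x by simp
      have xn: "Some x [^]\<^bsub>adj T\<^esub> n = Some x" using n(2) by (simp add: T_def sub_adj_pow)
      define e where "e = Some x [^]\<^bsub>adj T\<^esub> (n - 1)"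
      have e: "e \<in> carrier (adj T)" "e \<otimes>\<^bsub>adj T\<^esub> e = e" "e \<otimes>\<^bsub>adj T\<^esub> Some x = Some x" "Some x \<otimes>\<^bsub>adj T\<^esub> e = Some x"
        using N.idempotent_of_power[OF xN xn n(1)] xN by (simp_all add: e_def)
      have "n - 1 = Suc (n - 2)" using n(1) by simp
      then have e2: "e = Some x \<otimes>\<^bsub>adj T\<^esub> Some x [^]\<^bsub>adj T\<^esub> (n - 2)" "e = Some x [^]\<^bsub>adj T\<^esub> (n - 2) \<otimes>\<^bsub>adj T\<^esub> Some x"
        unfolding e_def using N.nat_pow_Suc2[OF xN] by simp_all
      have powN: "Some x [^]\<^bsub>adj T\<^esub> (n - 2) \<in> carrier (adj T)" using xN by simp
      have Rex: "Rrel (adj T) e (Some x)" "Lrel (adj T) e (Some x)"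
        unfolding Rrel_def Lrel_def using e e2 powN xN by metis+
      have eJ: "e \<in> Some ` J"
      proof -
        note J' = good_ideal_adj[OF S J]
        have "Some x \<otimes>\<^bsub>adj S\<^esub> Some x [^]\<^bsub>adj T\<^esub> (n - 2) \<in> Some ` J"
          using J'(3) powN NM x(2) by blast
        then show ?thesis using e2(1) by (simp add: mult)
      qed
      define H where "H = N.max_subgroup e"
      interpret H: Group.group H unfolding H_def by (rule N.group_max_subgroup[OF e(1,2)])
      have multH: "mult H = mult (adj S)" using N.max_subgroup_simps(1)[OF e(1,2)] by (simp add: H_def mult)
      have HJ: "carrier H \<subseteq> Some ` J"
      proof
        fix g assume "g \<in> carrier H"
        then have "g \<in> carrier (adj T)" "e \<otimes>\<^bsub>adj T\<^esub> g = g"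
          using N.max_subgroup_e[OF e(1,2)] by (auto simp: H_def)
        then show "g \<in> Some ` J" using good_ideal_adj(3)[OF S J _ eJ, of g] NM by (auto simp: mult)
      qed
      obtain F0 where F0: "finite F0" "F0 \<subseteq> carrier T" "\<forall>x\<in>carrier T. \<exists>y\<in>F0. (x, y) \<in> greenH T"
        using HT[folded T_def] unfolding H_finite_def finite_quotient_iff[OF green_equiv(3)] by blast
      obtain Y where Y: "finite Y" "Y \<subseteq> carrier H" "generate H Y = carrier H"
        unfolding H_def
      proof (rule N.max_subgroup_finitely_generated[OF e(1,2), of "Some ` B" "insert None (Some ` F0)"])
        show "P w" if "w \<in> carrier (adj T)" "P \<one>\<^bsub>adj T\<^esub>"
          "\<And>x a. x \<in> carrier (adj T) \<Longrightarrow> P x \<Longrightarrow> a \<in> Some ` B \<Longrightarrow> P (x \<otimes>\<^bsub>adj T\<^esub> a)" for P w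
          by (rule adj_induct_right[OF T, of B]) (use that in \<open>auto simp: T_def intro: sgenerate.base\<close>)
        show "\<exists>r\<in>insert None (Some ` F0). Rrel (adj T) e r \<and> Lrel (adj T) y r"
          if y: "y \<in> carrier (adj T)" "Rrel (adj T) e y" for y
        proof (cases y)
          case None
          then show ?thesis using y N.Lrel_refl by blast
        next
          case (Some s)
          then obtain r where r: "r \<in> F0" "(s, r) \<in> greenH T" using F0(3) y(1) by auto
          then have "Rrel (adj T) (Some s) (Some r)" "Lrel (adj T) (Some s) (Some r)" "r \<in> carrier T"
            unfolding greenH_def by (auto simp: greenR_Rrel[OF T] greenL_Lrel[OF T])
          then show ?thesis using r(1) y(2) Some N.Rrel_trans[OF e(1)] by auto
        qed
      qed (use B F0 that in \<open>auto simp: carrier_adj carrier_T intro: sgenerate.base\<close>)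
      have "R_small S ((\<lambda>g. g \<otimes>\<^bsub>adj S\<^esub> a) ` carrier H)"
        using L_quotient_in_variety[OF E J H.is_group multH HJ Y a] no_L by blast
      moreover have "Some y \<in> carrier H" if "y \<in> c" for y
      proof -
        have "(x0, x) \<in> greenH T" "(x0, y) \<in> greenH T" using x(1) that x0(2) by auto
        then have "(x, y) \<in> greenH T"
          using green_equiv(3)[of T] unfolding equiv_def by (meson symE transE)
        then have "Rrel (adj T) (Some x) (Some y)" "Lrel (adj T) (Some x) (Some y)" "y \<in> carrier T"
          unfolding greenH_def by (auto simp: greenR_Rrel[OF T] greenL_Lrel[OF T])
        then show ?thesis
          unfolding H_def N.max_subgroup_carrier[OF e(1,2)]
          using N.Rrel_trans[OF e(1) _ Rex(1)] N.Lrel_trans[OF e(1) _ Rex(2)] by simp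
      qed
      then have "(\<lambda>x. Some x \<otimes>\<^bsub>adj S\<^esub> a) ` c \<subseteq> (\<lambda>g. g \<otimes>\<^bsub>adj S\<^esub> a) ` carrier H" by blast
      ultimately show ?thesis by (rule R_small_mono)
    qed
  qed
  have "finite (carrier T // greenH T)" using HT by (simp add: H_finite_def T_def)
  then have "R_small S (\<Union>c\<in>carrier T // greenH T. (\<lambda>x. Some x \<otimes>\<^bsub>adj S\<^esub> a) ` c)"
    using small by (rule R_small_UN)
  moreover have "\<Union>(carrier T // greenH T) = sgenerate S B"
    using Union_quotient[OF green_equiv(3), of T] by (simp add: carrier_T)
  ultimately show ?thesis by (metis image_Union)
qed

lemma finite_R_quotient:
  assumes S: "is_semigroup S"
    and Q: "R_small S Q" "Q \<subseteq> carrier (adj S)" "\<And>x. x \<in> carrier S \<Longrightarrow> \<exists>y\<in>Q. Rrel (adj S) (Some x) y"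
  shows "finite (carrier S // greenR S)"
proof -
  interpret M: Group.monoid "adj S" using S by (rule monoid_adj)
  obtain F where F: "finite F" "F \<subseteq> carrier (adj S)" "\<And>x. x \<in> Q \<Longrightarrow> \<exists>y\<in>F. Rrel (adj S) x y"
    using Q(1) unfolding R_small_def by blast
  have "carrier S // greenR S \<subseteq> (\<lambda>y. {x \<in> carrier S. Rrel (adj S) (Some x) y}) ` F"
  proof
    fix c assume "c \<in> carrier S // greenR S"
    then obtain x where x: "x \<in> carrier S" "c = greenR S `` {x}" by (rule quotientE)
    obtain z where z: "z \<in> Q" "Rrel (adj S) (Some x) z" using Q(3)[OF x(1)] by blast
    obtain y where y: "y \<in> F" "Rrel (adj S) z y" using F(3)[OF z(1)] by blast
    have yM: "y \<in> carrier (adj S)" using y(1) F(2) by blast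
    have xy: "Rrel (adj S) (Some x) y" using M.Rrel_trans[OF _ yM z(2) y(2)] x(1) by simp
    have "Rrel (adj S) (Some x) (Some x') \<longleftrightarrow> Rrel (adj S) (Some x') y" if "x' \<in> carrier S" for x'
    proof
      assume "Rrel (adj S) (Some x) (Some x')"
      from M.Rrel_trans[OF _ yM M.Rrel_sym[OF this] xy] that show "Rrel (adj S) (Some x') y" by simp
    next
      assume "Rrel (adj S) (Some x') y"
      from M.Rrel_trans[OF _ _ xy M.Rrel_sym[OF this]] that x(1)
      show "Rrel (adj S) (Some x) (Some x')" by simp
    qed
    then have "c = {x' \<in> carrier S. Rrel (adj S) (Some x') y}"
      unfolding x(2) using x(1) by (auto simp: greenR_Rrel[OF S])
    with y(1) show "c \<in> (\<lambda>y. {x \<in> carrier S. Rrel (adj S) (Some x) y}) ` F" by blast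
  qed
  then show ?thesis using F(1) by (meson finite_imageI finite_subset)
qed

text \<open>Up to \<open>\<R>\<close>, an element of the ideal is the shortest prefix that lies in the ideal and
  involves all its generators; the last letter of this prefix is either new or completes a
  word from outside the ideal.\<close>

lemma finite_R_step:
  fixes S :: "'x semigrp"
  assumes E: "semigroup_identities E" "posN \<notin> variety E" "S \<in> variety E" and J: "good_ideal J S"
    and no_L: "\<And>G :: 'x option set monoid. novikov_adian G \<Longrightarrow> L_semigrp G \<notin> variety E"
    and A: "finite A" "A \<subseteq> carrier S" "sgenerate S A = carrier S"
    and IH: "\<And>B. B \<subset> A \<Longrightarrow> B \<noteq> {} \<Longrightarrow> H_finite (sub_semigrp S (sgenerate S B))"
  shows "finite (carrier S // greenR S)"
proof -
  have S: "is_semigroup S" using E(3) by (rule variety_semigroup)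
  interpret M: Group.monoid "adj S" using S by (rule monoid_adj)
  let ?X = "\<lambda>a. (\<lambda>x. Some x \<otimes>\<^bsub>adj S\<^esub> Some a) ` sgenerate S (A - {a})"
  have small: "R_small S (?X a)" if "a \<in> A" for a
  proof (cases "A - {a} = {}")
    case True
    then show ?thesis unfolding True by (simp add: R_small_finite[OF S])
  next
    case False
    have "finite (A - {a})" "A - {a} \<subseteq> carrier S" "A - {a} \<subset> A" "Some a \<in> carrier (adj S)"
      using A that by auto
    then show ?thesis using translates_R_finite[OF E J no_L _ _ False IH[OF _ False]] by blast
  qed
  \<comment> \<open>The finite part of the representatives: a prefix that has just entered
    \<open>J\<close> is a letter or an element outside \<open>J\<close> followed by a
    letter.\<close>
  define Q' where "Q' = Some ` (carrier S - J) \<union> Some ` A \<union>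
    (\<lambda>(x, a). Some (x \<cdot>\<^bsub>S\<^esub> a)) ` ((carrier S - J) \<times> A)"
  define Q where "Q = Q' \<union> (\<Union>a\<in>A. ?X a)"
  have "finite (carrier S - J)" using J by (simp add: good_ideal_def)
  then have Q': "finite Q'" "Q' \<subseteq> carrier (adj S)" using A(1,2) semigroup_closed[OF S] by (auto simp: Q'_def)
  have smallQ: "R_small S Q"
    unfolding Q_def by (rule R_small_Un[OF R_small_finite[OF S Q'] R_small_UN[OF A(1) small]])
  have "sgenerate S (A - {a}) \<subseteq> carrier S" for a using sgenerate_subset[OF S] A(2) by blast
  then have "Some x \<otimes>\<^bsub>adj S\<^esub> Some a \<in> carrier (adj S)" if "a \<in> A" "x \<in> sgenerate S (A - {a})" for a x
    using that A(2) by (intro M.m_closed) auto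
  then have QM: "Q \<subseteq> carrier (adj S)" unfolding Q_def using Q'(2) by blast
  \<comment> \<open>The induction carries the set \<open>B\<close> of letters read so far together
    with the fact that each of them divides w; a repeated letter can then be absorbed.\<close>
  have "\<exists>B\<subseteq>A. w \<in> sgenerate S B \<and>
      (\<forall>b\<in>B. \<exists>u\<in>carrier (adj S). \<exists>v\<in>carrier (adj S). Some w = u \<otimes>\<^bsub>adj S\<^esub> Some b \<otimes>\<^bsub>adj S\<^esub> v) \<and>
      (\<exists>y\<in>Q. Rrel (adj S) (Some w) y)" if "w \<in> carrier S" for w
  proof -
    have "w \<in> sgenerate S A" using that A(3) by simp
    with S A(2) show ?thesis
    proof (induction rule: sgenerate_induct_right)
      case (base a)
      have "\<exists>u\<in>carrier (adj S). \<exists>v\<in>carrier (adj S). Some a = u \<otimes>\<^bsub>adj S\<^esub> Some a \<otimes>\<^bsub>adj S\<^esub> v"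
        by (intro bexI[of _ None]) auto
      moreover have "\<exists>y\<in>Q. Rrel (adj S) (Some a) y"
        using base A(2) M.Rrel_refl by (intro bexI[of _ "Some a"]) (auto simp: Q_def Q'_def)
      ultimately show ?case
        using base by (intro exI[of _ "{a}"]) (simp add: sgenerate.base)
    next
      case (step w a)
      have wS: "w \<in> carrier S" and aS: "a \<in> carrier S" using step A by auto
      then have waS: "w \<cdot>\<^bsub>S\<^esub> a \<in> carrier S" by (rule semigroup_closed[OF S])
      obtain B where B: "B \<subseteq> A" "w \<in> sgenerate S B"
        "\<And>b. b \<in> B \<Longrightarrow> \<exists>u\<in>carrier (adj S). \<exists>v\<in>carrier (adj S). Some w = u \<otimes>\<^bsub>adj S\<^esub> Some b \<otimes>\<^bsub>adj S\<^esub> v"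
        "\<exists>y\<in>Q. Rrel (adj S) (Some w) y"
        using step.IH by blast
      have gen: "w \<cdot>\<^bsub>S\<^esub> a \<in> sgenerate S (insert a B)"
        using sgenerate.prod[of w S "insert a B" a] B(2) sgenerate_mono[of B "insert a B" S]
        by (auto intro: sgenerate.base)
      have div: "\<exists>u\<in>carrier (adj S). \<exists>v\<in>carrier (adj S). Some (w \<cdot>\<^bsub>S\<^esub> a) = u \<otimes>\<^bsub>adj S\<^esub> Some b \<otimes>\<^bsub>adj S\<^esub> v"
        if "b \<in> insert a B" for b
      proof (cases "b = a")
        case True
        then show ?thesis using wS by (intro bexI[of _ "Some w"] bexI[of _ None]) auto
      next
        case False
        then have b: "b \<in> B" "Some b \<in> carrier (adj S)" using that B(1) A(2) by auto
        obtain u v where uv: "u \<in> carrier (adj S)" "v \<in> carrier (adj S)" "Some w = u \<otimes>\<^bsub>adj S\<^esub> Some b \<otimes>\<^bsub>adj S\<^esub> v"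
          using B(3)[OF b(1)] by blast
        have "Some (w \<cdot>\<^bsub>S\<^esub> a) = u \<otimes>\<^bsub>adj S\<^esub> Some b \<otimes>\<^bsub>adj S\<^esub> v \<otimes>\<^bsub>adj S\<^esub> Some a"
          unfolding uv(3)[symmetric] by simp
        also have "\<dots> = u \<otimes>\<^bsub>adj S\<^esub> Some b \<otimes>\<^bsub>adj S\<^esub> (v \<otimes>\<^bsub>adj S\<^esub> Some a)"
          by (rule M.m_assoc) (use uv b aS in auto)
        finally show ?thesis using uv(1,2) aS by (metis M.m_closed adj_simps(1))
      qed
      have "\<exists>y\<in>Q. Rrel (adj S) (Some (w \<cdot>\<^bsub>S\<^esub> a)) y"
      proof (cases "a \<in> B")
        case False
        then have "w \<in> sgenerate S (A - {a})" using B(1,2) sgenerate_mono[of B "A - {a}" S] by blast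
        then have "Some w \<otimes>\<^bsub>adj S\<^esub> Some a \<in> Q" using step.hyps(2) unfolding Q_def by blast
        then show ?thesis using M.Rrel_refl QM by (intro bexI[of _ "Some (w \<cdot>\<^bsub>S\<^esub> a)"]) auto
      next
        case True
        show ?thesis
        proof (cases "w \<in> J")
          case False
          then have "Some (w \<cdot>\<^bsub>S\<^esub> a) \<in> Q" using wS step.hyps(2) by (force simp: Q_def Q'_def)
          moreover have "Rrel (adj S) (Some (w \<cdot>\<^bsub>S\<^esub> a)) (Some (w \<cdot>\<^bsub>S\<^esub> a))"
            by (rule M.Rrel_refl) (use waS in simp)
          ultimately show ?thesis by blast
        next
          case True
          obtain u v where uv: "u \<in> carrier (adj S)" "v \<in> carrier (adj S)" "Some w = u \<otimes>\<^bsub>adj S\<^esub> Some a \<otimes>\<^bsub>adj S\<^esub> v"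
            using B(3)[OF \<open>a \<in> B\<close>] by blast
          \<comment> \<open>The letter a already divides w, which lies in \<open>J\<close>, so
            appending it does not leave the R-class and the old representative still serves.\<close>
          have "Rrel (adj S) (Some w) (Some (w \<cdot>\<^bsub>S\<^esub> a))"
            using good_ideal_Rrel_mult[OF E J _ uv(1) _ uv(2,3)] True aS by simp
          moreover obtain y where "y \<in> Q" "Rrel (adj S) (Some w) y" using B(4) by blast
          ultimately show ?thesis
            using M.Rrel_trans[of "Some (w \<cdot>\<^bsub>S\<^esub> a)" y "Some w"] M.Rrel_sym waS QM by auto
        qed
      qed
      then show ?case
        using gen div B(1) step.hyps(2) by (intro exI[of _ "insert a B"]) blast
    qed
  qed
  then show ?thesis using finite_R_quotient[OF S smallQ QM] by blast
qed

text \<open>Induction on the generating set: a proper nonempty subset generates another member of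
  the variety, with its own good ideal. H-finiteness is self-dual, so one induction hypothesis
  serves both for R-classes and, in the opposite semigroup, for L-classes.\<close>

lemma H_finite_of_good_ideals:
  fixes S :: "'x semigrp"
  assumes E: "semigroup_identities E" "posN \<notin> variety E"
    and ideals: "\<And>S :: 'x semigrp. S \<in> variety E \<Longrightarrow> fin_generated S \<Longrightarrow> \<exists>J. good_ideal J S"
    and no_L: "\<And>G :: 'x option set monoid. novikov_adian G \<Longrightarrow>
      L_semigrp G \<notin> variety E \<and> L_semigrp G \<notin> variety (rev_ids E)"
    and S: "S \<in> variety E" and A: "finite A" "A \<subseteq> carrier S" "sgenerate S A = carrier S"
  shows "H_finite S"
  using A S
proof (induction A arbitrary: S rule: finite_psubset_induct)
  case (psubset A)
  have S: "is_semigroup S" using psubset.prems(3) by (rule variety_semigroup)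
  obtain J where J: "good_ideal J S"
    using ideals[OF psubset.prems(3)] psubset.hyps psubset.prems(1,2) unfolding fin_generated_def by blast
  have IH: "H_finite (sub_semigrp S (sgenerate S B))" if B: "B \<subset> A" "B \<noteq> {}" for B
  proof (rule psubset.IH[OF B(1)])
    have BS: "B \<subseteq> carrier S" using B psubset.prems(1) by blast
    show "sub_semigrp S (sgenerate S B) \<in> variety E"
      using variety_sub[OF E(1) psubset.prems(3) BS B(2)] .
  qed (auto intro: sgenerate.base)
  have "opp posN = posN" by (simp add: opp_def posN_def add.commute)
  then have rev: "semigroup_identities (rev_ids E)" "posN \<notin> variety (rev_ids E)"
    "opp S \<in> variety (rev_ids E)"
    using E opp_variety_iff[OF E(1), of posN] opp_variety[OF E(1) psubset.prems(3)] by simp_all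
  have "finite (carrier S // greenR S)"
    by (rule finite_R_step[OF E psubset.prems(3) J _ psubset.hyps psubset.prems(1,2) IH]) (use no_L in blast)
  moreover have "finite (carrier (opp S) // greenR (opp S))"
  proof (rule finite_R_step[OF rev good_ideal_opp[OF S J] _ psubset.hyps])
    fix B assume "B \<subset> A" "B \<noteq> {}"
    moreover have "sub_semigrp (opp S) (sgenerate (opp S) B) = opp (sub_semigrp S (sgenerate S B))"
      unfolding sgenerate_opp by (simp add: opp_def)
    ultimately show "H_finite (sub_semigrp (opp S) (sgenerate (opp S) B))" using IH by (simp only: H_finite_opp)
  qed (use psubset.prems no_L in auto)
  ultimately show ?case by (simp add: H_finite_iff green_opp)
qed

subsection \<open>Ideals under change of the underlying type\<close>

lemma completely_regular_finite_order:
  assumes S: "is_semigroup S" and J: "is_ideal J S"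
    and per: "periodic (sub_semigrp S J)" and cr: "completely_regular (sub_semigrp S J)" and x: "x \<in> J"
  shows "\<exists>n\<ge>2. Some x [^]\<^bsub>adj S\<^esub> (n::nat) = Some x"
proof -
  interpret M: Group.monoid "adj S" using S by (rule monoid_adj)
  have JS: "J \<subseteq> carrier S" using J by (simp add: is_ideal_def)
  have "J = \<Union>{T. is_subgroup_of T (sub_semigrp S J)}" using cr by (simp add: completely_regular_def)
  from subsetD[OF equalityD1[OF this] x]
  obtain T e where T: "x \<in> T" "T \<subseteq> J" and grp: "Group.group \<lparr>carrier = T, mult = sprod S, one = e\<rparr>"
    unfolding is_subgroup_of_def by auto
  define G where "G = \<lparr>carrier = T, mult = sprod S, one = e\<rparr>"
  interpret G: Group.group G using grp by (simp add: G_def)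
  have xG: "x \<in> carrier G" using T by (simp add: G_def)
  \<comment> \<open>Exponents are shifted by one because the zeroth power in \<open>adj S\<close> is
    the adjoined identity, not that of the subgroup.\<close>
  have pow: "Some x [^]\<^bsub>adj S\<^esub> (Suc n) = Some (x [^]\<^bsub>G\<^esub> Suc n)" for n :: nat
  proof (induction n)
    case 0
    then show ?case using T JS G.l_one[OF xG] by (auto simp: G_def)
  next
    case (Suc n)
    have "Some x [^]\<^bsub>adj S\<^esub> Suc (Suc n) = Some x [^]\<^bsub>adj S\<^esub> Suc n \<otimes>\<^bsub>adj S\<^esub> Some x" by simp
    also have "\<dots> = Some (x [^]\<^bsub>G\<^esub> Suc n \<cdot>\<^bsub>S\<^esub> x)" unfolding Suc by simp
    also have "\<dots> = Some (x [^]\<^bsub>G\<^esub> Suc (Suc n))" by (simp add: G_def)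
    finally show ?case .
  qed
  have gen: "x [^]\<^bsub>G\<^esub> Suc n \<in> sgenerate S {x}" for n :: nat
  proof (induction n)
    case 0
    then show ?case using xG by (auto intro: sgenerate.base)
  next
    case (Suc n)
    have "x [^]\<^bsub>G\<^esub> Suc n \<cdot>\<^bsub>S\<^esub> x \<in> sgenerate S {x}" using Suc by (intro sgenerate.prod) (auto intro: sgenerate.base)
    then show ?case by (simp add: G_def)
  qed
  have "finite (sgenerate S {x})" using per x by (simp add: periodic_def)
  then have "finite (range (\<lambda>n::nat. x [^]\<^bsub>G\<^esub> Suc n))" using gen by (meson finite_subset image_subsetI)
  then have "\<not> inj (\<lambda>n::nat. x [^]\<^bsub>G\<^esub> Suc n)" using finite_imageD infinite_UNIV_nat by blast
  then obtain i j :: nat where ij: "i < j" "x [^]\<^bsub>G\<^esub> Suc i = x [^]\<^bsub>G\<^esub> Suc j"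
    unfolding inj_def by (metis linorder_neqE_nat)
  define d where "d = j - i"
  have d: "Suc j = Suc i + d" "d \<ge> 1" using ij(1) by (auto simp: d_def)
  have "x [^]\<^bsub>G\<^esub> Suc i \<otimes>\<^bsub>G\<^esub> x [^]\<^bsub>G\<^esub> d = x [^]\<^bsub>G\<^esub> Suc i"
    unfolding G.nat_pow_mult[OF xG] d(1)[symmetric] using ij(2) by simp
  then have "x [^]\<^bsub>G\<^esub> d = \<one>\<^bsub>G\<^esub>" using xG G.l_cancel_one[of "x [^]\<^bsub>G\<^esub> Suc i" "x [^]\<^bsub>G\<^esub> d"] by simp
  then have "x [^]\<^bsub>G\<^esub> Suc d = x" using xG by simp
  then show ?thesis using pow[of d] d(2) by (intro exI[of _ "Suc d"]) simp
qed

text \<open>A product outside \<open>J\<close> has both factors outside \<open>J\<close>, so the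
  complement embeds into the part of the Rees quotient generated by the finitely many generators
  outside \<open>J\<close>.\<close>

lemma locally_finite_extension_finite_complement:
  assumes S: "is_semigroup S" "fin_generated S" and J: "locally_finite_extension S J"
  shows "finite (carrier S - J)"
proof -
  obtain A where A: "finite A" "A \<subseteq> carrier S" "sgenerate S A = carrier S"
    using S(2) by (auto simp: fin_generated_def)
  have idl: "is_ideal J S" and lf: "locally_finite (rees_quotient S J)"
    using J by (auto simp: locally_finite_extension_def)
  have "finite (Some ` (A - J))" "Some ` (A - J) \<subseteq> carrier (rees_quotient S J)"
    using A(1,2) by (auto simp: rees_quotient_def)
  then have "finite (sgenerate (rees_quotient S J) (Some ` (A - J)))"
    using lf unfolding locally_finite_def by blast
  moreover have "x \<notin> J \<longrightarrow> Some x \<in> sgenerate (rees_quotient S J) (Some ` (A - J))" if "x \<in> sgenerate S A" for x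
    using that
  proof induction
    case (prod x y)
    show ?case
    proof
      assume xy: "x \<cdot>\<^bsub>S\<^esub> y \<notin> J"
      have "x \<in> carrier S" "y \<in> carrier S" using prod(1,2) A(3) by auto
      then have "x \<notin> J" "y \<notin> J" using xy idl unfolding is_ideal_def by blast+
      then have "Some x \<in> sgenerate (rees_quotient S J) (Some ` (A - J))"
        "Some y \<in> sgenerate (rees_quotient S J) (Some ` (A - J))" using prod by auto
      from sgenerate.prod[OF this] show "Some (x \<cdot>\<^bsub>S\<^esub> y) \<in> sgenerate (rees_quotient S J) (Some ` (A - J))"
        using xy by (simp add: rees_quotient_def)
    qed
  qed (auto intro: sgenerate.base)
  ultimately have "finite (Some ` (carrier S - J))" using A(3) by (auto elim!: finite_subset[rotated])
  then show ?thesis by (simp add: finite_image_iff)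
qed

lemma good_ideal_copy:
  assumes S: "is_semigroup S" and inj: "inj_on f (carrier S)" and J: "good_ideal J (copy f S)"
  shows "\<exists>J. good_ideal J S"
proof -
  interpret M: Group.monoid "adj S" using S by (rule monoid_adj)
  define I where "I = {x \<in> carrier S. f x \<in> J}"
  have idl: "is_ideal J (copy f S)" and fin: "finite (carrier (copy f S) - J)"
    and order: "\<forall>x\<in>J. \<exists>n\<ge>2. Some x [^]\<^bsub>adj (copy f S)\<^esub> (n::nat) = Some x"
    using J by (auto simp: good_ideal_def)
  have car: "carrier (copy f S) = f ` carrier S" by (rule carrier_copy[OF S inj])
  have "is_ideal I S"
    unfolding is_ideal_def
  proof (intro conjI ballI)
    show "I \<noteq> {}" using idl unfolding is_ideal_def car by (auto simp: I_def)
    show "I \<subseteq> carrier S" by (auto simp: I_def)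
    fix s x assume s: "s \<in> carrier S" and x: "x \<in> I"
    then have xS: "x \<in> carrier S" by (simp add: I_def)
    show "s \<cdot>\<^bsub>S\<^esub> x \<in> I"
      using s x xS idl semigroup_closed[OF S s xS] copy_hom[OF S inj s xS]
      unfolding is_ideal_def car by (simp add: I_def)
    show "x \<cdot>\<^bsub>S\<^esub> s \<in> I"
      using s x xS idl semigroup_closed[OF S xS s] copy_hom[OF S inj xS s]
      unfolding is_ideal_def car by (simp add: I_def)
  qed
  moreover have "f ` (carrier S - I) \<subseteq> carrier (copy f S) - J" by (auto simp: I_def car)
  then have "finite (f ` (carrier S - I))" using fin finite_subset by blast
  then have "finite (carrier S - I)" using inj by (meson Diff_subset finite_imageD inj_on_subset)
  moreover have "\<exists>n\<ge>2. Some x [^]\<^bsub>adj S\<^esub> (n::nat) = Some x" if x: "x \<in> I" for x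
  proof -
    have xS: "x \<in> carrier S" "f x \<in> J" using x by (auto simp: I_def)
    have pow: "Some (f x) [^]\<^bsub>adj (copy f S)\<^esub> n = map_option f (Some x [^]\<^bsub>adj S\<^esub> n)" for n :: nat
    proof (induction n)
      case (Suc n)
      have "Some x [^]\<^bsub>adj S\<^esub> n \<in> carrier (adj S)" using xS by simp
      then show ?case using Suc xS(1) copy_hom[OF S inj] by (auto simp: carrier_adj)
    qed simp
    obtain n :: nat where n: "n \<ge> 2" "Some (f x) [^]\<^bsub>adj (copy f S)\<^esub> n = Some (f x)" using order xS(2) by blast
    obtain y where y: "y \<in> carrier S" "Some x [^]\<^bsub>adj S\<^esub> n = Some y"
      using adj_pow_carrier[OF S, of "Some x" n] xS n(1) by auto
    then have "f y = f x" using pow[of n] n(2) by simp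
    then show ?thesis using inj xS(1) y n(1) by (auto simp: inj_on_eq_iff)
  qed
  ultimately show ?thesis unfolding good_ideal_def by blast
qed

text \<open>Finite generation acts twice: countability provides a copy on the type where condition
  (2) is assumed, and it turns local finiteness of the quotient into a finite complement.\<close>

lemma good_ideal_transfer:
  fixes S :: "'x semigrp"
  assumes ext: "\<And>S :: 'c::infinite semigrp. S \<in> variety E \<Longrightarrow> \<exists>J. locally_finite_extension S J \<and>
      periodic (sub_semigrp S J) \<and> completely_regular (sub_semigrp S J)"
    and "semigroup_identities E" "S \<in> variety E" "fin_generated S"
  shows "\<exists>J. good_ideal J S"
proof -
  have S: "is_semigroup S" using assms(3) by (rule variety_semigroup)
  obtain f :: "'x \<Rightarrow> 'c" where inj: "inj_on f (carrier S)"
    using countable_inj_infinite fin_generated_countable[OF S assms(4)] by blast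
  have C: "copy f S \<in> variety E" "fin_generated (copy f S)"
    using copy_variety[OF S inj assms(2,3)] copy_fin_generated[OF S inj assms(4)] .
  have semi: "is_semigroup (copy f S)" using C(1) by (rule variety_semigroup)
  obtain J where J: "locally_finite_extension (copy f S) J" "periodic (sub_semigrp (copy f S) J)"
    "completely_regular (sub_semigrp (copy f S) J)" using ext[OF C(1)] by blast
  then have "is_ideal J (copy f S)" by (simp add: locally_finite_extension_def)
  then have "good_ideal J (copy f S)"
    unfolding good_ideal_def
    using locally_finite_extension_finite_complement[OF semi C(2) J(1)]
      completely_regular_finite_order[OF semi _ J(2,3)] by blast
  then show ?thesis using good_ideal_copy[OF S inj] by blast
qed

text \<open>Additively, the n-th power of x is n x, which differs from x for n at least 2. Thus
  condition (2) excludes the positive integers, which is the source of the uniform idempotent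
  exponent.\<close>

lemma posN_no_good_ideal: "\<not> good_ideal J posN"
proof
  assume J: "good_ideal J posN"
  then obtain x where x: "x \<in> J" "x \<ge> 1" unfolding good_ideal_def is_ideal_def by auto
  then obtain n :: nat where n: "n \<ge> 2" "Some x [^]\<^bsub>adj posN\<^esub> n = Some x" using J by (auto simp: good_ideal_def)
  have "Some x [^]\<^bsub>adj posN\<^esub> Suc k = Some (Suc k * x)" for k :: nat
    by (induction k) auto
  from this[of "n - 1"] n have "n * x = x" by simp
  then show False using x(2) n(1) by simp
qed

subsection \<open>Novikov--Adian groups\<close>

lemma countable_generate:
  assumes "Group.group G" "finite A" "A \<subseteq> carrier G"
  shows "countable (generate G A)"
proof -
  interpret G: Group.group G by (rule assms(1))
  define S where "S = \<lparr>carrier = carrier G, sprod = mult G\<rparr>"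
  have S: "is_semigroup S" using G.one_closed by (auto simp: is_semigroup_def S_def G.m_assoc)
  define B where "B = insert \<one>\<^bsub>G\<^esub> (A \<union> (\<lambda>a. inv\<^bsub>G\<^esub> a) ` A)"
  have B: "finite B" "B \<subseteq> carrier S" using assms by (auto simp: B_def S_def)
  have "x \<in> sgenerate S B" if "x \<in> generate G A" for x
    using that
  proof induction
    case (eng x y)
    from sgenerate.prod[OF eng(3,4)] show ?case by (simp add: S_def)
  qed (auto simp: B_def intro: sgenerate.base)
  then show ?thesis
    using countable_sgenerate[OF S B(2)] B(1) by (meson countable_finite countable_subset subsetI)
qed

text \<open>Finite generation makes the group countable, so it can be rebuilt on any infinite type;
  the corresponding semigroup embeds back into L(G) and stays in the variety.\<close>

lemma novikov_adian_transfer: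
  fixes G :: "'x monoid"
  assumes E: "semigroup_identities E" and G: "novikov_adian G" and L: "L_semigrp G \<in> variety E"
  shows "\<exists>G' :: 'd::infinite monoid. novikov_adian G' \<and> L_semigrp G' \<in> variety E"
proof -
  interpret G: Group.group G using G by (simp add: novikov_adian_def)
  obtain A where A: "finite A" "A \<subseteq> carrier G" "generate G A = carrier G"
    using G by (auto simp: novikov_adian_def)
  obtain n :: nat where n: "n > 0" "\<And>x. x \<in> carrier G \<Longrightarrow> x [^]\<^bsub>G\<^esub> n = \<one>\<^bsub>G\<^esub>"
    using G by (auto simp: novikov_adian_def)
  obtain f :: "'x \<Rightarrow> 'd" where inj: "inj_on f (carrier G)"
    using countable_inj_infinite countable_generate[OF G.is_group A(1,2)] A(3) by metis
  define g where "g = inv_into (carrier G) f"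
  have gf: "g (f x) = x" if "x \<in> carrier G" for x using inj that by (simp add: g_def)
  define G' where "G' = \<lparr>carrier = f ` carrier G, mult = (\<lambda>x y. f (g x \<otimes>\<^bsub>G\<^esub> g y)), one = f \<one>\<^bsub>G\<^esub>\<rparr>"
  have car: "carrier G' = f ` carrier G" by (simp add: G'_def)
  have "infinite (carrier G)" using G by (simp add: novikov_adian_def)
  then have inf: "infinite (carrier G')" unfolding car finite_image_iff[OF inj] .
  have "Group.group G'"
  proof (rule groupI)
    fix x assume "x \<in> carrier G'"
    then obtain x' where x': "x' \<in> carrier G" "x = f x'" by (auto simp: G'_def)
    then have "f (inv\<^bsub>G\<^esub> x') \<otimes>\<^bsub>G'\<^esub> x = \<one>\<^bsub>G'\<^esub>" by (simp add: G'_def gf)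
    moreover have "f (inv\<^bsub>G\<^esub> x') \<in> carrier G'" using x' by (simp add: G'_def)
    ultimately show "\<exists>y\<in>carrier G'. y \<otimes>\<^bsub>G'\<^esub> x = \<one>\<^bsub>G'\<^esub>" by blast
  qed (auto simp: G'_def gf G.m_assoc)
  then interpret G': Group.group G' .
  have G'_mult: "f x \<otimes>\<^bsub>G'\<^esub> f y = f (x \<otimes>\<^bsub>G\<^esub> y)" if "x \<in> carrier G" "y \<in> carrier G" for x y
    using that by (simp add: G'_def gf)
  have g_mult: "g (f x \<otimes>\<^bsub>G'\<^esub> f y) = x \<otimes>\<^bsub>G\<^esub> y" if "x \<in> carrier G" "y \<in> carrier G" for x y
    using that by (simp add: G'_def gf)
  have hom: "f \<in> hom G G'" unfolding hom_def car using G'_mult by auto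
  interpret f: group_hom G G' f by unfold_locales (rule hom)
  have "generate G' (f ` A) = carrier G'"
    unfolding f.generate_img[OF A(2)] A(3) car ..
  moreover have "x [^]\<^bsub>G'\<^esub> n = \<one>\<^bsub>G'\<^esub>" if "x \<in> carrier G'" for x
  proof -
    from that[unfolded car] obtain y where y: "x = f y" "y \<in> carrier G" by (rule imageE)
    show ?thesis unfolding y(1) f.hom_nat_pow[OF y(2), symmetric] n(2)[OF y(2)] by (rule f.hom_one)
  qed
  ultimately have NA: "novikov_adian G'"
    unfolding novikov_adian_def using G'.is_group inf A(1,2) n(1) car
    by (intro conjI exI[of _ "f ` A"] exI[of _ n] ballI) auto
  define h where "h = map_sum g g"
  have "L_semigrp G' \<in> variety E"
  proof (rule variety_inj[OF E L, where f = h])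
    show "carrier (L_semigrp G') \<noteq> {}" using G'.one_closed unfolding L_semigrp_simps(2) by blast
    show "x \<cdot>\<^bsub>L_semigrp G'\<^esub> y \<in> carrier (L_semigrp G')"
      if "x \<in> carrier (L_semigrp G')" "y \<in> carrier (L_semigrp G')" for x y
      using that unfolding L_semigrp_simps by (auto elim!: PlusE)
    show "h x \<in> carrier (L_semigrp G)" if "x \<in> carrier (L_semigrp G')" for x
      using that unfolding L_semigrp_simps(2) car by (auto simp: h_def gf elim!: PlusE)
    show "h (x \<cdot>\<^bsub>L_semigrp G'\<^esub> y) = h x \<cdot>\<^bsub>L_semigrp G\<^esub> h y"
      if "x \<in> carrier (L_semigrp G')" "y \<in> carrier (L_semigrp G')" for x y
      using that unfolding L_semigrp_simps car
      by (auto simp: h_def gf g_mult elim!: PlusE)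
    show "inj_on h (carrier (L_semigrp G'))"
      unfolding L_semigrp_simps(2) car
      by (rule inj_on_inverseI[where g = "map_sum f f"]) (auto simp: h_def gf elim!: PlusE)
  qed
  with NA show ?thesis by blast
qed

section \<open>Duality between L(G) and R(G)\<close>

definition group_opp :: "'g monoid \<Rightarrow> 'g monoid" where
  "group_opp G = \<lparr>carrier = carrier G, mult = (\<lambda>x y. y \<otimes>\<^bsub>G\<^esub> x), one = \<one>\<^bsub>G\<^esub>\<rparr>"

lemma novikov_adian_opp:
  assumes "novikov_adian G"
  shows "novikov_adian (group_opp G)"
proof -
  interpret G: Group.group G using assms by (simp add: novikov_adian_def)
  interpret O: Group.group "group_opp G"
  proof (rule groupI)
    fix x assume "x \<in> carrier (group_opp G)"
    then show "\<exists>y\<in>carrier (group_opp G). y \<otimes>\<^bsub>group_opp G\<^esub> x = \<one>\<^bsub>group_opp G\<^esub>"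
      by (intro bexI[of _ "inv\<^bsub>G\<^esub> x"]) (auto simp: group_opp_def)
  qed (auto simp: group_opp_def G.m_assoc)
  have inv_opp: "inv\<^bsub>group_opp G\<^esub> x = inv\<^bsub>G\<^esub> x" if "x \<in> carrier G" for x
    by (rule O.inv_equality) (use that in \<open>auto simp: group_opp_def\<close>)
  have pow: "x [^]\<^bsub>group_opp G\<^esub> n = x [^]\<^bsub>G\<^esub> n" if "x \<in> carrier G" for x and n :: nat
  proof (induction n)
    case (Suc n)
    then show ?case using G.nat_pow_Suc2[OF that, of n] by (simp add: group_opp_def)
  qed (simp add: group_opp_def)
  have gen: "x \<in> generate (group_opp G) A" if "x \<in> generate G A" "A \<subseteq> carrier G" for x A
    using that(1)
  proof induction
    case one
    then show ?case using generate.one[of "group_opp G" A] by (simp add: group_opp_def)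
  next
    case (inv h)
    then show ?case using generate.inv[of h A "group_opp G"] inv_opp that(2) by auto
  next
    case (eng x y)
    then show ?case using generate.eng[OF eng(4,3)] by (simp add: group_opp_def)
  qed (rule generate.incl)
  obtain A where A: "finite A" "A \<subseteq> carrier G" "generate G A = carrier G"
    using assms by (auto simp: novikov_adian_def)
  have "generate (group_opp G) A = carrier (group_opp G)"
    using gen[OF _ A(2)] A O.generate_incl[of A] by (auto simp: group_opp_def)
  then show ?thesis
    using assms A pow O.is_group unfolding novikov_adian_def by (auto simp: group_opp_def)
qed

text \<open>Reversing the product also reverses \<open>G\<close>, so the dual of R(G) is L of the
  opposite group, which is again Novikov--Adian.\<close>

lemma R_semigrp_eq_opp: "R_semigrp G = opp (L_semigrp (group_opp G))"
proof -
  have "R_prod G x y = L_prod (group_opp G) y x" for x y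
    by (cases x; cases y) (auto simp: group_opp_def)
  then have "R_prod G = (\<lambda>x y. L_prod (group_opp G) y x)" by (intro ext)
  moreover have "carrier (group_opp G) = carrier G" by (simp add: group_opp_def)
  ultimately show ?thesis by (simp add: R_semigrp_def L_semigrp_def opp_def)
qed

lemma R_semigrp_variety:
  assumes "semigroup_identities E"
  shows "R_semigrp G \<in> variety E \<longleftrightarrow> L_semigrp (group_opp G) \<in> variety (rev_ids E)"
  using opp_variety_iff[of "rev_ids E" "L_semigrp (group_opp G)"] assms
  by (simp add: R_semigrp_eq_opp)

section \<open>The equivalence across the four types\<close>

theorem theorem4p2:
  fixes E :: "(nat list \<times> nat list) set"
  assumes "semigroup_identities E"
    and "bounded_letters E"
  shows "(\<forall>S :: 'a::infinite semigrp. S \<in> variety E \<and> fin_generated S \<longrightarrow> H_finite S) \<longleftrightarrow>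
    ((\<forall>S :: 'b::infinite semigrp. S \<in> variety E \<longrightarrow> locally_finite S) \<or>
     ((\<forall>S :: 'c::infinite semigrp. S \<in> variety E \<longrightarrow>
         (\<exists>J. locally_finite_extension S J \<and>
              periodic (sub_semigrp S J) \<and> completely_regular (sub_semigrp S J))) \<and>
      (\<forall>G :: 'd::infinite monoid. novikov_adian G \<longrightarrow>
         L_semigrp G \<notin> variety E \<and> R_semigrp G \<notin> variety E)))"
    (is "?H \<longleftrightarrow> ?LF \<or> ?Ext \<and> ?NA")
proof
  assume H: ?H
  have lh: "locally_H_finite E"
    unfolding locally_H_finite_def using H_finite_transfer[where ?'a = 'a, OF _ assms(1)] H by blast
  show "?LF \<or> ?Ext \<and> ?NA"
  proof (cases ?LF)
    case False
    \<comment> \<open>The failure of local finiteness supplies the infinite finitely generated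
      member on which all exclusions of small semigroups rest.\<close>
    then obtain S :: "'b semigrp" and A where S: "S \<in> variety E"
      and A: "finite A" "A \<subseteq> carrier S" "infinite (sgenerate S A)"
      unfolding locally_finite_def by blast
    define T where "T = sub_semigrp S (sgenerate S A)"
    have "A \<noteq> {}" using A(3) by auto
    then have T: "T \<in> variety E" "fin_generated T" "infinite (carrier T)"
      using variety_sub[OF assms(1) S A(2)] fin_generated_sub[OF A(1)] A(3) by (simp_all add: T_def)
    have "?Ext" using locally_H_finite_imp_extension[OF assms(1) lh T] by blast
    moreover have "L_semigrp G \<notin> variety E \<and> R_semigrp G \<notin> variety E"
      if G: "novikov_adian G" for G :: "'d monoid"
    proof
      show "L_semigrp G \<notin> variety E" by (rule L_semigrp_not_locally_H_finite[OF assms(1) lh G])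
      have "semigroup_identities (rev_ids E)" using assms(1) by simp
      then show "R_semigrp G \<notin> variety E"
        unfolding R_semigrp_variety[OF assms(1)]
        by (rule L_semigrp_not_locally_H_finite[OF _ locally_H_finite_rev[OF assms(1) lh] novikov_adian_opp[OF G]])
    qed
    ultimately show ?thesis by blast
  qed simp
next
  assume "?LF \<or> ?Ext \<and> ?NA"
  then show ?H
  proof
    assume LF: ?LF
    then show ?H
      using locally_finite_transfer[where ?'a = 'b, OF _ assms(1)] H_finite_finite by blast
  next
    assume "?Ext \<and> ?NA"
    then have Ext: ?Ext and NA: ?NA by auto
    have ideals: "\<exists>J. good_ideal J S" if "S \<in> variety E" "fin_generated S" for S :: "'y semigrp"
      using good_ideal_transfer[where ?'c = 'c, OF _ assms(1) that] Ext by blast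
    have posN: "posN \<notin> variety E"
    proof
      assume "posN \<in> variety E"
      then have "\<exists>J. good_ideal J posN"
        using good_ideal_transfer[where ?'c = 'c, OF _ assms(1) _ fin_generated_posN] Ext by blast
      then show False using posN_no_good_ideal by blast
    qed
    \<comment> \<open>This type is the one of cosets in \<open>adj S\<close>, where the groups built
      from infinite orbits live.\<close>
    have no_L: "L_semigrp G \<notin> variety E \<and> L_semigrp G \<notin> variety (rev_ids E)"
      if G: "novikov_adian G" for G :: "'a option set monoid"
    proof
      show "L_semigrp G \<notin> variety E"
        using novikov_adian_transfer[where ?'d = 'd, OF assms(1) G] NA by blast
      show "L_semigrp G \<notin> variety (rev_ids E)"
      proof
        assume "L_semigrp G \<in> variety (rev_ids E)"
        then obtain G' :: "'d monoid" where G': "novikov_adian G'" "L_semigrp G' \<in> variety (rev_ids E)"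
          using novikov_adian_transfer[where ?'d = 'd, of "rev_ids E" G] G assms(1) by auto
        have "group_opp (group_opp G') = G'" by (simp add: group_opp_def)
        then have "R_semigrp (group_opp G') \<in> variety E"
          using R_semigrp_variety[OF assms(1), of "group_opp G'"] G'(2) by simp
        then show False using NA novikov_adian_opp[OF G'(1)] by blast
      qed
    qed
    show ?H
    proof (intro allI impI)
      fix S :: "'a semigrp" assume S: "S \<in> variety E \<and> fin_generated S"
      then obtain A where "finite A" "A \<subseteq> carrier S" "sgenerate S A = carrier S"
        by (auto simp: fin_generated_def)
      then show "H_finite S"
        using H_finite_of_good_ideals[OF assms(1) posN _ no_L] S
          good_ideal_transfer[where ?'c = 'c and ?'x = 'a, OF _ assms(1)] Ext by blast
    qed
  qed
qed


end
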